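(* Let $R(\mathbf{Z})$ be a relation, $\mathbf{Y}\subseteq\mathbf{Z}$ and $\mathcal{X}\subseteq 2^{\mathbf{Y}}$. The Approximate Decomposition Algorithm (described in the context) computes a partitioning $\bigcup_{\mathbf{X}\in\mathcal{X}}R^{\mathbf{X}}=R$ (into pairwise disjoint subrelations) in time $O(|R|)$ (data complexity) such that $DC_{R^{\mathbf{X}}}(\mathbf{X},\mathbf{Y},|\mathcal{X}|d)$ holds for every $\mathbf{X}\in\mathcal{X}$, where $d=PC_R(\mathcal{X},\mathbf{Y})$.
   Context: A relation $R(\mathbf{Z})$ is a finite set of tuples over a finite set of variables $\mathbf{Z}$; $\pi$ and $\sigma$ denote projection and selection. For $\mathbf{X}\subseteq\mathbf{Y}\subseteq\mathbf{Z}$, the degree constraint $DC_R(\mathbf{X},\mathbf{Y},d)$ asserts $\max_{\mathbf{x}}|\pi_{\mathbf{Y}}\sigma_{\mathbf{X}=\mathbf{x}}R|\le d$ (maximum over all assignments $\mathbf{x}$ of values to $\mathbf{X}$), and $DC_R(\mathbf{X},\mathbf{Y})$ denotes the least $d$ for which it holds. For $\mathcal{X}\subseteq 2^{\mathbf{Y}}$, $PC_R(\mathcal{X},\mathbf{Y})$ denotes $\min_{(R^{\mathbf{X}})_{\mathbf{X}\in\mathcal{X}}}\max_{\mathbf{X}\in\mathcal{X}}DC_{R^{\mathbf{X}}}(\mathbf{X},\mathbf{Y})$, the minimum being over all families of pairwise disjoint (possibly empty) subrelations whose union is $R$. Approximate Decomposition Algorithm on input $(R,\mathcal{X},\mathbf{Y})$: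 initialize $R^{\mathbf{X}}\gets\emptyset$ for all $\mathbf{X}\in\mathcal{X}$. While $R$ is not empty: pick a pair $(\mathbf{X},\mathbf{x})$ with $\mathbf{X}\in\mathcal{X}$, $\mathbf{x}\in\pi_{\mathbf{X}}R$ minimizing $|\pi_{\mathbf{Y}}\sigma_{\mathbf{X}=\mathbf{x}}R|$ (for the current $R$; ties broken arbitrarily), set $R^{\mathbf{X}}\gets R^{\mathbf{X}}\cup\sigma_{\mathbf{X}=\mathbf{x}}R$, then $R\gets R\setminus\sigma_{\mathbf{X}=\mathbf{x}}R$. Return $(R^{\mathbf{X}})_{\mathbf{X}\in\mathcal{X}}$ and $\max_{\mathbf{X}\in\mathcal{X}}DC_{R^{\mathbf{X}}}(\mathbf{X},\mathbf{Y})$. The runtime statement means that the algorithm can be implemented to run within that time. "Data complexity" means that $\mathbf{Z},\mathbf{Y},\mathcal{X}$ are regarded as fixed, so hidden constants may depend on them but not on the contents of $R$. *)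

theory Defs
  imports Complex_Main "HOL-Library.FuncSet" "HOL-Library.Disjoint_Sets"
begin

section \<open>Relations, degree constraints and partition constraints\<close>

text \<open>
  A tuple over a set \<open>Z\<close> of variables is a function that is \<^const>\<open>extensional\<close> on \<open>Z\<close>, so that
  equality of tuples over \<open>Z\<close> is agreement on \<open>Z\<close>.
\<close>

definition relation :: "'a set \<Rightarrow> ('a \<Rightarrow> 'v) set \<Rightarrow> bool" where
  "relation Z R \<longleftrightarrow> finite Z \<and> finite R \<and> R \<subseteq> extensional Z"

definition proj :: "'a set \<Rightarrow> ('a \<Rightarrow> 'v) set \<Rightarrow> ('a \<Rightarrow> 'v) set" where
  "proj Y R = (\<lambda>t. restrict t Y) ` R"

definition sel :: "'a set \<Rightarrow> ('a \<Rightarrow> 'v) \<Rightarrow> ('a \<Rightarrow> 'v) set \<Rightarrow> ('a \<Rightarrow> 'v) set" where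
  "sel X x R = {t \<in> R. restrict t X = x}"

definition DC :: "('a \<Rightarrow> 'v) set \<Rightarrow> 'a set \<Rightarrow> 'a set \<Rightarrow> nat \<Rightarrow> bool" where
  "DC R X Y d \<longleftrightarrow> (\<forall>x \<in> extensional X. card (proj Y (sel X x R)) \<le> d)"

definition least_DC :: "('a \<Rightarrow> 'v) set \<Rightarrow> 'a set \<Rightarrow> 'a set \<Rightarrow> nat" where
  "least_DC R X Y = (LEAST d. DC R X Y d)"

text \<open>
  A family indexed by \<open>\<X>\<close> is a total function on sets of variables; its values outside \<open>\<X>\<close> are
  irrelevant.
\<close>

definition is_partition ::
    "'a set set \<Rightarrow> ('a \<Rightarrow> 'v) set \<Rightarrow> ('a set \<Rightarrow> ('a \<Rightarrow> 'v) set) \<Rightarrow> bool" where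
  "is_partition \<X> R P \<longleftrightarrow> (\<Union>X\<in>\<X>. P X) = R \<and> disjoint_family_on P \<X>"

definition max_DC :: "'a set set \<Rightarrow> ('a set \<Rightarrow> ('a \<Rightarrow> 'v) set) \<Rightarrow> 'a set \<Rightarrow> nat" where
  "max_DC \<X> P Y = Max ((\<lambda>X. least_DC (P X) X Y) ` \<X>)"

definition PC :: "('a \<Rightarrow> 'v) set \<Rightarrow> 'a set set \<Rightarrow> 'a set \<Rightarrow> nat" where
  "PC R \<X> Y = (LEAST d. \<exists>P. is_partition \<X> R P \<and> d = max_DC \<X> P Y)"


section \<open>The Approximate Decomposition Algorithm\<close>

text \<open>
  A state consists of what is left of the input relation and the parts built so far. One step is
  one iteration of the loop; it is nondeterministic, as ties are broken arbitrarily.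
\<close>

inductive adec_step ::
    "'a set set \<Rightarrow> 'a set \<Rightarrow>
      ('a \<Rightarrow> 'v) set \<times> ('a set \<Rightarrow> ('a \<Rightarrow> 'v) set) \<Rightarrow>
      ('a \<Rightarrow> 'v) set \<times> ('a set \<Rightarrow> ('a \<Rightarrow> 'v) set) \<Rightarrow> bool"
  for \<X> Y where
  "\<lbrakk> X \<in> \<X>; x \<in> proj X R;
     \<And>X' x'. X' \<in> \<X> \<Longrightarrow> x' \<in> proj X' R \<Longrightarrow>
       card (proj Y (sel X x R)) \<le> card (proj Y (sel X' x' R)) \<rbrakk>
   \<Longrightarrow> adec_step \<X> Y (R, P) (R - sel X x R, P(X := P X \<union> sel X x R))"

text \<open>The family \<open>P\<close> and the number \<open>v\<close> are a possible return value on input \<open>(R, \<X>, Y)\<close>.\<close>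

definition adec_result ::
    "'a set set \<Rightarrow> 'a set \<Rightarrow> ('a \<Rightarrow> 'v) set \<Rightarrow> ('a set \<Rightarrow> ('a \<Rightarrow> 'v) set) \<Rightarrow> nat \<Rightarrow> bool" where
  "adec_result \<X> Y R P v \<longleftrightarrow>
     (adec_step \<X> Y)\<^sup>*\<^sup>* (R, \<lambda>_. {}) ({}, P) \<and> v = max_DC \<X> P Y"

text \<open>
  Whatever choices are made, the loop never gets stuck on a nonempty relation and does not run
  forever.
\<close>

definition adec_terminates :: "'a set set \<Rightarrow> 'a set \<Rightarrow> ('a \<Rightarrow> 'v) set \<Rightarrow> bool" where
  "adec_terminates \<X> Y R \<longleftrightarrow>
     (\<forall>R' P. (adec_step \<X> Y)\<^sup>*\<^sup>* (R, \<lambda>_. {}) (R', P) \<longrightarrow> R' \<noteq> {} \<longrightarrow>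
        (\<exists>S. adec_step \<X> Y (R', P) S)) \<and>
     (\<nexists>S. S 0 = (R, \<lambda>_. {}) \<and> (\<forall>i::nat. adec_step \<X> Y (S i) (S (Suc i))))"


section \<open>Random access machine with addition and subtraction\<close>

text \<open>
  The uniform-cost RAM in structured form. A program uses finitely many registers and finitely
  many unbounded arrays of natural numbers, all named by numerals occurring in the program. (The
  arrays of a program can be interleaved in a single memory, and structured control flow can be
  replaced by jumps, at the cost of a constant factor in the running time.) Arithmetic is
  restricted to addition and truncated subtraction. Every operation, every access to a register or
  to an array cell, and every comparison takes one unit of time.
\<close>

record state =
  reg :: "nat \<Rightarrow> nat"
  arr :: "nat \<Rightarrow> nat \<Rightarrow> nat"

datatype exp =
    Const nat
  | Reg nat
  | Arr nat exp
  | Plus exp exp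
  | Minus exp exp

primrec val :: "exp \<Rightarrow> state \<Rightarrow> nat" where
  "val (Const k) s = k"
| "val (Reg r) s = reg s r"
| "val (Arr a e) s = arr s a (val e s)"
| "val (Plus e1 e2) s = val e1 s + val e2 s"
| "val (Minus e1 e2) s = val e1 s - val e2 s"

primrec cost :: "exp \<Rightarrow> nat" where
  "cost (Const k) = 1"
| "cost (Reg r) = 1"
| "cost (Arr a e) = cost e + 1"
| "cost (Plus e1 e2) = cost e1 + cost e2 + 1"
| "cost (Minus e1 e2) = cost e1 + cost e2 + 1"

datatype com =
    Skip
  | Assign nat exp
  | Store nat exp exp
  | Seq com com
  | IfLess exp exp com com
  | WhileLess exp exp com

text \<open>\<open>exec c s t s'\<close>: started in \<open>s\<close>, the program \<open>c\<close> halts after \<open>t\<close> time units in \<open>s'\<close>.\<close>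

inductive exec :: "com \<Rightarrow> state \<Rightarrow> nat \<Rightarrow> state \<Rightarrow> bool" where
  Skip: "exec Skip s 1 s"
| Assign: "exec (Assign r e) s (cost e + 1) (s\<lparr>reg := (reg s)(r := val e s)\<rparr>)"
| Store: "exec (Store a i e) s (cost i + cost e + 1)
    (s\<lparr>arr := (arr s)(a := (arr s a)(val i s := val e s))\<rparr>)"
| Seq: "exec c1 s t1 s1 \<Longrightarrow> exec c2 s1 t2 s2 \<Longrightarrow> exec (Seq c1 c2) s (t1 + t2) s2"
| IfTrue: "val e1 s < val e2 s \<Longrightarrow> exec c1 s t s' \<Longrightarrow>
    exec (IfLess e1 e2 c1 c2) s (cost e1 + cost e2 + 1 + t) s'"
| IfFalse: "\<not> val e1 s < val e2 s \<Longrightarrow> exec c2 s t s' \<Longrightarrow>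
    exec (IfLess e1 e2 c1 c2) s (cost e1 + cost e2 + 1 + t) s'"
| WhileFalse: "\<not> val e1 s < val e2 s \<Longrightarrow>
    exec (WhileLess e1 e2 c) s (cost e1 + cost e2 + 1) s"
| WhileTrue: "val e1 s < val e2 s \<Longrightarrow> exec c s t1 s1 \<Longrightarrow>
    exec (WhileLess e1 e2 c) s1 t2 s2 \<Longrightarrow>
    exec (WhileLess e1 e2 c) s (cost e1 + cost e2 + 1 + t1 + t2) s2"


section \<open>Relations as machine data\<close>

text \<open>
  Data values are presented to the machine through an encoding \<open>enc\<close> as natural numbers, which is
  injective on the values occurring in the relation but otherwise arbitrary.
\<close>

definition encoding :: "'a set \<Rightarrow> ('a \<Rightarrow> 'v) set \<Rightarrow> ('v \<Rightarrow> nat) \<Rightarrow> bool" where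
  "encoding Z R enc \<longleftrightarrow> inj_on enc (\<Union>t\<in>R. t ` Z)"

text \<open>
  The array \<open>m\<close> lists the \<open>n\<close> tuples of \<open>R\<close> row by row, in some order and without repetition, the
  columns being ordered as in the enumeration \<open>zs\<close> of the variables.
\<close>

definition holds_relation ::
    "('v \<Rightarrow> nat) \<Rightarrow> 'a list \<Rightarrow> (nat \<Rightarrow> nat) \<Rightarrow> nat \<Rightarrow> ('a \<Rightarrow> 'v) set \<Rightarrow> bool" where
  "holds_relation enc zs m n R \<longleftrightarrow>
     (\<exists>ts. distinct ts \<and> set ts = R \<and> length ts = n \<and>
        (\<forall>i<n. \<forall>j<length zs. m (i * length zs + j) = enc ((ts ! i) (zs ! j))))"

text \<open>Input: \<open>|R|\<close> in register 0, the tuples in array 0, and zero everywhere else.\<close>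

definition input_state ::
    "('v \<Rightarrow> nat) \<Rightarrow> 'a list \<Rightarrow> ('a \<Rightarrow> 'v) set \<Rightarrow> state \<Rightarrow> bool" where
  "input_state enc zs R s \<longleftrightarrow>
     reg s = (\<lambda>_. 0)(0 := card R) \<and>
     holds_relation enc zs (arr s 0) (card R) R \<and>
     (\<forall>i \<ge> card R * length zs. arr s 0 i = 0) \<and>
     (\<forall>a > 0. arr s a = (\<lambda>_. 0))"

text \<open>
  Output: the number \<open>v\<close> in register 0 and, for the \<open>j\<close>-th element \<open>X\<close> of \<open>\<X>\<close> in the enumeration
  \<open>Xs\<close> (counted from 0), the number of tuples of \<open>P X\<close> in register \<open>j + 1\<close> and the tuples
  themselves in array \<open>j + 1\<close>.
\<close>

definition output_state ::
    "('v \<Rightarrow> nat) \<Rightarrow> 'a list \<Rightarrow> 'a set list \<Rightarrow> ('a set \<Rightarrow> ('a \<Rightarrow> 'v) set) \<Rightarrow> nat \<Rightarrow>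
      state \<Rightarrow> bool" where
  "output_state enc zs Xs P v s \<longleftrightarrow>
     reg s 0 = v \<and>
     (\<forall>j<length Xs. holds_relation enc zs (arr s (j + 1)) (reg s (j + 1)) (P (Xs ! j)))"

end

theory Submission
  imports Defs
begin

text \<open>
  Approximation: let \<open>m\<close> be the degree of the selected group of the current relation \<open>S\<close>, and take an
  optimal partition of \<open>R\<close>. Some part contains at least a \<open>1 / card \<X>\<close> fraction of the projection of
  \<open>S\<close> to \<open>Y\<close>. With respect to the set of that part, all groups of \<open>S\<close> have degree at least \<open>m\<close> and
  those of the part have degree at most \<open>d\<close>, whence \<open>m \<le> card \<X> * d\<close>. A group is moved as a whole,
  so its degree in the part it goes to is the degree at its selection.

  Running time: values are replaced by numbers below \<open>n = card R\<close> by direct addressing, and projections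
  of tuples are numbered column by column, a pair of numbers below \<open>n\<close> being looked up at an address
  below \<open>n * n\<close>; the memory is zero initially, so no initialization is paid for. Only the first tuple
  of each class of equal projections to \<open>Y\<close> counts for the degrees, which thus become numbers of
  tuples. Groups of minimal degree come from a bucket queue with lazy deletion. Removing a tuple
  lowers one degree per set by one, hence the minimum by at most one per removed item, so that
  the total movement of the queue position is linear.
\<close>

section \<open>Degrees and partitions\<close>

text \<open>Counting representatives instead of projections is sound because every set of the family
  lies inside \<open>Y\<close>: tuples with equal projection to \<open>Y\<close> are in the same
  group for every set and leave the relation together, so a class has left exactly when its
  representative has. This closure property is part of \<open>reached\<close>. The machine part
  knows nothing of relations. It speaks of item numbers and of an arbitrary predicate
  \<open>\<Psi>\<close> on the owners and the largest selected degree, assumed to survive the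
  selection of a group of minimal degree. Only at the end is \<open>\<Psi>\<close> instantiated with
  \<open>reached\<close>, that is, reachability by steps of the algorithm. The obstacle on the time
  side is that a single selection can be expensive, so a uniform bound per iteration does not add up
  to a linear total; unspent budget is therefore handed on from command to command and compared with
  a potential. The machine cannot multiply either: products with program constants are unfolded into
  sums, and multiples of \<open>n\<close> are read from a table.\<close>

lemma finite_proj [simp]: "finite R \<Longrightarrow> finite (proj Y R)"
  by (simp add: proj_def)

lemma finite_sel [simp]: "finite R \<Longrightarrow> finite (sel X x R)"
  by (simp add: sel_def)

lemma sel_subset: "sel X x R \<subseteq> R"
  by (auto simp: sel_def)

lemma proj_extensional: "x \<in> proj X R \<Longrightarrow> x \<in> extensional X"
  by (auto simp: proj_def)

lemma card_proj_le: "finite R \<Longrightarrow> card (proj Y R) \<le> card R"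
  by (simp add: proj_def card_image_le)

lemma sel_empty_iff: "sel X x R = {} \<longleftrightarrow> x \<notin> proj X R"
  by (auto simp: sel_def proj_def)

lemma restrict_eq_subset:
  assumes "restrict t Y = restrict u Y" "X \<subseteq> Y"
  shows "restrict t X = restrict u X"
  using assms by (metis Int_absorb1 restrict_restrict)

text \<open>\<open>card R\<close> bounds every degree, so the \<open>LEAST\<close> in
  \<open>least_DC\<close> is attained, and degree constraints are monotone in the bound.\<close>

lemma DC_iff_least_DC:
  assumes "finite R"
  shows "DC R X Y d \<longleftrightarrow> least_DC R X Y \<le> d"
proof -
  have "DC R X Y (card R)"
    unfolding DC_def using assms
    by (meson card_mono card_proj_le finite_sel le_trans sel_subset)
  then have "DC R X Y (least_DC R X Y)"
    unfolding least_DC_def by (rule LeastI)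
  then show ?thesis
    unfolding least_DC_def by (meson DC_def Least_le order_trans)
qed

lemma least_DC_empty [simp]: "least_DC {} X Y = 0"
proof -
  have "DC {} X Y 0" by (simp add: DC_def sel_def proj_def)
  then show ?thesis using DC_iff_least_DC[OF finite.emptyI] by (metis le_zero_eq)
qed

text \<open>No tuple of \<open>A\<close> belongs to the group of \<open>x\<close>, so in the union
  this group is exactly the one added and all others are unchanged. The two sides are compared
  through their upper bounds.\<close>

lemma least_DC_Un_sel:
  assumes "finite A" "finite R" "x \<in> proj X R" "x \<notin> proj X A"
  shows "least_DC (A \<union> sel X x R) X Y = max (least_DC A X Y) (card (proj Y (sel X x R)))"
proof -
  have sel_Un: "sel X x' (A \<union> sel X x R) = (if x' = x then sel X x R else sel X x' A)" for x'
    using assms(4) by (auto simp: sel_def proj_def)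
  have sel_A: "sel X x A = {}" using assms(4) by (simp add: sel_empty_iff)
  have "DC (A \<union> sel X x R) X Y d \<longleftrightarrow> DC A X Y d \<and> card (proj Y (sel X x R)) \<le> d" for d
    unfolding DC_def sel_Un using proj_extensional[OF assms(3)] sel_A
    by (auto simp: proj_def split: if_splits)
  then have "least_DC (A \<union> sel X x R) X Y \<le> d \<longleftrightarrow>
      max (least_DC A X Y) (card (proj Y (sel X x R))) \<le> d" for d
    using assms(1,2) by (simp add: DC_iff_least_DC)
  then show ?thesis by (meson order_antisym order_refl)
qed

text \<open>Putting all of \<open>R\<close> into the part of \<open>X0\<close> is an admissible
  partition, so the \<open>LEAST\<close> in \<open>PC\<close> ranges over a nonempty set of
  numbers.\<close>

lemma PC_attained:
  assumes "X0 \<in> \<X>"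
  obtains P where "is_partition \<X> R P" "max_DC \<X> P Y = PC R \<X> Y"
proof -
  have "is_partition \<X> R ((\<lambda>_. {})(X0 := R))"
    using assms by (auto simp: is_partition_def disjoint_family_on_def)
  then have "\<exists>d P. is_partition \<X> R P \<and> d = max_DC \<X> P Y" by blast
  then have "\<exists>P. is_partition \<X> R P \<and> PC R \<X> Y = max_DC \<X> P Y"
    unfolding PC_def by (rule LeastI_ex)
  then show ?thesis using that by metis
qed

text \<open>
  Double counting: for every \<open>X\<close>, the groups of \<open>S\<close> have at least \<open>m\<close> and those of \<open>P X\<close> at
  most \<open>d\<close> projections to \<open>Y\<close>, so \<open>P X\<close> covers at most a fraction \<open>d / m\<close> of the projection of \<open>S\<close>.
\<close>

lemma min_degree_le:
  assumes fin: "finite \<X>" "finite S" and "S \<noteq> {}" and sub: "\<X> \<subseteq> Pow Y"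
    and cover: "S \<subseteq> (\<Union>X\<in>\<X>. P X)"
    and dc: "\<And>X. X \<in> \<X> \<Longrightarrow> DC (P X) X Y d"
    and fP: "\<And>X. X \<in> \<X> \<Longrightarrow> finite (P X)"
    and m: "\<And>X x. X \<in> \<X> \<Longrightarrow> x \<in> proj X S \<Longrightarrow> m \<le> card (proj Y (sel X x S))"
  shows "m \<le> card \<X> * d"
proof -
  let ?y = "card (proj Y S)"
  have part: "m * card (proj Y (P X \<inter> S)) \<le> d * ?y" if X: "X \<in> \<X>" for X
  proof -
    have "proj Y (P X \<inter> S) \<subseteq> (\<Union>x\<in>proj X S. proj Y (sel X x (P X)))"
      by (auto simp: proj_def sel_def)
    then have "card (proj Y (P X \<inter> S)) \<le> card (\<Union>x\<in>proj X S. proj Y (sel X x (P X)))"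
      using fin fP[OF X] by (intro card_mono) auto
    also have "\<dots> \<le> (\<Sum>x\<in>proj X S. card (proj Y (sel X x (P X))))"
      using fin by (intro card_UN_le) auto
    also have "\<dots> \<le> (\<Sum>x\<in>proj X S. d)"
      using dc[OF X] proj_extensional by (intro sum_mono) (auto simp: DC_def)
    finally have 1: "card (proj Y (P X \<inter> S)) \<le> card (proj X S) * d" by simp
    \<comment> \<open>As \<open>X\<close> lies inside \<open>Y\<close>, the projection to
      \<open>Y\<close> determines the group for \<open>X\<close>; so the projections of distinct
      groups are disjoint and their sizes add up.\<close>
    have disj: "proj Y (sel X x S) \<inter> proj Y (sel X x' S) = {}" if "x \<noteq> x'" for x x'
    proof -
      have "restrict t Y \<noteq> restrict u Y" if "restrict t X = x" "restrict u X = x'" for t u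
        using restrict_eq_subset[of t Y u X] sub X \<open>x \<noteq> x'\<close> that by auto
      then show ?thesis by (fastforce simp: proj_def sel_def)
    qed
    have "card (proj X S) * m \<le> (\<Sum>x\<in>proj X S. card (proj Y (sel X x S)))"
      using sum_mono[of "proj X S" "\<lambda>_. m"] m[OF X] by simp
    also have "\<dots> = card (\<Union>x\<in>proj X S. proj Y (sel X x S))"
      using fin disj by (subst card_UN_disjoint) auto
    also have "\<dots> \<le> ?y"
      using fin by (intro card_mono) (auto simp: proj_def sel_def)
    finally have "card (proj X S) * m \<le> ?y" .
    \<comment> \<open>The upper and the lower bound on \<open>card (proj X S)\<close> are scaled by
      \<open>d\<close> and \<open>m\<close>, so that no quotient is formed.\<close>
    then have "d * (card (proj X S) * m) \<le> d * ?y" by (rule mult_le_mono2)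
    moreover have "m * card (proj Y (P X \<inter> S)) \<le> m * (card (proj X S) * d)"
      using 1 by (rule mult_le_mono2)
    moreover have "m * (card (proj X S) * d) = d * (card (proj X S) * m)" by (simp add: ac_simps)
    ultimately show ?thesis by linarith
  qed
  have "proj Y S \<subseteq> (\<Union>X\<in>\<X>. proj Y (P X \<inter> S))"
    using cover by (fastforce simp: proj_def)
  then have "?y \<le> card (\<Union>X\<in>\<X>. proj Y (P X \<inter> S))"
    using fin by (intro card_mono) auto
  also have "\<dots> \<le> (\<Sum>X\<in>\<X>. card (proj Y (P X \<inter> S)))"
    using fin by (intro card_UN_le) auto
  finally have "m * ?y \<le> (\<Sum>X\<in>\<X>. m * card (proj Y (P X \<inter> S)))"
    unfolding sum_distrib_left[symmetric] by (rule mult_le_mono2)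
  also have "\<dots> \<le> (\<Sum>X\<in>\<X>. d * ?y)" using part by (rule sum_mono)
  also have "\<dots> = (card \<X> * d) * ?y" by simp
  finally have "m * ?y \<le> (card \<X> * d) * ?y" .
  moreover have "?y > 0" using assms(2,3) by (simp add: card_gt_0_iff) (simp add: proj_def)
  ultimately show ?thesis by simp
qed


section \<open>Runs of the algorithm\<close>

text \<open>The separation of \<open>proj X (P X)\<close> from \<open>proj X R\<close> records that
  groups are moved completely: nothing left over can enlarge a group that is already in
  \<open>P X\<close>. It also makes \<open>P X\<close> disjoint from \<open>R\<close>.\<close>

definition adec_inv ::
  "'a set set \<Rightarrow> 'a set \<Rightarrow> ('a \<Rightarrow> 'v) set \<Rightarrow> ('a \<Rightarrow> 'v) set \<Rightarrow> ('a set \<Rightarrow> ('a \<Rightarrow> 'v) set) \<Rightarrow> bool" where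
  "adec_inv \<X> Y R0 R P \<longleftrightarrow>
     (\<Union>X\<in>\<X>. P X) \<union> R = R0 \<and> disjoint_family_on P \<X> \<and>
     (\<forall>X\<in>\<X>. proj X (P X) \<inter> proj X R = {} \<and> least_DC (P X) X Y \<le> card \<X> * PC R0 \<X> Y)"

lemma adec_inv_step:
  assumes fin: "finite \<X>" "finite R0" and sub: "\<X> \<subseteq> Pow Y"
    and inv: "adec_inv \<X> Y R0 R P" and step: "adec_step \<X> Y (R, P) (R', P')"
  shows "adec_inv \<X> Y R0 R' P'"
  using step
proof cases
  case (1 X x)
  let ?S = "sel X x R"
  have R': "R' = R - ?S" and P': "P' = P(X := P X \<union> ?S)" using 1 by auto
  have X: "X \<in> \<X>" and x: "x \<in> proj X R" by fact+
  have un: "(\<Union>X\<in>\<X>. P X) \<union> R = R0" and disj: "disjoint_family_on P \<X>"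
    and sep: "\<And>X. X \<in> \<X> \<Longrightarrow> proj X (P X) \<inter> proj X R = {}"
    and le: "\<And>X. X \<in> \<X> \<Longrightarrow> least_DC (P X) X Y \<le> card \<X> * PC R0 \<X> Y"
    using inv by (auto simp: adec_inv_def)
  have fR: "finite R" and fP: "\<And>X. X \<in> \<X> \<Longrightarrow> finite (P X)"
    using un fin(2) by (auto intro: finite_subset)
  have PR: "P X' \<inter> R = {}" if "X' \<in> \<X>" for X'
    using sep[OF that] by (auto simp: proj_def)
  \<comment> \<open>An optimal partition of the initial \<open>R0\<close> also covers the current
    \<open>R\<close>, so one and the same bound serves in all iterations.\<close>
  obtain Q where Q: "is_partition \<X> R0 Q" "max_DC \<X> Q Y = PC R0 \<X> Y"
    using PC_attained[OF X] .
  have fQ: "finite (Q X')" if "X' \<in> \<X>" for X'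
    using Q(1) that fin(2) by (auto simp: is_partition_def intro: finite_subset)
  have dcQ: "DC (Q X') X' Y (PC R0 \<X> Y)" if "X' \<in> \<X>" for X'
    unfolding DC_iff_least_DC[OF fQ[OF that]] Q(2)[symmetric] max_DC_def
    using that fin(1) by (intro Max_ge) auto
  have ne: "R \<noteq> {}" using x by (auto simp: proj_def)
  have min: "card (proj Y ?S) \<le> card \<X> * PC R0 \<X> Y"
    by (rule min_degree_le[of \<X> R Y Q])
      (use fin fR ne sub Q(1) un dcQ fQ 1(5) in \<open>auto simp: is_partition_def\<close>)
  have "(\<Union>X\<in>\<X>. P' X) \<union> R' = R0"
    using un X sel_subset[of X x R] unfolding R' P' by (auto split: if_splits)
  moreover have "disjoint_family_on P' \<X>"
    using disj PR sel_subset[of X x R] unfolding P' disjoint_family_on_def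
    by (fastforce split: if_splits)
  moreover have "proj X' (P' X') \<inter> proj X' R' = {}" if "X' \<in> \<X>" for X'
    using sep[OF that] sel_subset[of X x R] unfolding R' P'
    by (auto simp: proj_def sel_def)
  moreover have "least_DC (P' X') X' Y \<le> card \<X> * PC R0 \<X> Y" if "X' \<in> \<X>" for X'
  proof -
    have "x \<notin> proj X (P X)" using sep[OF X] x by blast
    then show ?thesis
      using le[OF that] le[OF X] least_DC_Un_sel[OF fP[OF X] fR x, of Y] min unfolding P' by auto
  qed
  ultimately show ?thesis unfolding adec_inv_def by blast
qed

lemma adec_inv_steps:
  assumes fin: "finite \<X>" "finite R0" and sub: "\<X> \<subseteq> Pow Y"
    and "(adec_step \<X> Y)\<^sup>*\<^sup>* (R0, \<lambda>_. {}) (R, P)"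
  shows "adec_inv \<X> Y R0 R P"
  using assms(4)
proof (induction "(R, P)" arbitrary: R P rule: rtranclp_induct)
  case base
  then show ?case by (auto simp: adec_inv_def disjoint_family_on_def proj_def)
next
  case (step S)
  obtain R1 P1 where "S = (R1, P1)" by (cases S)
  then show ?case using step adec_inv_step[OF fin sub] by blast
qed

text \<open>Lets the returned number be kept as a running maximum of the selected degrees. The
  invariant supplies that the group of \<open>x\<close> is new in the part of
  \<open>X\<close>.\<close>

lemma max_DC_step:
  assumes fin: "finite \<X>" "finite R0" and sub: "\<X> \<subseteq> Pow Y"
    and inv: "adec_inv \<X> Y R0 R P" and X: "X \<in> \<X>" and x: "x \<in> proj X R"
  shows "max_DC \<X> (P(X := P X \<union> sel X x R)) Y = max (max_DC \<X> P Y) (card (proj Y (sel X x R)))"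
proof -
  let ?S = "sel X x R"
  have "P X \<union> R \<subseteq> R0" and x': "x \<notin> proj X (P X)"
    using inv X x by (auto simp: adec_inv_def)
  then have "finite (P X)" "finite R" using fin(2) by (auto intro: finite_subset)
  then have X_eq: "least_DC (P X \<union> ?S) X Y = max (least_DC (P X) X Y) (card (proj Y ?S))"
    using least_DC_Un_sel x x' by blast
  have "(max_DC \<X> (P(X := P X \<union> ?S)) Y \<le> d) \<longleftrightarrow> (max (max_DC \<X> P Y) (card (proj Y ?S)) \<le> d)" for d
  proof -
    have Max_le: "max_DC \<X> Q Y \<le> d \<longleftrightarrow> (\<forall>X\<in>\<X>. least_DC (Q X) X Y \<le> d)"
      for Q :: "'a set \<Rightarrow> ('a \<Rightarrow> 'b) set"
      unfolding max_DC_def using fin(1) X by (subst Max_le_iff) auto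
    show ?thesis unfolding Max_le max.bounded_iff using X by (auto simp: X_eq)
  qed
  then show ?thesis by (meson order_antisym order_refl)
qed

lemma adec_step_decreases:
  "adec_step \<X> Y S S' \<Longrightarrow> fst S' \<subset> fst S"
proof (erule adec_step.cases)
  fix X x R P
  assume "S = (R, P)" "S' = (R - sel X x R, P(X := P X \<union> sel X x R))" "x \<in> proj X R"
  then show ?thesis using sel_subset[of X x R] sel_empty_iff[of X x R] by auto
qed

lemma adec_step_exists:
  assumes "finite \<X>" "\<X> \<noteq> {}" "R \<noteq> {}" "finite R"
  shows "\<exists>S. adec_step \<X> Y (R, P) S"
proof -
  let ?C = "Sigma \<X> (\<lambda>X. proj X R)" and ?f = "\<lambda>(X, x). card (proj Y (sel X x R))"
  have C: "finite ?C" "?C \<noteq> {}" using assms by (auto simp: proj_def)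
  obtain X x where c: "arg_min_on ?f ?C = (X, x)" by force
  have "(X, x) \<in> ?C" using arg_min_if_finite(1)[OF C, of ?f] c by simp
  moreover have "?f (X, x) \<le> ?f c'" if "c' \<in> ?C" for c'
    using arg_min_least[OF C that, of ?f] c by simp
  ultimately have "adec_step \<X> Y (R, P) (R - sel X x R, P(X := P X \<union> sel X x R))"
    by (intro adec_step.intros) auto
  then show ?thesis ..
qed

lemma adec_terminates:
  assumes "finite \<X>" "\<X> \<noteq> {}" "\<X> \<subseteq> Pow Y" "finite R"
  shows "adec_terminates \<X> Y R"
  unfolding adec_terminates_def
proof (intro conjI allI impI notI)
  fix R' P
  assume "(adec_step \<X> Y)\<^sup>*\<^sup>* (R, \<lambda>_. {}) (R', P)" and R': "R' \<noteq> {}"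
  then have "adec_inv \<X> Y R R' P" using adec_inv_steps assms by blast
  then have "finite R'" using assms(4) by (auto simp: adec_inv_def)
  then show "\<exists>S. adec_step \<X> Y (R', P) S" using adec_step_exists assms R' by blast
next
  assume "\<exists>S. S 0 = (R, \<lambda>_. {}) \<and> (\<forall>i::nat. adec_step \<X> Y (S i) (S (Suc i)))"
  then obtain S where S: "S 0 = (R, \<lambda>_. {})" "\<And>i::nat. adec_step \<X> Y (S i) (S (Suc i))" by blast
  \<comment> \<open>Every step removes at least one tuple, so an infinite run fails at index
    \<open>Suc (card R)\<close>.\<close>
  have "finite (fst (S i)) \<and> card (fst (S i)) + i \<le> card R" for i
  proof (induction i)
    case 0
    then show ?case using S assms by simp
  next
    case (Suc i)
    have "fst (S (Suc i)) \<subset> fst (S i)" using adec_step_decreases[OF S(2)] .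
    then show ?case using Suc psubset_card_mono[of "fst (S i)" "fst (S (Suc i))"]
      by (auto intro: finite_subset)
  qed
  from this[of "Suc (card R)"] show False by simp
qed

lemma adec_result_correct:
  assumes "finite \<X>" "\<X> \<subseteq> Pow Y" "finite R" "adec_result \<X> Y R P v"
  shows "is_partition \<X> R P" "\<forall>X\<in>\<X>. DC (P X) X Y (card \<X> * PC R \<X> Y)"
proof -
  have inv: "adec_inv \<X> Y R {} P"
    using adec_inv_steps assms unfolding adec_result_def by blast
  then show "is_partition \<X> R P" by (simp add: adec_inv_def is_partition_def)
  have "finite (P X)" if "X \<in> \<X>" for X
    using inv that assms(3) by (auto simp: adec_inv_def intro: finite_subset)
  then show "\<forall>X\<in>\<X>. DC (P X) X Y (card \<X> * PC R \<X> Y)"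
    using inv by (auto simp: adec_inv_def DC_iff_least_DC)
qed

section \<open>Reasoning about programs\<close>

definition runs :: "com \<Rightarrow> state \<Rightarrow> nat \<Rightarrow> (state \<Rightarrow> bool) \<Rightarrow> bool" where
  "runs c s b Q \<longleftrightarrow> (\<exists>t s'. exec c s t s' \<and> t \<le> b \<and> Q s')"

text \<open>
  The postcondition sees the unspent part of the time budget: an amortized analysis states that a
  potential of the final state is below it.
\<close>

definition budget :: "com \<Rightarrow> state \<Rightarrow> nat \<Rightarrow> (state \<Rightarrow> nat \<Rightarrow> bool) \<Rightarrow> bool" where
  "budget c s b Q \<longleftrightarrow> (\<exists>t s' b'. exec c s t s' \<and> t + b' \<le> b \<and> Q s' b')"

text \<open>Loop-free code is executed by simplification through \<open>run\<close>, with
  \<open>bound\<close> as its worst-case time. The \<open>WhileLess\<close> clauses of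
  \<open>bound\<close> and \<open>run\<close> are default values that make the recursion total;
  \<open>loopfree\<close> guards against them.\<close>

primrec loopfree :: "com \<Rightarrow> bool" where
  "loopfree Skip \<longleftrightarrow> True"
| "loopfree (Assign r e) \<longleftrightarrow> True"
| "loopfree (Store a i e) \<longleftrightarrow> True"
| "loopfree (Seq c1 c2) \<longleftrightarrow> loopfree c1 \<and> loopfree c2"
| "loopfree (IfLess e1 e2 c1 c2) \<longleftrightarrow> loopfree c1 \<and> loopfree c2"
| "loopfree (WhileLess e1 e2 c) \<longleftrightarrow> False"

primrec bound :: "com \<Rightarrow> nat" where
  "bound Skip = 1"
| "bound (Assign r e) = cost e + 1"
| "bound (Store a i e) = cost i + cost e + 1"
| "bound (Seq c1 c2) = bound c1 + bound c2"
| "bound (IfLess e1 e2 c1 c2) = cost e1 + cost e2 + 1 + max (bound c1) (bound c2)"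
| "bound (WhileLess e1 e2 c) = 0"

primrec run :: "com \<Rightarrow> state \<Rightarrow> state" where
  "run Skip s = s"
| "run (Assign r e) s = s\<lparr>reg := (reg s)(r := val e s)\<rparr>"
| "run (Store a i e) s = s\<lparr>arr := (arr s)(a := (arr s a)(val i s := val e s))\<rparr>"
| "run (Seq c1 c2) s = run c2 (run c1 s)"
| "run (IfLess e1 e2 c1 c2) s = (if val e1 s < val e2 s then run c1 s else run c2 s)"
| "run (WhileLess e1 e2 c) s = s"

lemma runsI: "exec c s t s' \<Longrightarrow> t \<le> b \<Longrightarrow> Q s' \<Longrightarrow> runs c s b Q"
  unfolding runs_def by blast

lemma budgetI: "exec c s t s' \<Longrightarrow> t + b' \<le> b \<Longrightarrow> Q s' b' \<Longrightarrow> budget c s b Q"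
  unfolding budget_def by blast

lemma exec_run: "loopfree c \<Longrightarrow> \<exists>t\<le>bound c. exec c s t (run c s)"
proof (induction c arbitrary: s)
  case (Seq c1 c2)
  then show ?case by (auto intro!: exec.Seq) (meson add_mono exec.Seq)
next
  case (IfLess e1 e2 c1 c2)
  obtain t1 t2 where "t1 \<le> bound c1" "exec c1 s t1 (run c1 s)" "t2 \<le> bound c2" "exec c2 s t2 (run c2 s)"
    using IfLess by fastforce
  then show ?case
    using exec.IfTrue[of e1 s e2 c1 t1 "run c1 s" c2] exec.IfFalse[of e1 s e2 c2 t2 "run c2 s" c1]
    by (intro exI[of _ "cost e1 + cost e2 + 1 + (if val e1 s < val e2 s then t1 else t2)"]) auto
next
  case (WhileLess e1 e2 c)
  then show ?case by simp
qed (metis bound.simps run.simps exec.intros(1-3) order_refl)+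

lemma runs_loopfree:
  "loopfree c \<Longrightarrow> bound c \<le> b \<Longrightarrow> Q (run c s) \<Longrightarrow> runs c s b Q"
  unfolding runs_def using exec_run order_trans by blast

lemma runs_Seq:
  assumes "runs c1 s b1 Q1" "\<And>s'. Q1 s' \<Longrightarrow> runs c2 s' b2 Q"
  shows "runs (Seq c1 c2) s (b1 + b2) Q"
  using assms unfolding runs_def by (meson add_mono exec.Seq)

lemma runs_mono:
  assumes "runs c s b Q" "b \<le> b'" "\<And>s'. Q s' \<Longrightarrow> Q' s'"
  shows "runs c s b' Q'"
  using assms unfolding runs_def by (meson order_trans)

lemma runs_while_step:
  assumes "val e1 s < val e2 s" "loopfree c" "runs (WhileLess e1 e2 c) (run c s) b Q"
  shows "runs (WhileLess e1 e2 c) s (cost e1 + cost e2 + 1 + bound c + b) Q"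
proof -
  obtain t where t: "t \<le> bound c" "exec c s t (run c s)" using exec_run assms(2) by blast
  obtain t' s' where t': "exec (WhileLess e1 e2 c) (run c s) t' s'" "t' \<le> b" "Q s'"
    using assms(3) by (auto simp: runs_def)
  show ?thesis
    by (rule runsI[OF exec.WhileTrue[OF assms(1) t(2) t'(1)]]) (use t t' in auto)
qed

lemma runs_for:
  assumes "loopfree body" and "J 0 s"
    and reg: "\<And>q s. J q s \<Longrightarrow> reg s r = q \<and> val e s = n"
    and step: "\<And>q s. q < n \<Longrightarrow> J q s \<Longrightarrow> J (Suc q) (run body s)"
  shows "runs (WhileLess (Reg r) e body) s ((cost e + 2 + bound body) * (n + 1)) (J n)"
proof -
  let ?w = "cost e + 2 + bound body"
  have "runs (WhileLess (Reg r) e body) s (?w * (n - q + 1)) (J n)" if "J q s" "q \<le> n" for q s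
    using that
  proof (induction "n - q" arbitrary: q s)
    case 0
    have "q = n" "\<not> val (Reg r) s < val e s" using reg[OF 0(2)] 0 by auto
    then show ?case by (intro runsI[OF exec.WhileFalse]) (use 0 in auto)
  next
    case (Suc d)
    have "val (Reg r) s < val e s" using reg[OF Suc(3)] Suc by simp
    moreover have "runs (WhileLess (Reg r) e body) (run body s) (?w * (n - Suc q + 1)) (J n)"
      using Suc step[OF _ Suc(3)] by (intro Suc(1)) auto
    ultimately have "runs (WhileLess (Reg r) e body) s
        (cost (Reg r) + cost e + 1 + bound body + ?w * (n - Suc q + 1)) (J n)"
      using assms(1) by (intro runs_while_step)
    moreover have "n - q = Suc (n - Suc q)" using Suc(2) by simp
    ultimately show ?case by (elim runs_mono) (auto simp: algebra_simps)
  qed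
  from this[OF assms(2)] show ?thesis by simp
qed

lemma budget_runs: "budget c s b (\<lambda>s' _. Q s') \<Longrightarrow> runs c s b Q"
  unfolding budget_def runs_def by (meson add_leD1)

lemma budget_loopfree:
  assumes "loopfree c" "bound c + b' \<le> b" "Q (run c s) b'"
  shows "budget c s b Q"
  unfolding budget_def using exec_run[OF assms(1), of s] assms by (meson add_mono le_refl order_trans)

lemma budget_Seq:
  assumes "budget c1 s b Q1" "\<And>s' b'. Q1 s' b' \<Longrightarrow> budget c2 s' b' Q"
  shows "budget (Seq c1 c2) s b Q"
proof -
  obtain t1 s1 b1 where 1: "exec c1 s t1 s1" "t1 + b1 \<le> b" "Q1 s1 b1"
    using assms(1) by (auto simp: budget_def)
  obtain t2 s2 b2 where 2: "exec c2 s1 t2 s2" "t2 + b2 \<le> b1" "Q s2 b2"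
    using assms(2)[OF 1(3)] by (auto simp: budget_def)
  show ?thesis by (rule budgetI[OF exec.Seq[OF 1(1) 2(1)]]) (use 1 2 in auto)
qed

lemma budget_If:
  assumes "cost e1 + cost e2 + 1 + b' \<le> b"
    and "val e1 s < val e2 s \<Longrightarrow> budget c1 s b' Q" "\<not> val e1 s < val e2 s \<Longrightarrow> budget c2 s b' Q"
  shows "budget (IfLess e1 e2 c1 c2) s b Q"
proof (cases "val e1 s < val e2 s")
  case True
  then obtain t s' b'' where t: "exec c1 s t s'" "t + b'' \<le> b'" "Q s' b''"
    using assms(2) by (auto simp: budget_def)
  show ?thesis by (rule budgetI[OF exec.IfTrue[OF True t(1)]]) (use t assms(1) in auto)
next
  case False
  then obtain t s' b'' where t: "exec c2 s t s'" "t + b'' \<le> b'" "Q s' b''"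
    using assms(3) by (auto simp: budget_def)
  show ?thesis by (rule budgetI[OF exec.IfFalse[OF False t(1)]]) (use t assms(1) in auto)
qed

text \<open>Every iteration decreases the budget, so no separate termination argument is needed.\<close>

lemma budget_while:
  assumes "I s b"
    and "\<And>s b. I s b \<Longrightarrow> val e1 s < val e2 s \<Longrightarrow>
      \<exists>b'. cost e1 + cost e2 + 1 + b' \<le> b \<and> budget c s b' I"
    and "\<And>s b. I s b \<Longrightarrow> \<not> val e1 s < val e2 s \<Longrightarrow>
      \<exists>b'. cost e1 + cost e2 + 1 + b' \<le> b \<and> Q s b'"
  shows "budget (WhileLess e1 e2 c) s b Q"
  using assms(1)
proof (induction b arbitrary: s rule: less_induct)
  case (less b)
  show ?case
  proof (cases "val e1 s < val e2 s")
    case True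
    obtain b' where b': "cost e1 + cost e2 + 1 + b' \<le> b" "budget c s b' I"
      using assms(2)[OF less(2) True] by blast
    then obtain t1 s1 b1 where 1: "exec c s t1 s1" "t1 + b1 \<le> b'" "I s1 b1"
      by (auto simp: budget_def)
    have "b1 < b" using b' 1 by simp
    from less(1)[OF this 1(3)] obtain t2 s2 b2
      where 2: "exec (WhileLess e1 e2 c) s1 t2 s2" "t2 + b2 \<le> b1" "Q s2 b2"
      by (auto simp: budget_def)
    show ?thesis by (rule budgetI[OF exec.WhileTrue[OF True 1(1) 2(1)]]) (use 1 2 b' in auto)
  next
    case False
    then show ?thesis
      unfolding budget_def using exec.WhileFalse[OF False, of c] assms(3)[OF less(2) False] by blast
  qed
qed

lemma budget_mono:
  assumes "budget c s b Q" "b \<le> b'" "\<And>s' b''. Q s' b'' \<Longrightarrow> Q' s' b''"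
  shows "budget c s b' Q'"
  using assms unfolding budget_def by (meson order_trans)

lemma budget_Seq_loopfree:
  assumes "budget c2 (run c1 s) b' Q" "loopfree c1" "bound c1 + b' \<le> b"
  shows "budget (Seq c1 c2) s b Q"
  by (rule budget_Seq[where ?Q1.0 = "\<lambda>s' b''. s' = run c1 s \<and> b'' = b'"])
    (use assms in \<open>auto intro: budget_loopfree\<close>)

text \<open>Frame rule for time: \<open>d\<close> units withheld from a command are still available
  after it.\<close>

lemma budget_slack:
  "budget c s b Q \<Longrightarrow> budget c s (b + d) (\<lambda>s' b'. \<exists>b''. b' = b'' + d \<and> Q s' b'')"
  unfolding budget_def by (metis add.assoc add_le_cancel_right)

text \<open>Multiplication by a number fixed in the program, unfolded into additions; its cost
  depends on that number but not on the data.\<close>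

primrec times :: "nat \<Rightarrow> exp \<Rightarrow> exp" where
  "times 0 e = Const 0"
| "times (Suc m) e = Plus e (times m e)"

lemma val_times [simp]: "val (times m e) s = m * val e s"
  by (induction m) auto

fun seqs :: "com list \<Rightarrow> com" where
  "seqs [] = Skip"
| "seqs [c] = c"
| "seqs (c # cs) = Seq c (seqs cs)"

section \<open>Class identifiers\<close>

text \<open>Canonical name of the class of \<open>t\<close> under the key \<open>f\<close>. Since
  \<open>t\<close> itself is a candidate, names of indices below \<open>n\<close> stay below
  \<open>n\<close>, and the representatives are the fixed points of \<open>first f\<close>.\<close>

definition first :: "(nat \<Rightarrow> 'b) \<Rightarrow> nat \<Rightarrow> nat" where
  "first f t = (LEAST u. f u = f t)"

lemma f_first [simp]: "f (first f t) = f t"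
  unfolding first_def by (rule LeastI) simp

lemma first_le [simp]: "first f t \<le> t"
  unfolding first_def by (rule Least_le) simp

lemma first_le_iff: "f u = f t \<Longrightarrow> first f t \<le> u"
  unfolding first_def by (rule Least_le)

lemma first_eq_iff: "first f t = first f u \<longleftrightarrow> f t = f u"
  by (metis f_first first_def)

lemma first_cong:
  assumes "\<And>u. u \<le> t \<Longrightarrow> (f u = f t) = (g u = g t)"
  shows "first f t = first g t"
  by (metis assms f_first first_le first_le_iff order_antisym)

lemma first_less: "t < n \<Longrightarrow> first f t < n"
  using first_le[of f t] by linarith

definition agree :: "nat set \<Rightarrow> nat set \<Rightarrow> state \<Rightarrow> state \<Rightarrow> bool" where
  "agree R A s s' \<longleftrightarrow> (\<forall>r. r \<notin> R \<longrightarrow> reg s' r = reg s r) \<and> (\<forall>a. a \<notin> A \<longrightarrow> arr s' a = arr s a)"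

lemma agree_refl [simp]: "agree R A s s"
  by (simp add: agree_def)

lemma agree_trans:
  "agree R A s s' \<Longrightarrow> agree R' A' s' s'' \<Longrightarrow> agree (R \<union> R') (A \<union> A') s s''"
  by (simp add: agree_def)

locale layout =
  fixes k w :: nat
begin

text \<open>
  Registers and arrays up to \<open>k\<close> are those of the input and output; \<open>k\<close> stands for the number of sets
  in the family and \<open>w\<close> for the number of variables. In the main loop, \<open>rn\<close> and \<open>rm\<close> are the numbers
  of tuples and items, \<open>rp\<close> is the position in the bucket queue, \<open>rv\<close> the largest degree selected so
  far, \<open>re\<close> the next unused bucket entry, and \<open>aown\<close> maps a tuple to 0 while it is in the relation and
  to \<open>j + 1\<close> once it has moved to the part of the \<open>j\<close>-th set.
\<close>

abbreviation "rn \<equiv> k + 3"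
abbreviation "rm \<equiv> k + 4"
abbreviation "rt \<equiv> k + 5"
abbreviation "ri \<equiv> k + 6"
abbreviation "rG \<equiv> k + 7"
abbreviation "rN \<equiv> k + 8"
abbreviation "rp \<equiv> k + 9"
abbreviation "rv \<equiv> k + 10"
abbreviation "re \<equiv> k + 11"
abbreviation "rd \<equiv> k + 12"
abbreviation "rH \<equiv> k + 13"

abbreviation "amul \<equiv> k + 3"
abbreviation "acls \<equiv> k + 4"
abbreviation "atup \<equiv> k + 5"
abbreviation "aset \<equiv> k + 6"
abbreviation "anext \<equiv> k + 7"
abbreviation "ahead \<equiv> k + 8"
abbreviation "adeg \<equiv> k + 9"
abbreviation "aown \<equiv> k + 10"
abbreviation "abucket \<equiv> k + 11"
abbreviation "abnext \<equiv> k + 12"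
abbreviation "abgroup \<equiv> k + 13"

definition inc :: "nat \<Rightarrow> com" where
  "inc r = Assign r (Plus (Reg r) (Const 1))"

lemma inc_simps [simp]:
  "loopfree (inc r)" "run (inc r) s = s\<lparr>reg := (reg s)(r := Suc (reg s r))\<rparr>"
  by (simp_all add: inc_def)

text \<open>Direct addressing: cell \<open>e\<close> of array \<open>d\<close> holds one plus the
  first index with that key, where 0 means that the key has not occurred yet. This relies on
  \<open>d\<close> being zero at the start.\<close>

definition dedup :: "exp \<Rightarrow> nat \<Rightarrow> nat \<Rightarrow> com" where
  "dedup e d out = Seq (Assign rt (Const 0)) (WhileLess (Reg rt) (Reg rn) (seqs
     [Assign ri e,
      IfLess (Arr d (Reg ri)) (Const 1) (Store d (Reg ri) (Plus (Reg rt) (Const 1))) Skip,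
      Store out (Reg rt) (Minus (Arr d (Reg ri)) (Const 1)),
      inc rt]))"

text \<open>The expression \<open>e\<close> is evaluated while the scratch registers and both arrays
  change, so its value is prescribed for all states that agree with \<open>s\<close>
  elsewhere.\<close>

lemma runs_dedup:
  assumes key: "\<And>s' t. agree {rt, ri} {d, out} s s' \<Longrightarrow> reg s' rt = t \<Longrightarrow> t < n \<Longrightarrow> val e s' = key t"
    and n: "reg s rn = n" and "d \<noteq> out" and zero: "arr s d = (\<lambda>_. 0)"
  shows "runs (dedup e d out) s ((cost e + 30) * (n + 1))
    (\<lambda>s'. agree {rt, ri} {d, out} s s' \<and> (\<forall>t<n. arr s' out t = first key t))"
proof -
  define J where "J q s' \<longleftrightarrow> agree {rt, ri} {d, out} s s' \<and> reg s' rt = q \<and>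
      (\<forall>a. arr s' d a = (if \<exists>u<q. key u = a then Suc (LEAST u. key u = a) else 0)) \<and>
      (\<forall>t<q. arr s' out t = first key t)" for q s'
  let ?body = "seqs
     [Assign ri e,
      IfLess (Arr d (Reg ri)) (Const 1) (Store d (Reg ri) (Plus (Reg rt) (Const 1))) Skip,
      Store out (Reg rt) (Minus (Arr d (Reg ri)) (Const 1)),
      inc rt]"
  have step: "J (Suc q) (run ?body s')" if q: "q < n" and J: "J q s'" for q s'
  proof -
    have ag: "agree {rt, ri} {d, out} s s'" and rt: "reg s' rt = q"
      and d: "\<And>a. arr s' d a = (if \<exists>u<q. key u = a then Suc (LEAST u. key u = a) else 0)"
      and out: "\<And>t. t < q \<Longrightarrow> arr s' out t = first key t"
      using J by (auto simp: J_def)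
    have e: "val e s' = key q" using key[OF ag rt q] .
    have new: "(LEAST u. key u = key q) = q" if "\<not> (\<exists>u<q. key u = key q)"
      using that by (intro Least_equality) (auto simp: not_less[symmetric])
    have ex: "(\<exists>u<Suc q. key u = a) \<longleftrightarrow> (\<exists>u<q. key u = a) \<or> a = key q" for a
      by (auto simp: less_Suc_eq)
    show ?thesis
      using ag rt out new \<open>d \<noteq> out\<close>
      by (auto simp: J_def agree_def e d ex less_Suc_eq first_def)
  qed
  have J0: "J 0 (run (Assign rt (Const 0)) s)"
    using zero by (simp add: J_def agree_def)
  have "runs (WhileLess (Reg rt) (Reg rn) ?body) (run (Assign rt (Const 0)) s)
      ((cost (Reg rn) + 2 + bound ?body) * (n + 1)) (J n)"
    by (rule runs_for[where J=J, OF _ J0 _ step]) (auto simp: J_def agree_def n)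
  then have "runs (dedup e d out) s (2 + (cost (Reg rn) + 2 + bound ?body) * (n + 1)) (J n)"
    unfolding dedup_def
    by (intro runs_Seq[OF runs_loopfree[where Q="\<lambda>s'. s' = run (Assign rt (Const 0)) s"]]) auto
  then show ?thesis
    by (rule runs_mono) (auto simp: J_def inc_def algebra_simps)
qed

definition column :: "nat \<Rightarrow> exp" where
  "column c = Arr 0 (Plus (times w (Reg rt)) (Const c))"

text \<open>The number \<open>n\<close> is part of the data, so the product of a class with
  \<open>n\<close> is looked up: cell \<open>i\<close> of \<open>amul\<close> holds
  \<open>i * n\<close>.\<close>

definition pair :: "nat \<Rightarrow> nat \<Rightarrow> exp" where
  "pair a b = Plus (Arr amul (Arr a (Reg rt))) (Arr b (Reg rt))"

text \<open>
  Array \<open>f\<close> holds the classes of the tuples with respect to the columns treated so far. They are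
  refined by one column at a time: values are first replaced by numbers below \<open>n\<close>, so that a pair of
  a class and a value can be used as an index.
\<close>

primrec chain :: "nat \<Rightarrow> nat list \<Rightarrow> com" where
  "chain f [] = Skip"
| "chain f (c # cs) = Seq (dedup (column c) (f + 1) (f + 2))
    (Seq (dedup (pair f (f + 2)) (f + 3) (f + 4)) (chain (f + 4) cs))"

text \<open>A number \<open>x * n + y\<close> with \<open>y < n\<close> determines \<open>x\<close>
  and \<open>y\<close>. Only indices up to \<open>t\<close> matter for \<open>first\<close>, so it
  suffices that \<open>h\<close> has this form below \<open>n\<close>.\<close>

lemma first_pair:
  assumes "t < n" and "\<And>u. u < n \<Longrightarrow> h u = first f u * n + first g u"
  shows "first h t = first (\<lambda>u. (f u, g u)) t"
proof (rule first_cong)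
  fix u assume "u \<le> t"
  have "x = x' \<and> y = y'" if "x * n + y = x' * n + y'" "y < n" "y' < n" for x x' y y' :: nat
    using that by (metis add.commute add_left_cancel div_mult_self3 div_less mod_less mod_mult_self3 add_0_right nat_neq_iff not_less_zero)
  from this[of "first f u" "first g u" "first f t" "first g t"]
  have "first f u * n + first g u = first f t * n + first g t \<longleftrightarrow> f u = f t \<and> g u = g t"
    using \<open>u \<le> t\<close> assms(1) first_less[of u n g] first_less[of t n g]
      first_eq_iff[of f u t] first_eq_iff[of g u t] by auto
  then show "h u = h t \<longleftrightarrow> (f u, g u) = (f t, g t)"
    using \<open>u \<le> t\<close> assms by simp
qed

text \<open>The list \<open>ds\<close> holds the columns already treated, and the induction shifts
  columns from \<open>cs\<close> to it. Each column uses four fresh arrays above \<open>f\<close>,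
  which are therefore still zero. \<open>C\<close> is chosen before state and input size, as data
  complexity demands.\<close>

lemma runs_chain:
  "\<exists>C. \<forall>s n ds. f > k + 20 \<longrightarrow> reg s rn = n \<longrightarrow> (\<forall>i<n. arr s amul i = i * n) \<longrightarrow>
     (\<forall>a>f. arr s a = (\<lambda>_. 0)) \<longrightarrow>
     (\<forall>t<n. arr s f t = first (\<lambda>t. map (\<lambda>c. arr s 0 (w * t + c)) ds) t) \<longrightarrow>
     runs (chain f cs) s (C * (n + 1)) (\<lambda>s'. agree {rt, ri} {f<..f + 4 * length cs} s s' \<and>
       (\<forall>t<n. arr s' (f + 4 * length cs) t = first (\<lambda>t. map (\<lambda>c. arr s 0 (w * t + c)) (ds @ cs)) t))"
proof (induction cs arbitrary: f)
  case Nil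
  show ?case
    by (intro exI[of _ 1] allI impI runs_loopfree) auto
next
  case (Cons c cs)
  obtain C where C: "\<And>s n ds. f + 4 > k + 20 \<Longrightarrow> reg s rn = n \<Longrightarrow> (\<forall>i<n. arr s amul i = i * n) \<Longrightarrow>
     (\<forall>a>f + 4. arr s a = (\<lambda>_. 0)) \<Longrightarrow>
     (\<forall>t<n. arr s (f + 4) t = first (\<lambda>t. map (\<lambda>c. arr s 0 (w * t + c)) ds) t) \<Longrightarrow>
     runs (chain (f + 4) cs) s (C * (n + 1)) (\<lambda>s'. agree {rt, ri} {f + 4<..f + 4 + 4 * length cs} s s' \<and>
       (\<forall>t<n. arr s' (f + 4 + 4 * length cs) t = first (\<lambda>t. map (\<lambda>c. arr s 0 (w * t + c)) (ds @ cs)) t))"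
    using Cons[of "f + 4"] by blast
  let ?C1 = "cost (column c) + 30" and ?C2 = "cost (pair f (f + 2)) + 30"
  show ?case
  proof (intro exI[of _ "?C1 + (?C2 + C)"] allI impI)
    fix s :: state and n ds
    assume f: "k + 20 < f" and n: "reg s rn = n" and mul: "\<forall>i<n. arr s amul i = i * n"
      and zero: "\<forall>a>f. arr s a = (\<lambda>_. 0)"
      and cur: "\<forall>t<n. arr s f t = first (\<lambda>t. map (\<lambda>c. arr s 0 (w * t + c)) ds) t"
    let ?v = "\<lambda>t. arr s 0 (w * t + c)" and ?g = "\<lambda>t. map (\<lambda>c. arr s 0 (w * t + c)) ds"
    let ?Q = "\<lambda>s'. agree {rt, ri} {f<..f + 4 * length (c # cs)} s s' \<and>
       (\<forall>t<n. arr s' (f + 4 * length (c # cs)) t = first (\<lambda>t. map (\<lambda>c. arr s 0 (w * t + c)) (ds @ c # cs)) t)"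
    let ?key = "\<lambda>t. if t < n then first ?g t * n + first ?v t else 0"
    have 1: "runs (dedup (column c) (f + 1) (f + 2)) s (?C1 * (n + 1))
       (\<lambda>s'. agree {rt, ri} {f + 1, f + 2} s s' \<and> (\<forall>t<n. arr s' (f + 2) t = first ?v t))"
      using f n zero by (intro runs_dedup) (auto simp: column_def agree_def)
    have 2: "runs (dedup (pair f (f + 2)) (f + 3) (f + 4)) s1 (?C2 * (n + 1))
       (\<lambda>s'. agree {rt, ri} {f + 3, f + 4} s1 s' \<and> (\<forall>t<n. arr s' (f + 4) t = first ?key t))"
      if "agree {rt, ri} {f + 1, f + 2} s s1" "\<forall>t<n. arr s1 (f + 2) t = first ?v t" for s1
      using that f n zero mul cur by (intro runs_dedup) (auto simp: pair_def agree_def first_less)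
    have key: "first ?key t = first (\<lambda>t. map (\<lambda>c. arr s 0 (w * t + c)) (ds @ [c])) t" if "t < n" for t
      using first_pair[OF that, of ?key ?g ?v] by (simp add: first_def)
    have 3: "runs (chain (f + 4) cs) s2 (C * (n + 1)) ?Q"
      if s2: "agree {rt, ri} {f + 3, f + 4} s1 s2" "\<forall>t<n. arr s2 (f + 4) t = first ?key t"
        and s1: "agree {rt, ri} {f + 1, f + 2} s s1" for s1 s2
    proof -
      have ag: "agree {rt, ri} {f + 1, f + 2, f + 3, f + 4} s s2"
        using agree_trans[OF s1 s2(1)] by (simp add: insert_commute)
      have "runs (chain (f + 4) cs) s2 (C * (n + 1)) (\<lambda>s'. agree {rt, ri} {f + 4<..f + 4 + 4 * length cs} s2 s' \<and>
        (\<forall>t<n. arr s' (f + 4 + 4 * length cs) t = first (\<lambda>t. map (\<lambda>c. arr s2 0 (w * t + c)) ((ds @ [c]) @ cs)) t))"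
        using ag s2(2) f n mul zero key by (intro C) (auto simp: agree_def)
      then show ?thesis
        by (rule runs_mono) (use ag f in \<open>auto simp: agree_def add.assoc\<close>)
    qed
    have "runs (chain f (c # cs)) s (?C1 * (n + 1) + (?C2 * (n + 1) + C * (n + 1))) ?Q"
      unfolding chain.simps
      by (rule runs_Seq[OF 1], elim conjE, rule runs_Seq[OF 2]) (use 3 in blast)+
    then show "runs (chain f (c # cs)) s ((?C1 + (?C2 + C)) * (n + 1)) ?Q"
      by (simp add: algebra_simps)
  qed
qed

end

section \<open>Linked lists\<close>

text \<open>A pointer is an index plus one and 0 ends a list, so that zeroed memory consists of
  empty lists.\<close>

primrec linked :: "(nat \<Rightarrow> nat) \<Rightarrow> nat \<Rightarrow> nat list \<Rightarrow> bool" where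
  "linked next p [] \<longleftrightarrow> p = 0"
| "linked next p (x # xs) \<longleftrightarrow> p = Suc x \<and> linked next (next x) xs"

lemma linked_upd [simp]: "y \<notin> set xs \<Longrightarrow> linked (next(y := z)) p xs \<longleftrightarrow> linked next p xs"
  by (induction xs arbitrary: p) auto

lemma linked_0 [simp]: "linked next 0 xs \<longleftrightarrow> xs = []"
  by (cases xs) auto

lemma linked_pos:
  assumes "linked next p xs" "p \<noteq> 0"
  obtains ys where "xs = (p - 1) # ys" "linked next (next (p - 1)) ys"
  using assms by (cases xs) auto

text \<open>Each element has one value under \<open>f\<close> and is counted at most once. This
  bounds the total size of the initial lists in the potential.\<close>

lemma sum_length_filter_le:
  assumes "finite S"
  shows "(\<Sum>l\<in>S. length (filter (\<lambda>x. f x = l) xs)) \<le> length xs"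
proof (induction xs)
  case (Cons x xs)
  have "(\<Sum>l\<in>S. length (filter (\<lambda>x. f x = l) (x # xs))) =
      (\<Sum>l\<in>S. (if f x = l then 1 else 0) + length (filter (\<lambda>x. f x = l) xs))"
    by (intro sum.cong) auto
  also have "\<dots> \<le> 1 + length xs"
    using Cons assms by (simp add: sum.distrib)
  finally show ?case by simp
qed simp

lemma card_less_Suc:
  "card {N. N < Suc q \<and> P N} = card {N. N < q \<and> P N} + (if P q then 1 else 0)"
proof -
  have "{N. N < Suc q \<and> P N} = (if P q then insert q {N. N < q \<and> P N} else {N. N < q \<and> P N})"
    by (auto simp: less_Suc_eq)
  then show ?thesis by simp
qed


section \<open>Initialization\<close>

context layout
begin

definition multiples :: com where
  "multiples = Seq (Seq (Assign rt (Const 0)) (Assign ri (Const 0)))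
     (WhileLess (Reg rt) (Reg rn)
       (seqs [Store amul (Reg rt) (Reg ri), Assign ri (Plus (Reg ri) (Reg rn)), inc rt]))"

lemma runs_multiples:
  assumes n: "reg s rn = n"
  shows "runs multiples s (20 * (n + 1))
    (\<lambda>s'. agree {rt, ri} {amul} s s' \<and> (\<forall>i<n. arr s' amul i = i * n))"
proof -
  define J where "J q s' \<longleftrightarrow> agree {rt, ri} {amul} s s' \<and> reg s' rt = q \<and> reg s' ri = q * n \<and>
      (\<forall>i<q. arr s' amul i = i * n)" for q s'
  let ?init = "Seq (Assign rt (Const 0)) (Assign ri (Const 0))"
  let ?body = "seqs [Store amul (Reg rt) (Reg ri), Assign ri (Plus (Reg ri) (Reg rn)), inc rt]"
  have J0: "J 0 (run ?init s)" by (simp add: J_def agree_def)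
  have step: "J (Suc q) (run ?body s')" if "q < n" "J q s'" for q s'
    using that n by (auto simp: J_def agree_def less_Suc_eq)
  have "runs (WhileLess (Reg rt) (Reg rn) ?body) (run ?init s)
      ((cost (Reg rn) + 2 + bound ?body) * (n + 1)) (J n)"
    by (rule runs_for[where J=J, OF _ J0 _ step]) (auto simp: J_def agree_def n)
  then have "runs multiples s (4 + (cost (Reg rn) + 2 + bound ?body) * (n + 1)) (J n)"
    unfolding multiples_def
    by (intro runs_Seq[OF runs_loopfree[where Q="\<lambda>s'. s' = run ?init s"]]) auto
  then show ?thesis
    by (rule runs_mono) (auto simp: J_def inc_def algebra_simps)
qed

text \<open>
  An item is a pair of a set and a tuple; the item of the \<open>j\<close>-th set and tuple \<open>t\<close> is represented
  by the number \<open>j * n + t\<close>. A group is represented by its first item.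
\<close>

definition append_items :: "nat \<Rightarrow> nat \<Rightarrow> com" where
  "append_items a j = Seq (Assign rt (Const 0)) (WhileLess (Reg rt) (Reg rn) (seqs
     [Assign ri (Plus (times j (Reg rn)) (Reg rt)),
      Store acls (Reg ri) (Plus (times j (Reg rn)) (Arr a (Reg rt))),
      Store atup (Reg ri) (Reg rt),
      Store aset (Reg ri) (Const j),
      inc rt]))"

lemma runs_append_items:
  "\<exists>C. \<forall>s n. reg s rn = n \<longrightarrow> a \<notin> {acls, atup, aset} \<longrightarrow>
    runs (append_items a j) s (C * (n + 1)) (\<lambda>s'. agree {rt, ri} {acls, atup, aset} s s' \<and>
      (\<forall>t<n. arr s' acls (j * n + t) = j * n + arr s a t \<and> arr s' atup (j * n + t) = t \<and>
        arr s' aset (j * n + t) = j) \<and>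
      (\<forall>N < j * n. arr s' acls N = arr s acls N \<and> arr s' atup N = arr s atup N \<and>
        arr s' aset N = arr s aset N))"
proof -
  let ?body = "seqs
     [Assign ri (Plus (times j (Reg rn)) (Reg rt)),
      Store acls (Reg ri) (Plus (times j (Reg rn)) (Arr a (Reg rt))),
      Store atup (Reg ri) (Reg rt),
      Store aset (Reg ri) (Const j),
      inc rt]"
  show ?thesis
  proof (intro exI[of _ "2 + (cost (Reg rn) + 2 + bound ?body)"] allI impI)
    fix s :: state and n
    assume n: "reg s rn = n" and a: "a \<notin> {acls, atup, aset}"
    define J where "J q s' \<longleftrightarrow> agree {rt, ri} {acls, atup, aset} s s' \<and> reg s' rt = q \<and>
      (\<forall>t<q. arr s' acls (j * n + t) = j * n + arr s a t \<and> arr s' atup (j * n + t) = t \<and>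
        arr s' aset (j * n + t) = j) \<and>
      (\<forall>N < j * n. arr s' acls N = arr s acls N \<and> arr s' atup N = arr s atup N \<and>
        arr s' aset N = arr s aset N)" for q s'
    have J0: "J 0 (run (Assign rt (Const 0)) s)" by (simp add: J_def agree_def)
    have step: "J (Suc q) (run ?body s')" if "q < n" "J q s'" for q s'
      using that n a by (auto simp: J_def agree_def less_Suc_eq)
    have "runs (WhileLess (Reg rt) (Reg rn) ?body) (run (Assign rt (Const 0)) s)
        ((cost (Reg rn) + 2 + bound ?body) * (n + 1)) (J n)"
      by (rule runs_for[where J=J, OF _ J0 _ step]) (auto simp: J_def agree_def n)
    then have "runs (append_items a j) s (2 + (cost (Reg rn) + 2 + bound ?body) * (n + 1)) (J n)"
      unfolding append_items_def
      by (intro runs_Seq[OF runs_loopfree[where Q="\<lambda>s'. s' = run (Assign rt (Const 0)) s"]]) auto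
    then show "runs (append_items a j) s ((2 + (cost (Reg rn) + 2 + bound ?body)) * (n + 1))
      (\<lambda>s'. agree {rt, ri} {acls, atup, aset} s s' \<and>
      (\<forall>t<n. arr s' acls (j * n + t) = j * n + arr s a t \<and> arr s' atup (j * n + t) = t \<and>
        arr s' aset (j * n + t) = j) \<and>
      (\<forall>N < j * n. arr s' acls N = arr s acls N \<and> arr s' atup N = arr s atup N \<and>
        arr s' aset N = arr s aset N))"
      by (rule runs_mono) (auto simp: J_def)
  qed
qed

primrec items :: "nat \<Rightarrow> nat \<Rightarrow> nat list list \<Rightarrow> com" where
  "items f j [] = Skip"
| "items f j (cs # css) = Seq (chain f cs)
     (Seq (append_items (f + 4 * length cs) j) (items (f + 4 * length cs + 1) (Suc j) css))"

lemma runs_items: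
  "\<exists>C. \<forall>s n. f > k + 20 \<longrightarrow> reg s rn = n \<longrightarrow> (\<forall>i<n. arr s amul i = i * n) \<longrightarrow>
     (\<forall>a\<ge>f. arr s a = (\<lambda>_. 0)) \<longrightarrow>
     runs (items f j css) s (C * (n + 1)) (\<lambda>s'. agree {rt, ri} ({acls, atup, aset} \<union> {f..}) s s' \<and>
       (\<forall>i<length css. \<forall>t<n.
         arr s' acls ((j + i) * n + t) = (j + i) * n + first (\<lambda>t. map (\<lambda>c. arr s 0 (w * t + c)) (css ! i)) t \<and>
         arr s' atup ((j + i) * n + t) = t \<and> arr s' aset ((j + i) * n + t) = j + i) \<and>
       (\<forall>N < j * n. arr s' acls N = arr s acls N \<and> arr s' atup N = arr s atup N \<and>
         arr s' aset N = arr s aset N))"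
proof (induction css arbitrary: f j)
  case Nil
  show ?case by (intro exI[of _ 1] allI impI runs_loopfree) auto
next
  case (Cons cs css)
  let ?f = "f + 4 * length cs" and ?K = "\<lambda>s cs t. map (\<lambda>c. arr s 0 (w * t + c)) cs"
  let ?post = "\<lambda>f j css n s s'. agree {rt, ri} ({acls, atup, aset} \<union> {f..}) s s' \<and>
       (\<forall>i<length css. \<forall>t<n.
         arr s' acls ((j + i) * n + t) = (j + i) * n + first (?K s (css ! i)) t \<and>
         arr s' atup ((j + i) * n + t) = t \<and> arr s' aset ((j + i) * n + t) = j + i) \<and>
       (\<forall>N < j * n. arr s' acls N = arr s acls N \<and> arr s' atup N = arr s atup N \<and>
         arr s' aset N = arr s aset N)"
  obtain C1 where C1: "\<And>s n ds. f > k + 20 \<Longrightarrow> reg s rn = n \<Longrightarrow> (\<forall>i<n. arr s amul i = i * n) \<Longrightarrow>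
     (\<forall>a>f. arr s a = (\<lambda>_. 0)) \<Longrightarrow> (\<forall>t<n. arr s f t = first (?K s ds) t) \<Longrightarrow>
     runs (chain f cs) s (C1 * (n + 1)) (\<lambda>s'. agree {rt, ri} {f<..?f} s s' \<and>
       (\<forall>t<n. arr s' ?f t = first (?K s (ds @ cs)) t))"
    using runs_chain[of f cs] by blast
  obtain C2 where C2: "\<And>s n. reg s rn = n \<Longrightarrow> ?f \<notin> {acls, atup, aset} \<Longrightarrow>
    runs (append_items ?f j) s (C2 * (n + 1)) (\<lambda>s'. agree {rt, ri} {acls, atup, aset} s s' \<and>
      (\<forall>t<n. arr s' acls (j * n + t) = j * n + arr s ?f t \<and> arr s' atup (j * n + t) = t \<and>
        arr s' aset (j * n + t) = j) \<and>
      (\<forall>N < j * n. arr s' acls N = arr s acls N \<and> arr s' atup N = arr s atup N \<and>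
        arr s' aset N = arr s aset N))"
    using runs_append_items[of ?f j] by blast
  obtain C3 where C3: "\<And>s n. ?f + 1 > k + 20 \<Longrightarrow> reg s rn = n \<Longrightarrow> (\<forall>i<n. arr s amul i = i * n) \<Longrightarrow>
     (\<forall>a\<ge>?f + 1. arr s a = (\<lambda>_. 0)) \<Longrightarrow>
     runs (items (?f + 1) (Suc j) css) s (C3 * (n + 1)) (?post (?f + 1) (Suc j) css n s)"
    using Cons[of "?f + 1" "Suc j"] by blast
  show ?case
  proof (intro exI[of _ "C1 + (C2 + C3)"] allI impI)
    fix s :: state and n
    assume f: "k + 20 < f" and n: "reg s rn = n" and mul: "\<forall>i<n. arr s amul i = i * n"
      and zero: "\<forall>a\<ge>f. arr s a = (\<lambda>_. 0)"
    let ?Q1 = "\<lambda>s1. agree {rt, ri} {f<..?f} s s1 \<and> (\<forall>t<n. arr s1 ?f t = first (?K s cs) t)"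
    let ?Q2 = "\<lambda>s2. agree {rt, ri} ({acls, atup, aset} \<union> {f<..?f}) s s2 \<and>
      (\<forall>t<n. arr s2 acls (j * n + t) = j * n + first (?K s cs) t \<and> arr s2 atup (j * n + t) = t \<and>
        arr s2 aset (j * n + t) = j) \<and>
      (\<forall>N < j * n. arr s2 acls N = arr s acls N \<and> arr s2 atup N = arr s atup N \<and>
        arr s2 aset N = arr s aset N)"
    \<comment> \<open>Before any column is treated, all tuples form one class, named 0; this is what
      the zeroed array \<open>f\<close> holds.\<close>
    have 1: "runs (chain f cs) s (C1 * (n + 1)) ?Q1"
      using C1[of s n "[]"] f n mul zero by (simp add: first_def)
    have 2: "runs (append_items ?f j) s1 (C2 * (n + 1)) ?Q2" if "?Q1 s1" for s1
    proof (rule runs_mono[OF C2 order_refl])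
      show "reg s1 rn = n" using that n by (auto simp: agree_def)
      show "?f \<notin> {acls, atup, aset}" using f by auto
      fix s2
      assume "agree {rt, ri} {acls, atup, aset} s1 s2 \<and>
      (\<forall>t<n. arr s2 acls (j * n + t) = j * n + arr s1 ?f t \<and> arr s2 atup (j * n + t) = t \<and>
        arr s2 aset (j * n + t) = j) \<and>
      (\<forall>N < j * n. arr s2 acls N = arr s1 acls N \<and> arr s2 atup N = arr s1 atup N \<and>
        arr s2 aset N = arr s1 aset N)"
      then show "?Q2 s2" using that f by (auto simp: agree_def)
    qed
    have 3: "runs (items (?f + 1) (Suc j) css) s2 (C3 * (n + 1)) (?post f j (cs # css) n s)"
      if Q2: "?Q2 s2" for s2
    proof (rule runs_mono[OF C3 order_refl])
      show "?f + 1 > k + 20" using f by auto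
      show "reg s2 rn = n" "\<forall>i<n. arr s2 amul i = i * n" "\<forall>a\<ge>?f + 1. arr s2 a = (\<lambda>_. 0)"
        using Q2 n f mul zero by (auto simp: agree_def)
      fix s3 assume Q3: "?post (?f + 1) (Suc j) css n s2 s3"
      have arr0: "arr s2 0 = arr s 0" using Q2 f by (simp add: agree_def)
      have old3: "arr s3 acls N = arr s2 acls N \<and> arr s3 atup N = arr s2 atup N \<and>
        arr s3 aset N = arr s2 aset N" if "N < Suc j * n" for N
        using Q3[THEN conjunct2, THEN conjunct2] that by blast
      have tl: "arr s3 acls ((Suc j + i) * n + t) = (Suc j + i) * n + first (?K s (css ! i)) t \<and>
         arr s3 atup ((Suc j + i) * n + t) = t \<and> arr s3 aset ((Suc j + i) * n + t) = Suc j + i"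
        if "i < length css" "t < n" for i t
        using Q3[unfolded arr0, THEN conjunct2, THEN conjunct1] that by blast
      have new: "arr s3 acls ((j + i) * n + t) = (j + i) * n + first (?K s ((cs # css) ! i)) t \<and>
         arr s3 atup ((j + i) * n + t) = t \<and> arr s3 aset ((j + i) * n + t) = j + i"
        if i: "i < length (cs # css)" and t: "t < n" for i t
      proof (cases i)
        case 0
        have "arr s2 acls (j * n + t) = j * n + first (?K s cs) t \<and> arr s2 atup (j * n + t) = t \<and>
          arr s2 aset (j * n + t) = j" using Q2 t by simp
        then show ?thesis using old3[of "j * n + t"] t 0 by simp
      next
        case (Suc i')
        have eq: "j + Suc i' = Suc j + i'" by simp
        have "i' < length css" using i Suc by simp
        from tl[OF this t] show ?thesis unfolding Suc nth_Cons_Suc eq .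
      qed
      show "?post f j (cs # css) n s s3"
      proof (intro conjI)
        show "agree {rt, ri} ({acls, atup, aset} \<union> {f..}) s s3"
          using Q2 Q3 by (auto simp: agree_def)
        show "\<forall>i<length (cs # css). \<forall>t<n.
          arr s3 acls ((j + i) * n + t) = (j + i) * n + first (?K s ((cs # css) ! i)) t \<and>
          arr s3 atup ((j + i) * n + t) = t \<and> arr s3 aset ((j + i) * n + t) = j + i"
          using new by blast
        have "N < Suc j * n" if "N < j * n" for N using that by simp
        then show "\<forall>N < j * n. arr s3 acls N = arr s acls N \<and> arr s3 atup N = arr s atup N \<and>
          arr s3 aset N = arr s aset N"
          using Q2 old3 by simp
      qed
    qed
    have "runs (items f j (cs # css)) s (C1 * (n + 1) + (C2 * (n + 1) + C3 * (n + 1)))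
        (?post f j (cs # css) n s)"
      unfolding items.simps
      by (rule runs_Seq[OF 1], rule runs_Seq[OF 2], assumption, rule 3)
    then show "runs (items f j (cs # css)) s ((C1 + (C2 + C3)) * (n + 1)) (?post f j (cs # css) n s)"
      by (simp add: algebra_simps)
  qed
qed

text \<open>All items enter the lists, since all tuples of a group have to be moved, but an item
  raises the degree only if its tuple is the first of its class for \<open>Y\<close>: the comparison
  asks whether array \<open>y\<close> names an earlier tuple.\<close>

definition groups :: "nat \<Rightarrow> com" where
  "groups y = Seq (Assign rN (Const 0)) (WhileLess (Reg rN) (Reg rm) (seqs
     [Assign rG (Arr acls (Reg rN)),
      Store anext (Reg rN) (Arr ahead (Reg rG)),
      Store ahead (Reg rG) (Plus (Reg rN) (Const 1)),
      IfLess (Arr y (Arr atup (Reg rN))) (Arr atup (Reg rN)) Skip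
        (Store adeg (Reg rG) (Plus (Arr adeg (Reg rG)) (Const 1))),
      inc rN]))"

lemma runs_groups:
  assumes m: "reg s rm = m" and y: "y > k + 20" and zero: "arr s ahead = (\<lambda>_. 0)" "arr s adeg = (\<lambda>_. 0)"
  shows "runs (groups y) s (100 * (m + 1)) (\<lambda>s'. agree {rN, rG} {anext, ahead, adeg} s s' \<and>
    (\<forall>G. linked (arr s' anext) (arr s' ahead G) (rev (filter (\<lambda>N. arr s acls N = G) [0..<m])) \<and>
      arr s' adeg G = card {N. N < m \<and> \<not> arr s y (arr s atup N) < arr s atup N \<and> arr s acls N = G}))"
proof -
  define J where "J q s' \<longleftrightarrow> agree {rN, rG} {anext, ahead, adeg} s s' \<and> reg s' rN = q \<and>
    (\<forall>G. linked (arr s' anext) (arr s' ahead G) (rev (filter (\<lambda>N. arr s acls N = G) [0..<q])) \<and>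
      arr s' adeg G = card {N. N < q \<and> \<not> arr s y (arr s atup N) < arr s atup N \<and> arr s acls N = G})"
    for q s'
  let ?body = "seqs
     [Assign rG (Arr acls (Reg rN)),
      Store anext (Reg rN) (Arr ahead (Reg rG)),
      Store ahead (Reg rG) (Plus (Reg rN) (Const 1)),
      IfLess (Arr y (Arr atup (Reg rN))) (Arr atup (Reg rN)) Skip
        (Store adeg (Reg rG) (Plus (Arr adeg (Reg rG)) (Const 1))),
      inc rN]"
  have J0: "J 0 (run (Assign rN (Const 0)) s)"
    using zero by (simp add: J_def agree_def)
  have step: "J (Suc q) (run ?body s')" if "q < m" "J q s'" for q s'
    using that y by (auto simp: J_def agree_def card_less_Suc)
  have "runs (WhileLess (Reg rN) (Reg rm) ?body) (run (Assign rN (Const 0)) s)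
      ((cost (Reg rm) + 2 + bound ?body) * (m + 1)) (J m)"
    by (rule runs_for[where J=J, OF _ J0 _ step]) (auto simp: J_def agree_def m)
  then have "runs (groups y) s (2 + (cost (Reg rm) + 2 + bound ?body) * (m + 1)) (J m)"
    unfolding groups_def
    by (intro runs_Seq[OF runs_loopfree[where Q="\<lambda>s'. s' = run (Assign rN (Const 0)) s"]]) auto
  then show ?thesis
    by (rule runs_mono) (auto simp: J_def inc_def algebra_simps)
qed

text \<open>A group can have several entries in the buckets, one for each degree it has had. List
  cells are therefore numbered by \<open>re\<close>, and \<open>abgroup\<close> leads from an entry
  back to its group.\<close>

definition push :: com where
  "push = seqs
     [Assign rd (Arr adeg (Reg rG)),
      Store abnext (Reg re) (Arr abucket (Reg rd)),
      Store abgroup (Reg re) (Reg rG),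
      Store abucket (Reg rd) (Plus (Reg re) (Const 1)),
      inc re]"

text \<open>All numbers below \<open>rm\<close> are entered, also those that represent no group.
  These have degree 0, and selecting one changes nothing.\<close>

definition fill_buckets :: com where
  "fill_buckets = Seq (Seq (Assign rG (Const 0)) (Assign re (Const 0)))
     (WhileLess (Reg rG) (Reg rm) (Seq push (inc rG)))"

lemma runs_fill_buckets:
  assumes m: "reg s rm = m" and zero: "arr s abucket = (\<lambda>_. 0)"
  shows "runs fill_buckets s (100 * (m + 1)) (\<lambda>s'. agree {rd, rG, re} {abucket, abnext, abgroup} s s' \<and>
    reg s' re = m \<and> (\<forall>G<m. arr s' abgroup G = G) \<and>
    (\<forall>l. linked (arr s' abnext) (arr s' abucket l) (rev (filter (\<lambda>G. arr s adeg G = l) [0..<m]))))"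
proof -
  define J where "J q s' \<longleftrightarrow> agree {rd, rG, re} {abucket, abnext, abgroup} s s' \<and>
    reg s' rG = q \<and> reg s' re = q \<and> (\<forall>G<q. arr s' abgroup G = G) \<and>
    (\<forall>l. linked (arr s' abnext) (arr s' abucket l) (rev (filter (\<lambda>G. arr s adeg G = l) [0..<q])))"
    for q s'
  let ?init = "Seq (Assign rG (Const 0)) (Assign re (Const 0))"
  let ?body = "Seq push (inc rG)"
  have J0: "J 0 (run ?init s)"
    using zero by (simp add: J_def agree_def)
  have step: "J (Suc q) (run ?body s')" if "q < m" "J q s'" for q s'
    using that by (auto simp: J_def agree_def push_def less_Suc_eq)
  have "runs (WhileLess (Reg rG) (Reg rm) ?body) (run ?init s)
      ((cost (Reg rm) + 2 + bound ?body) * (m + 1)) (J m)"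
    by (rule runs_for[where J=J, OF _ J0 _ step]) (auto simp: J_def agree_def m push_def)
  then have "runs fill_buckets s (4 + (cost (Reg rm) + 2 + bound ?body) * (m + 1)) (J m)"
    unfolding fill_buckets_def
    by (intro runs_Seq[OF runs_loopfree[where Q="\<lambda>s'. s' = run ?init s"]]) auto
  then show ?thesis
    by (rule runs_mono) (auto simp: J_def inc_def push_def algebra_simps)
qed

end

section \<open>The main loop\<close>

lemma sum_length_Cons:
  assumes "finite S" "d \<in> S"
  shows "(\<Sum>l\<in>S. length ((B(d := e # B d)) l)) = Suc (\<Sum>l\<in>S. length (B l))"
  using assms by (simp add: sum.remove[of S d])

lemma sum_length_tl:
  assumes "finite S" "d \<in> S" "B d = e # es"
  shows "(\<Sum>l\<in>S. length (B l)) = Suc (\<Sum>l\<in>S. length ((B(d := es)) l))"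
  using assms by (simp add: sum.remove[of S d])

definition live :: "nat \<Rightarrow> nat \<Rightarrow> (nat \<Rightarrow> bool) \<Rightarrow> (nat \<Rightarrow> nat) \<Rightarrow> nat set" where
  "live n m rep own = {N. N < m \<and> own (N mod n) = 0 \<and> rep (N mod n)}"

text \<open>Only one inclusion is maintained: a list may still contain items of tuples that have
  left through a group of another set. They are recognized by their owner and skipped.\<close>

definition listed :: "nat \<Rightarrow> nat \<Rightarrow> (nat \<Rightarrow> nat) \<Rightarrow> (nat \<Rightarrow> nat list) \<Rightarrow> (nat \<Rightarrow> nat) \<Rightarrow> bool" where
  "listed n m cls L own \<longleftrightarrow> (\<forall>N<m. own (N mod n) = 0 \<longrightarrow> N \<in> set (L (cls N)))"

text \<open>Specification of moving group \<open>H\<close>: \<open>H div n\<close> is the number of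
  its set, and \<open>H div n * n + t\<close> is the item of tuple \<open>t\<close> for that
  set.\<close>

definition taken :: "nat \<Rightarrow> (nat \<Rightarrow> nat) \<Rightarrow> nat \<Rightarrow> (nat \<Rightarrow> nat) \<Rightarrow> nat \<Rightarrow> nat" where
  "taken n cls H own t = (if t < n \<and> own t = 0 \<and> cls (H div n * n + t) = H then Suc (H div n) else own t)"

context layout
begin

text \<open>
  Entries of the buckets may be stale: an item whose group has changed its degree since the entry was
  created is skipped. A decrement creates a new entry and moves the position \<open>rp\<close>, below which
  no group has its degree, down by one.
\<close>

definition decrement :: com where
  "decrement = Seq (seqs
     [Assign rG (Arr acls (Reg rN)),
      Store adeg (Reg rG) (Minus (Arr adeg (Reg rG)) (Const 1))])
     (Seq push (seqs
     [Assign rp (Minus (Reg rp) (Const 1)),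
      Assign rN (Plus (Reg rN) (Reg rn))]))"

lemma loopfree_decrement: "loopfree decrement"
  by (simp add: decrement_def push_def)

lemma bound_decrement: "bound decrement \<le> 90"
  by (simp add: decrement_def push_def inc_def)

text \<open>Starting at \<open>t\<close> and advancing by \<open>n\<close>, the inner loop visits
  the items of tuple \<open>t\<close> for all sets. It runs for representatives only, as other
  tuples do not count for the degrees.\<close>

definition take_group :: "nat \<Rightarrow> com" where
  "take_group y = WhileLess (Const 0) (Arr ahead (Reg rH)) (Seq (seqs
     [Assign rN (Minus (Arr ahead (Reg rH)) (Const 1)),
      Store ahead (Reg rH) (Arr anext (Reg rN)),
      Assign rt (Arr atup (Reg rN))])
     (IfLess (Arr aown (Reg rt)) (Const 1)
       (Seq (Seq (Store aown (Reg rt) (Plus (Arr aset (Reg rH)) (Const 1))) (Assign rN (Reg rt)))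
         (IfLess (Arr y (Reg rt)) (Reg rt) Skip (WhileLess (Reg rN) (Reg rm) decrement)))
       Skip))"

text \<open>The two comparisons with \<open>adeg\<close> express equality with \<open>rp\<close>,
  the test for an entry that is not stale. Degrees are at most \<open>rm\<close>, so a position
  beyond \<open>rm\<close> ends the loop.\<close>

definition main_loop :: "nat \<Rightarrow> com" where
  "main_loop y = WhileLess (Reg rp) (Plus (Reg rm) (Const 1))
     (IfLess (Arr abucket (Reg rp)) (Const 1) (inc rp)
       (Seq (seqs
         [Assign rd (Minus (Arr abucket (Reg rp)) (Const 1)),
          Store abucket (Reg rp) (Arr abnext (Reg rd)),
          Assign rH (Arr abgroup (Reg rd))])
        (IfLess (Arr adeg (Reg rH)) (Reg rp) Skip
          (IfLess (Reg rp) (Arr adeg (Reg rH)) Skip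
            (Seq (IfLess (Reg rv) (Reg rp) (Assign rv (Reg rp)) Skip) (take_group y))))))"

definition group_lists :: "nat \<Rightarrow> (nat \<Rightarrow> nat) \<Rightarrow> (nat \<Rightarrow> nat list) \<Rightarrow> state \<Rightarrow> bool" where
  "group_lists m cls L s \<longleftrightarrow>
     (\<forall>G<m. linked (arr s anext) (arr s ahead G) (L G) \<and> (\<forall>N\<in>set (L G). N < m \<and> cls N = G))"

definition bucket_lists :: "nat \<Rightarrow> (nat \<Rightarrow> nat list) \<Rightarrow> state \<Rightarrow> bool" where
  "bucket_lists m B s \<longleftrightarrow>
     (\<forall>l. linked (arr s abnext) (arr s abucket l) (B l) \<and>
       (\<forall>e\<in>set (B l). e < reg s re \<and> arr s abgroup e < m))"

text \<open>An entry is demanded only in the bucket of the current degree and only if that degree is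
  positive; stale entries elsewhere are harmless.\<close>

definition queued :: "(nat \<Rightarrow> nat list) \<Rightarrow> state \<Rightarrow> nat \<Rightarrow> bool" where
  "queued B s G \<longleftrightarrow> (0 < arr s adeg G \<longrightarrow>
     reg s rp \<le> arr s adeg G \<and> (\<exists>e\<in>set (B (arr s adeg G)). arr s abgroup e = G))"

text \<open>
  The live items \<open>A\<close> determine the degrees; \<open>L\<close> and \<open>B\<close> are the contents of the linked lists of the
  groups and buckets; the groups in \<open>X\<close> may be missing from the buckets.
\<close>

definition core :: "nat \<Rightarrow> nat \<Rightarrow> nat \<Rightarrow> (nat \<Rightarrow> nat) \<Rightarrow> (nat \<Rightarrow> bool) \<Rightarrow> nat set \<Rightarrow> nat set \<Rightarrow>
    (nat \<Rightarrow> nat list) \<Rightarrow> (nat \<Rightarrow> nat list) \<Rightarrow> state \<Rightarrow> bool" where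
  "core y n m cls rep A X B L s \<longleftrightarrow>
     reg s rn = n \<and> reg s rm = m \<and>
     (\<forall>N<m. arr s acls N = cls N \<and> arr s atup N = N mod n \<and> arr s aset N = N div n) \<and>
     (\<forall>t<n. arr s y t < t \<longleftrightarrow> \<not> rep t) \<and>
     A \<subseteq> {..<m} \<and>
     (\<forall>G<m. arr s adeg G = card {N \<in> A. cls N = G}) \<and>
     group_lists m cls L s \<and> bucket_lists m B s \<and>
     (\<forall>G<m. G \<notin> X \<longrightarrow> queued B s G) \<and>
     reg s rp \<le> m + 1"

text \<open>
  A live item is worth three units: one for its decrement, one for the bucket entry and one for the
  step back of \<open>rp\<close> which the decrement causes.
\<close>

definition potential :: "nat \<Rightarrow> nat set \<Rightarrow> (nat \<Rightarrow> nat list) \<Rightarrow> (nat \<Rightarrow> nat list) \<Rightarrow> state \<Rightarrow> nat" where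
  "potential m A B L s = 100 * ((m + 1 - reg s rp) + (\<Sum>l\<le>m. length (B l)) + (\<Sum>G<m. length (L G)) + 3 * card A)"

text \<open>Of the three units of the item that dies, one is taken by the new bucket entry and one
  by the step back of \<open>rp\<close>. The third, worth 100, exceeds the cost of the command.
  Lowering \<open>rp\<close> along with one degree keeps it below all positive degrees, without any
  comparison.\<close>

lemma core_decrement:
  assumes core: "core y n m cls rep A X B L s" and N: "reg s rN = N" "N \<in> A"
    and cls: "cls N < m" and y: "y > k + 20"
  defines "s' \<equiv> run decrement s"
  shows "\<exists>B'. core y n m cls rep (A - {N}) X B' L s' \<and>
    potential m (A - {N}) B' L s' + 100 \<le> potential m A B L s \<and>
    agree {rG, rN, rd, re, rp} {adeg, abucket, abnext, abgroup} s s' \<and> reg s' rN = N + n"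
proof -
  have A: "A \<subseteq> {..<m}" and deg: "\<And>G. G < m \<Longrightarrow> arr s adeg G = card {N \<in> A. cls N = G}"
    using core by (auto simp: core_def)
  have old: "queued B s G" if "G < m" "G \<notin> X" for G
    using core that by (simp add: core_def)
  have Nm: "N < m" using A N by auto
  have finA: "finite A" using A finite_subset by blast
  have clsN: "arr s acls N = cls N" using core Nm by (simp add: core_def)
  let ?d = "arr s adeg (cls N) - 1" and ?e = "reg s re"
  let ?B = "B(?d := ?e # B ?d)"
  have dec: "card {N' \<in> A - {N}. cls N' = G} = card {N' \<in> A. cls N' = G} - (if G = cls N then 1 else 0)"
    for G
  proof (cases "G = cls N")
    case True
    have "{N' \<in> A - {N}. cls N' = G} = {N' \<in> A. cls N' = G} - {N}" by auto
    then show ?thesis using True N finA by simp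
  next
    case False
    then have "{N' \<in> A - {N}. cls N' = G} = {N' \<in> A. cls N' = G}" by auto
    then show ?thesis using False by simp
  qed
  have pos: "0 < card {N' \<in> A. cls N' = cls N}"
    using N finA by (auto simp: card_gt_0_iff)
  have "card {N' \<in> A. cls N' = cls N} \<le> card {..<m}"
    using A by (intro card_mono) auto
  then have d: "?d \<le> m" using deg[OF cls] by simp
  have s': "reg s' = (reg s)(rG := cls N, rd := ?d, re := Suc ?e, rp := reg s rp - 1, rN := N + n)"
      "arr s' = (arr s)(adeg := (arr s adeg)(cls N := ?d), abnext := (arr s abnext)(?e := arr s abucket ?d),
         abgroup := (arr s abgroup)(?e := cls N), abucket := (arr s abucket)(?d := Suc ?e))"
    using N clsN core unfolding s'_def
    by (auto simp: decrement_def push_def core_def fun_eq_iff)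
  have old_lists: "bucket_lists m B s" using core by (simp add: core_def)
  \<comment> \<open>Entries in use are numbered below \<open>re\<close>, so writing cell
    \<open>?e\<close> disturbs no list.\<close>
  then have fresh: "?e \<notin> set (B l)" for l by (auto simp: bucket_lists_def)
  have bucket: "bucket_lists m ?B s'"
    using old_lists fresh cls by (auto simp: s' bucket_lists_def less_Suc_eq)
  have deg': "arr s' adeg G = card {N' \<in> A - {N}. cls N' = G}" if "G < m" for G
    unfolding dec using deg[OF that] deg[OF cls] by (simp add: s')
  have live: "queued ?B s' G" if G: "G < m" "G \<notin> X" for G
  proof (cases "G = cls N")
    case True
    have "reg s rp \<le> arr s adeg G" using old[OF G] True pos deg[OF cls] by (simp add: queued_def)
    then have "reg s rp - 1 \<le> ?d" using True by (simp add: diff_le_mono)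
    then show ?thesis using True by (simp add: s' queued_def)
  next
    case False
    then have eq: "arr s' adeg G = arr s adeg G" by (simp add: s')
    show ?thesis
      unfolding queued_def eq
    proof
      assume pos: "0 < arr s adeg G"
      then obtain e where e: "e \<in> set (B (arr s adeg G))" "arr s abgroup e = G" "reg s rp \<le> arr s adeg G"
        using old[OF G] by (auto simp: queued_def)
      have "e \<noteq> ?e" using fresh e(1) by metis
      then have "arr s' abgroup e = G" using e by (simp add: s')
      moreover have "e \<in> set (?B (arr s adeg G))"
        using e(1) by (cases "arr s adeg G = ?d") simp_all
      moreover have "reg s' rp \<le> arr s adeg G" using e(3) by (simp add: s')
      ultimately show "reg s' rp \<le> arr s adeg G \<and> (\<exists>e\<in>set (?B (arr s adeg G)). arr s' abgroup e = G)"
        by blast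
    qed
  qed
  have groups: "group_lists m cls L s'" using core by (simp add: core_def group_lists_def s')
  have "core y n m cls rep (A - {N}) X ?B L s'"
    unfolding core_def
  proof (intro conjI)
    show "\<forall>G<m. G \<notin> X \<longrightarrow> queued ?B s' G" using live by blast
    show "\<forall>G<m. arr s' adeg G = card {N' \<in> A - {N}. cls N' = G}" using deg' by blast
  qed (use core y bucket groups in \<open>auto simp: core_def s'\<close>)
  moreover have "potential m (A - {N}) ?B L s' + 100 \<le> potential m A B L s"
  proof -
    have "card A = Suc (card (A - {N}))" using N finA by (metis card_Suc_Diff1)
    moreover have "(\<Sum>l\<le>m. length (?B l)) = Suc (\<Sum>l\<le>m. length (B l))"
      using d by (intro sum_length_Cons) auto
    moreover have "m + 1 - reg s' rp \<le> Suc (m + 1 - reg s rp)" by (simp add: s')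
    moreover have "100 * (a' + b' + l + 3 * c') + 100 \<le> 100 * (a + b + l + 3 * c)"
      if "c = Suc c'" "b' = Suc b" "a' \<le> Suc a" for a a' b b' c c' l :: nat
    proof -
      have "a' + b' + l + 3 * c' + 1 \<le> a + b + l + 3 * c" using that by linarith
      then have "100 * (a' + b' + l + 3 * c' + 1) \<le> 100 * (a + b + l + 3 * c)" by (rule mult_le_mono2)
      then show ?thesis by simp
    qed
    ultimately show ?thesis unfolding potential_def by blast
  qed
  moreover have "agree {rG, rN, rd, re, rp} {adeg, abucket, abnext, abgroup} s s'" "reg s' rN = N + n"
    by (auto simp: agree_def s')
  ultimately show ?thesis by blast
qed

lemma budget_decrements:
  assumes core: "core y n m cls rep A X B L s" and t: "reg s rN = t" "t < n"
    and sub: "{N. N < m \<and> N mod n = t} \<subseteq> A" and cls: "\<And>N. N < m \<Longrightarrow> cls N < m" and y: "y > k + 20"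
    and b: "potential m A B L s + 3 \<le> b"
  shows "budget (WhileLess (Reg rN) (Reg rm) decrement) s b (\<lambda>s' b'.
    (\<exists>B'. core y n m cls rep (A - {N. N mod n = t}) X B' L s' \<and>
      potential m (A - {N. N mod n = t}) B' L s' \<le> b') \<and>
    agree {rG, rN, rd, re, rp} {adeg, abucket, abnext, abgroup} s s')"
proof -
  let ?A = "\<lambda>q. A - {N. N mod n = t \<and> N < q}"
  \<comment> \<open>The summand 3 is the price of one loop test, kept in reserve for the failing
    one.\<close>
  let ?I = "\<lambda>s' b'. reg s' rN mod n = t \<and>
    (\<exists>B'. core y n m cls rep (?A (reg s' rN)) X B' L s' \<and> potential m (?A (reg s' rN)) B' L s' + 3 \<le> b') \<and>
    agree {rG, rN, rd, re, rp} {adeg, abucket, abnext, abgroup} s s'"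
  have "N mod n \<noteq> t" if "N < t" for N using that mod_less_eq_dividend[of N n] by linarith
  then have "?A t = A" by auto
  then have init: "?I s b" using core t b by (intro conjI exI[of _ B]) simp_all
  show ?thesis
  proof (rule budget_while[where I = ?I, OF init])
  fix s1 b1 assume I: "?I s1 b1"
  then obtain B1 where core1: "core y n m cls rep (?A (reg s1 rN)) X B1 L s1"
      and b1: "potential m (?A (reg s1 rN)) B1 L s1 + 3 \<le> b1"
      and ag1: "agree {rG, rN, rd, re, rp} {adeg, abucket, abnext, abgroup} s s1"
      and mod: "reg s1 rN mod n = t" by blast
  {
    assume less: "val (Reg rN) s1 < val (Reg rm) s1"
    let ?N = "reg s1 rN" and ?s = "run decrement s1"
    have N: "?N < m" using less core1 by (simp add: core_def)
    then have "?N \<in> ?A ?N" using sub mod by auto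
    from core_decrement[OF core1 refl this cls[OF N] y]
    obtain B2 where 2: "core y n m cls rep (?A ?N - {?N}) X B2 L ?s"
      "potential m (?A ?N - {?N}) B2 L ?s + 100 \<le> potential m (?A ?N) B1 L s1"
      "agree {rG, rN, rd, re, rp} {adeg, abucket, abnext, abgroup} s1 ?s" "reg ?s rN = ?N + n"
      by blast
    \<comment> \<open>Items of one tuple are \<open>n\<close> apart, so advancing by
      \<open>n\<close> passes exactly one of them.\<close>
    have "N' = ?N" if "N' mod n = t" "N' < ?N + n" "\<not> N' < ?N" for N'
    proof -
      have "N' mod n = ?N mod n" "?N \<le> N'" using that mod by auto
      then obtain i where "N' = ?N + n * i" by (rule mod_eq_nat1E)
      then show ?thesis using that by (cases i) auto
    qed
    moreover have "?N < ?N + n" using t by simp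
    ultimately have A: "?A (?N + n) = ?A ?N - {?N}" using mod by auto
    have "agree {rG, rN, rd, re, rp} {adeg, abucket, abnext, abgroup} s ?s"
      using agree_trans[OF ag1 2(3)] by simp
    then have "?I ?s (potential m (?A ?N - {?N}) B2 L ?s + 3)"
      using 2(1,4) mod unfolding 2(4) A by auto
    then have "budget decrement s1 (b1 - 3) ?I"
      using 2(2) b1 bound_decrement
      by (intro budget_loopfree[OF loopfree_decrement, where b' = "potential m (?A ?N - {?N}) B2 L ?s + 3"])
        linarith
    then show "\<exists>b'. cost (Reg rN) + cost (Reg rm) + 1 + b' \<le> b1 \<and> budget decrement s1 b' ?I"
      using b1 by (intro exI[of _ "b1 - 3"]) auto
  }
  {
    assume "\<not> val (Reg rN) s1 < val (Reg rm) s1"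
    then have "m \<le> reg s1 rN" using core1 by (simp add: core_def)
    moreover have "A \<subseteq> {..<m}" using core by (simp add: core_def)
    ultimately have "?A (reg s1 rN) = A - {N. N mod n = t}" by (auto dest: subsetD)
    then show "\<exists>b'. cost (Reg rN) + cost (Reg rm) + 1 + b' \<le> b1 \<and>
      (\<exists>B'. core y n m cls rep (A - {N. N mod n = t}) X B' L s1 \<and>
        potential m (A - {N. N mod n = t}) B' L s1 \<le> b') \<and>
      agree {rG, rN, rd, re, rp} {adeg, abucket, abnext, abgroup} s s1"
      using core1 b1 ag1 by (intro exI[of _ "b1 - 3"]) auto
  }
  qed
qed

lemma core_exempt:
  assumes "core y n m cls rep A {H} B L s" and "queued B s H"
  shows "core y n m cls rep A {} B L s"
  using assms unfolding core_def by auto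

lemma core_cong:
  assumes "core y n m cls rep A X B L s" and "arr s' = arr s"
    and "reg s' rn = reg s rn" "reg s' rm = reg s rm" "reg s' rp = reg s rp" "reg s' re = reg s re"
  shows "core y n m cls rep A X B L s'"
  using assms(1) unfolding core_def group_lists_def bucket_lists_def queued_def assms(2-) .

lemma budget_take_group:
  assumes core: "core y n m cls rep (live n m rep (arr s aown)) {H} B L s"
    and listed: "listed n m cls L (arr s aown)"
    and H: "reg s rH = H" "H < m" and m: "n dvd m"
    and cls: "\<And>N. N < m \<Longrightarrow> cls N < m" "\<And>N. N < m \<Longrightarrow> cls N div n = N div n" and y: "y > k + 20"
    and b: "potential m (live n m rep (arr s aown)) B L s + 10 \<le> b"
  shows "budget (take_group y) s b (\<lambda>s' b'.
    (\<exists>B' L'. core y n m cls rep (live n m rep (arr s' aown)) {} B' L' s' \<and>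
      listed n m cls L' (arr s' aown) \<and> potential m (live n m rep (arr s' aown)) B' L' s' \<le> b') \<and>
    agree {rt, rG, rN, rd, re, rp} {ahead, adeg, abucket, abnext, abgroup, aown} s s' \<and>
    arr s' aown = taken n cls H (arr s aown))"
proof -
  let ?live = "\<lambda>s. live n m rep (arr s aown)"
  let ?ag = "agree {rt, rG, rN, rd, re, rp} {ahead, adeg, abucket, abnext, abgroup, aown}"
  \<comment> \<open>Every tuple has its initial or its final owner, whatever part of the list has
    been traversed; that all owners are final follows only once the list is empty.\<close>
  define I where "I s' b' \<longleftrightarrow> (\<exists>B L. core y n m cls rep (?live s') {H} B L s' \<and>
      listed n m cls L (arr s' aown) \<and> potential m (?live s') B L s' + 10 \<le> b') \<and> ?ag s s' \<and>
      (\<forall>t. arr s' aown t = arr s aown t \<or> arr s' aown t = taken n cls H (arr s aown) t)" for s' b'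
  have n: "n > 0" using H(2) m by (cases n) auto
  have item: "H div n * n + t < m" if "t < n" for t
  proof -
    obtain j where j: "m = n * j" using m by blast
    then have "H div n < j" using H(2) by (simp add: less_mult_imp_div_less mult.commute)
    then have "Suc (H div n) * n \<le> j * n" by (intro mult_le_mono1) simp
    then have "H div n * n + n \<le> m" using j by (simp add: mult.commute)
    then show ?thesis using that by linarith
  qed
  have I_intro: "I s' b'" if "core y n m cls rep (?live s') {H} B' L' s'"
      "listed n m cls L' (arr s' aown)" "potential m (?live s') B' L' s' + 10 \<le> b'" "?ag s s'"
      "\<And>t. arr s' aown t = arr s aown t \<or> arr s' aown t = taken n cls H (arr s aown) t" for s' b' B' L'
    using that unfolding I_def by blast
  have init: "I s b" using core listed b by (intro I_intro) auto
  show ?thesis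
    unfolding take_group_def
  proof (rule budget_while[where I = I, OF init])
    fix s1 b1 assume I: "I s1 b1" and "val (Const 0) s1 < val (Arr ahead (Reg rH)) s1"
    then obtain B1 L1 where core1: "core y n m cls rep (?live s1) {H} B1 L1 s1"
      and listed1: "listed n m cls L1 (arr s1 aown)"
      and b1: "potential m (?live s1) B1 L1 s1 + 10 \<le> b1" and ag1: "?ag s s1"
      and own1: "\<And>t. arr s1 aown t = arr s aown t \<or> arr s1 aown t = taken n cls H (arr s aown) t"
      and ne: "arr s1 ahead H \<noteq> 0"
      using H by (auto simp: I_def agree_def)
    have H1: "reg s1 rH = H" using ag1 H by (simp add: agree_def)
    have link: "linked (arr s1 anext) (arr s1 ahead H) (L1 H)" using core1 H(2) by (simp add: core_def group_lists_def)
    let ?N = "arr s1 ahead H - 1" and ?t = "(arr s1 ahead H - 1) mod n"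
    obtain Ns where Ns: "L1 H = ?N # Ns" "linked (arr s1 anext) (arr s1 anext ?N) Ns"
      using linked_pos[OF link ne] .
    have N: "?N < m" "cls ?N = H" using core1 H(2) Ns by (auto simp: core_def group_lists_def)
    have t: "?t < n" using n by simp
    have N_eq: "?N = H div n * n + ?t" using cls(2)[OF N(1)] N(2) by simp
    let ?c2 = "seqs
     [Assign rN (Minus (Arr ahead (Reg rH)) (Const 1)),
      Store ahead (Reg rH) (Arr anext (Reg rN)),
      Assign rt (Arr atup (Reg rN))]"
    define s2 where "s2 = run ?c2 s1"
    let ?L = "L1(H := Ns)"
    have s2_eq: "reg s2 = (reg s1)(rN := ?N, rt := ?t)"
      "arr s2 = (arr s1)(ahead := (arr s1 ahead)(H := arr s1 anext ?N))"
      using core1 N(1) H1 by (auto simp: s2_def core_def)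
    have core2: "core y n m cls rep (?live s1) {H} B1 ?L s2"
    proof -
      have "group_lists m cls ?L s2"
        using core1 Ns by (auto simp: core_def group_lists_def s2_eq)
      then show ?thesis
        using core1 y by (auto simp: core_def bucket_lists_def queued_def s2_eq)
    qed
    \<comment> \<open>The popped cell releases 100 units, which pay for the iteration apart from the
      decrements.\<close>
    have pot2: "potential m (?live s1) B1 ?L s2 + 100 = potential m (?live s1) B1 L1 s1"
      using sum_length_tl[of "{..<m}" H L1 ?N Ns] H(2) Ns(1) by (simp add: potential_def s2_eq)
    have ag2: "?ag s s2" using ag1 by (auto simp: agree_def s2_eq)
    have listed2: "N' \<in> set (?L (cls N'))"
      if "N' < m" "arr s1 aown (N' mod n) = 0" "N' mod n \<noteq> ?t" for N'
    proof -
      have "N' \<in> set (L1 (cls N'))" "N' \<noteq> ?N" using listed1 that by (auto simp: listed_def)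
      then show ?thesis using Ns(1) by (cases "cls N' = H") auto
    qed
    let ?then = "Seq (Seq (Store aown (Reg rt) (Plus (Arr aset (Reg rH)) (Const 1))) (Assign rN (Reg rt)))
         (IfLess (Arr y (Reg rt)) (Reg rt) Skip (WhileLess (Reg rN) (Reg rm) decrement))"
    let ?p = "potential m (?live s1) B1 ?L s2"
    have taken: "budget ?then s2 (?p + 60) I" if own: "arr s1 aown ?t = 0"
    proof -
      let ?c3 = "Seq (Store aown (Reg rt) (Plus (Arr aset (Reg rH)) (Const 1))) (Assign rN (Reg rt))"
      define s3 where "s3 = run ?c3 s2"
      have s3_eq: "reg s3 = (reg s1)(rN := ?t, rt := ?t)"
        "arr s3 = (arr s1)(ahead := (arr s1 ahead)(H := arr s1 anext ?N),
           aown := (arr s1 aown)(?t := Suc (H div n)))"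
        using core1 H H1 by (auto simp: s3_def s2_eq core_def)
      have core3: "core y n m cls rep (?live s1) {H} B1 ?L s3"
        using core2 y by (auto simp: core_def group_lists_def bucket_lists_def queued_def s2_eq s3_eq)
      have pot3: "potential m (?live s1) B1 ?L s3 = ?p" by (simp add: potential_def s2_eq s3_eq)
      have ag3: "?ag s s3" using ag1 by (auto simp: agree_def s3_eq)
      have listed3: "listed n m cls ?L (arr s3 aown)"
        unfolding listed_def
      proof (intro allI impI)
        fix N' assume "N' < m" "arr s3 aown (N' mod n) = 0"
        then show "N' \<in> set (?L (cls N'))"
          by (intro listed2) (auto simp: s3_eq split: if_splits)
      qed
      have "taken n cls H (arr s aown) ?t = Suc (H div n)"
        using own own1[of ?t] t N_eq N(2) by (auto simp: taken_def)
      then have own3: "arr s3 aown t = arr s aown t \<or> arr s3 aown t = taken n cls H (arr s aown) t" for t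
        using own1[of t] by (simp add: s3_eq)
      have "budget (IfLess (Arr y (Reg rt)) (Reg rt) Skip (WhileLess (Reg rN) (Reg rm) decrement)) s3 (?p + 50) I"
      proof (rule budget_If)
        show "cost (Arr y (Reg rt)) + cost (Reg rt) + 1 + (?p + 40) \<le> ?p + 50" by simp
        have y3: "arr s3 y ?t < ?t \<longleftrightarrow> \<not> rep ?t" using core3 t by (simp add: core_def)
        {
          assume "val (Arr y (Reg rt)) s3 < val (Reg rt) s3"
          then have "\<not> rep ?t" using y3 by (simp add: s3_eq)
          \<comment> \<open>A tuple that is not a representative has no live items, so its move
            leaves all degrees as they are.\<close>
          then have live3: "?live s3 = ?live s1" using own by (auto simp: live_def s3_eq)
          have "I s3 (?p + 10)"
            using ag3 own3 by (intro I_intro[OF core3[folded live3] listed3]) (auto simp: live3 pot3)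
          then show "budget Skip s3 (?p + 40) I" by (intro budget_loopfree) auto
        }
        {
          assume "\<not> val (Arr y (Reg rt)) s3 < val (Reg rt) s3"
          then have "rep ?t" using y3 by (simp add: s3_eq)
          then have sub: "{N. N < m \<and> N mod n = ?t} \<subseteq> ?live s1" using own by (auto simp: live_def)
          have live3: "?live s1 - {N. N mod n = ?t} = ?live s3" by (auto simp: live_def s3_eq)
          have "budget (WhileLess (Reg rN) (Reg rm) decrement) s3 (?p + 3) (\<lambda>s' b'.
            (\<exists>B'. core y n m cls rep (?live s3) {H} B' ?L s' \<and> potential m (?live s3) B' ?L s' \<le> b') \<and>
            agree {rG, rN, rd, re, rp} {adeg, abucket, abnext, abgroup} s3 s')"
            using budget_decrements[OF core3 _ t sub cls(1) y, of "?p + 3"] pot3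
            unfolding live3 by (simp add: s3_eq)
          \<comment> \<open>The decrements need 3 of the 40 units beyond the potential; the other 37
            cover the 10 that \<open>I\<close> demands.\<close>
          from budget_slack[OF this, of 37]
          have "budget (WhileLess (Reg rN) (Reg rm) decrement) s3 (?p + 40) (\<lambda>s' b'.
            (\<exists>B'. core y n m cls rep (?live s3) {H} B' ?L s' \<and> potential m (?live s3) B' ?L s' + 37 \<le> b') \<and>
            agree {rG, rN, rd, re, rp} {adeg, abucket, abnext, abgroup} s3 s')"
            by (rule budget_mono) auto
          then show "budget (WhileLess (Reg rN) (Reg rm) decrement) s3 (?p + 40) I"
          proof (rule budget_mono[OF _ order_refl])
            fix s4 b4
            assume "(\<exists>B'. core y n m cls rep (?live s3) {H} B' ?L s4 \<and> potential m (?live s3) B' ?L s4 + 37 \<le> b4) \<and>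
              agree {rG, rN, rd, re, rp} {adeg, abucket, abnext, abgroup} s3 s4"
            then obtain B4 where 4: "core y n m cls rep (?live s3) {H} B4 ?L s4"
              "potential m (?live s3) B4 ?L s4 + 37 \<le> b4"
              "agree {rG, rN, rd, re, rp} {adeg, abucket, abnext, abgroup} s3 s4" by blast
            have own4: "arr s4 aown = arr s3 aown" using 4(3) by (simp add: agree_def)
            have "?ag s s4" using ag3 4(3) by (auto simp: agree_def)
            then show "I s4 b4"
              using 4 listed3 own3 unfolding own4[symmetric] by (intro I_intro) auto
          qed
        }
      qed
      then show ?thesis unfolding s3_def by (rule budget_Seq_loopfree) simp_all
    qed
    have skip: "budget Skip s2 (?p + 60) I" if own: "arr s1 aown ?t \<noteq> 0"
    proof (rule budget_loopfree[where b' = "?p + 10"])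
      have "listed n m cls ?L (arr s2 aown)"
        unfolding listed_def
      proof (intro allI impI)
        fix N' assume "N' < m" "arr s2 aown (N' mod n) = 0"
        then show "N' \<in> set (?L (cls N'))"
          using own by (intro listed2) (auto simp: s2_eq split: if_splits)
      qed
      moreover have own2: "arr s2 aown = arr s1 aown" by (simp add: s2_eq)
      ultimately show "I (run Skip s2) (?p + 10)"
        using I_intro[of s2 B1 ?L "?p + 10"] core2 ag2 own1 by simp
    qed auto
    have if_own: "budget (IfLess (Arr aown (Reg rt)) (Const 1) ?then Skip) s2 (?p + 70) I"
      using taken skip by (intro budget_If[where b' = "?p + 60"]) (auto simp: s2_eq)
    show "\<exists>b'. cost (Const 0) + cost (Arr ahead (Reg rH)) + 1 + b' \<le> b1 \<and>
        budget (Seq ?c2 (IfLess (Arr aown (Reg rt)) (Const 1) ?then Skip)) s1 b' I"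
    proof (intro exI[of _ "?p + 100"] conjI)
      show "cost (Const 0) + cost (Arr ahead (Reg rH)) + 1 + (?p + 100) \<le> b1" using b1 pot2 by simp
      show "budget (Seq ?c2 (IfLess (Arr aown (Reg rt)) (Const 1) ?then Skip)) s1 (?p + 100) I"
        by (rule budget_Seq_loopfree[OF if_own[unfolded s2_def], folded s2_def]) simp_all
    qed
  next
    fix s1 b1 assume I: "I s1 b1" and "\<not> val (Const 0) s1 < val (Arr ahead (Reg rH)) s1"
    then obtain B1 L1 where core1: "core y n m cls rep (?live s1) {H} B1 L1 s1"
      and listed1: "listed n m cls L1 (arr s1 aown)"
      and b1: "potential m (?live s1) B1 L1 s1 + 10 \<le> b1" and ag1: "?ag s s1"
      and own1: "\<And>t. arr s1 aown t = arr s aown t \<or> arr s1 aown t = taken n cls H (arr s aown) t"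
      and z: "arr s1 ahead H = 0"
      using H by (auto simp: I_def agree_def)
    have "linked (arr s1 anext) (arr s1 ahead H) (L1 H)" using core1 H(2) by (simp add: core_def group_lists_def)
    then have L: "L1 H = []" using z by simp
    \<comment> \<open>With an empty list, \<open>listed\<close> says that no tuple of the group
      remains.\<close>
    have dead: "arr s1 aown (N mod n) \<noteq> 0" if "N < m" "cls N = H" for N
      using listed1 that L unfolding listed_def by fastforce
    have empty: "{N \<in> ?live s1. cls N = H} = {}" using dead by (fastforce simp: live_def)
    have "arr s1 adeg H = card {N \<in> ?live s1. cls N = H}" using core1 H(2) by (simp add: core_def)
    then have "arr s1 adeg H = 0" by (simp only: empty card.empty)
    then have "queued B1 s1 H" by (simp add: queued_def)
    with core1 have core2: "core y n m cls rep (?live s1) {} B1 L1 s1" by (rule core_exempt)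
    have "arr s1 aown t = taken n cls H (arr s aown) t" for t
    proof (cases "t < n \<and> arr s aown t = 0 \<and> cls (H div n * n + t) = H")
      case True
      then show ?thesis using dead[of "H div n * n + t"] item[of t] own1[of t] by auto
    next
      case False
      then show ?thesis using own1[of t] by (auto simp: taken_def)
    qed
    then have "arr s1 aown = taken n cls H (arr s aown)" by auto
    then show "\<exists>b'. cost (Const 0) + cost (Arr ahead (Reg rH)) + 1 + b' \<le> b1 \<and>
      (\<exists>B' L'. core y n m cls rep (?live s1) {} B' L' s1 \<and>
        listed n m cls L' (arr s1 aown) \<and> potential m (?live s1) B' L' s1 \<le> b') \<and> ?ag s s1 \<and>
        arr s1 aown = taken n cls H (arr s aown)"
      using core2 listed1 ag1 b1 by (intro exI[of _ "potential m (?live s1) B1 L1 s1"]) auto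
  qed
qed

text \<open>A selected group has degree \<open>rp\<close>, and no positive degree is below
  \<open>rp\<close>; so every selection satisfies the minimality premise of \<open>step\<close>.
  That premise also admits an \<open>H\<close> without live items.\<close>

lemma budget_main_loop:
  fixes \<Psi> :: "(nat \<Rightarrow> nat) \<Rightarrow> nat \<Rightarrow> bool"
  assumes core: "core y n m cls rep (live n m rep (arr s aown)) {} B L s"
    and listed: "listed n m cls L (arr s aown)" and m: "n dvd m"
    and cls: "\<And>N. N < m \<Longrightarrow> cls N < m" "\<And>N. N < m \<Longrightarrow> cls N div n = N div n" and y: "y > k + 20"
    and b: "potential m (live n m rep (arr s aown)) B L s + 50 \<le> b"
    and \<Psi>: "\<Psi> (arr s aown) (reg s rv)"
    and step: "\<And>own v H. \<Psi> own v \<Longrightarrow> H < m \<Longrightarrow>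
      (\<And>G. G < m \<Longrightarrow> {N \<in> live n m rep own. cls N = G} \<noteq> {} \<Longrightarrow>
        card {N \<in> live n m rep own. cls N = H} \<le> card {N \<in> live n m rep own. cls N = G}) \<Longrightarrow>
      \<Psi> (taken n cls H own) (max v (card {N \<in> live n m rep own. cls N = H}))"
  shows "budget (main_loop y) s b (\<lambda>s' _. \<Psi> (arr s' aown) (reg s' rv) \<and> live n m rep (arr s' aown) = {} \<and>
    agree {rt, rG, rN, rp, rv, rd, re, rH} {ahead, adeg, abucket, abnext, abgroup, aown} s s')"
proof -
  let ?live = "\<lambda>s. live n m rep (arr s aown)"
  let ?ag = "agree {rt, rG, rN, rp, rv, rd, re, rH} {ahead, adeg, abucket, abnext, abgroup, aown}"
  define I where "I s' b' \<longleftrightarrow> (\<exists>B L. core y n m cls rep (?live s') {} B L s' \<and>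
      listed n m cls L (arr s' aown) \<and> potential m (?live s') B L s' + 10 \<le> b') \<and> ?ag s s' \<and>
      \<Psi> (arr s' aown) (reg s' rv)" for s' b'
  have I_intro: "I s' b'" if "core y n m cls rep (?live s') {} B' L' s'"
      "listed n m cls L' (arr s' aown)" "potential m (?live s') B' L' s' + 10 \<le> b'" "?ag s s'"
      "\<Psi> (arr s' aown) (reg s' rv)" for s' b' B' L'
    using that unfolding I_def by blast
  have init: "I s b" using core listed b \<Psi> by (intro I_intro) auto
  let ?pop = "seqs
         [Assign rd (Minus (Arr abucket (Reg rp)) (Const 1)),
          Store abucket (Reg rp) (Arr abnext (Reg rd)),
          Assign rH (Arr abgroup (Reg rd))]"
  let ?setv = "IfLess (Reg rv) (Reg rp) (Assign rv (Reg rp)) Skip"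
  let ?pick = "IfLess (Arr adeg (Reg rH)) (Reg rp) Skip
          (IfLess (Reg rp) (Arr adeg (Reg rH)) Skip (Seq ?setv (take_group y)))"
  show ?thesis
    unfolding main_loop_def
  proof (rule budget_while[where I = I, OF init])
    fix s1 b1 assume I: "I s1 b1" and less: "val (Reg rp) s1 < val (Plus (Reg rm) (Const 1)) s1"
    from I obtain B1 L1 where core1: "core y n m cls rep (?live s1) {} B1 L1 s1"
      and listed1: "listed n m cls L1 (arr s1 aown)"
      and b1: "potential m (?live s1) B1 L1 s1 + 10 \<le> b1" and ag1: "?ag s s1"
      and \<Psi>1: "\<Psi> (arr s1 aown) (reg s1 rv)"
      by (auto simp: I_def)
    have p: "reg s1 rp \<le> m" using less core1 by (simp add: core_def)
    have link: "linked (arr s1 abnext) (arr s1 abucket (reg s1 rp)) (B1 (reg s1 rp))"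
      using core1 by (simp add: core_def bucket_lists_def)
    have queued1: "queued B1 s1 G" if "G < m" for G using core1 that by (simp add: core_def)
    have deg1: "arr s1 adeg G = card {N \<in> ?live s1. cls N = G}" if "G < m" for G
      using core1 that by (simp add: core_def)
    have "budget (inc rp) s1 (b1 - 10) I" if "arr s1 abucket (reg s1 rp) < 1"
    proof -
      have empty: "B1 (reg s1 rp) = []" using link that by simp
      let ?s = "run (inc rp) s1"
      \<comment> \<open>No positive degree equals \<open>rp\<close>, as its bucket is empty; so all
        of them exceed \<open>rp\<close> and the position may advance.\<close>
      have "queued B1 ?s G" if "G < m" for G
        using queued1[OF that] empty by (auto simp: queued_def less_eq_Suc_le[symmetric] order.order_iff_strict)
      then have "core y n m cls rep (?live ?s) {} B1 L1 ?s"
        using core1 p by (auto simp: core_def group_lists_def bucket_lists_def)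
      then have "I ?s (potential m (?live s1) B1 L1 ?s + 10)"
        by (rule I_intro) (use listed1 ag1 \<Psi>1 in \<open>auto simp: agree_def\<close>)
      moreover have "potential m (?live s1) B1 L1 ?s + 100 = potential m (?live s1) B1 L1 s1"
        using p by (simp add: potential_def Suc_diff_le)
      ultimately show ?thesis
        using b1 by (intro budget_loopfree[where b' = "potential m (?live s1) B1 L1 ?s + 10"]) (auto simp: inc_def)
    qed
    moreover have "budget (Seq ?pop ?pick) s1 (b1 - 10) I" if "\<not> arr s1 abucket (reg s1 rp) < 1"
    proof -
      let ?p = "reg s1 rp"
      let ?e = "arr s1 abucket ?p - 1"
      have ne: "arr s1 abucket ?p \<noteq> 0" using that by simp
      obtain es where es: "B1 ?p = ?e # es" "linked (arr s1 abnext) (arr s1 abnext ?e) es"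
        using linked_pos[OF link ne] .
      define H where "H = arr s1 abgroup ?e"
      have lists1: "bucket_lists m B1 s1" and e: "?e \<in> set (B1 ?p)"
        using core1 es(1) by (auto simp: core_def)
      then have H: "H < m" unfolding bucket_lists_def H_def by blast
      define s2 where "s2 = run ?pop s1"
      let ?B = "B1(?p := es)"
      have s2_eq: "reg s2 = (reg s1)(rd := ?e, rH := H)"
        "arr s2 = (arr s1)(abucket := (arr s1 abucket)(?p := arr s1 abnext ?e))"
        by (auto simp: s2_def H_def)
      have "queued ?B s2 G" if "G < m" "G \<noteq> H" for G
        using queued1[OF that(1)] that(2) es(1) by (auto simp: queued_def s2_eq H_def)
      moreover have "bucket_lists m ?B s2"
        unfolding bucket_lists_def
      proof
        fix l
        show "linked (arr s2 abnext) (arr s2 abucket l) (?B l) \<and>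
          (\<forall>e\<in>set (?B l). e < reg s2 re \<and> arr s2 abgroup e < m)"
          using lists1[unfolded bucket_lists_def, THEN spec, of l] es
          by (cases "l = ?p") (auto simp: s2_eq)
      qed
      ultimately have core2: "core y n m cls rep (?live s1) {H} ?B L1 s2"
        using core1 y by (auto simp: core_def group_lists_def s2_eq)
      have pot2: "potential m (?live s1) ?B L1 s2 + 100 = potential m (?live s1) B1 L1 s1"
        using sum_length_tl[of "{..m}" ?p B1 ?e es] p es(1) by (simp add: potential_def s2_eq)
      have ag2: "?ag s s2" using ag1 by (auto simp: agree_def s2_eq)
      let ?q = "potential m (?live s1) ?B L1 s2"
      have H2: "reg s2 rH = H" "reg s2 rp = ?p" "arr s2 adeg = arr s1 adeg" "reg s2 rv = reg s1 rv"
        "arr s2 aown = arr s1 aown"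
        by (simp_all add: s2_eq)
      \<comment> \<open>If the degree of \<open>H\<close> differs from the position, its valid entry
        is in another bucket and survives the pop.\<close>
      have stale: "budget Skip s2 (?q + 20) I" if "arr s1 adeg H \<noteq> ?p"
      proof (rule budget_loopfree[where b' = "?q + 10"])
        have "queued ?B s2 H" using queued1[OF H] that by (auto simp: queued_def s2_eq)
        with core2 have "core y n m cls rep (?live s1) {} ?B L1 s2" by (rule core_exempt)
        then show "I (run Skip s2) (?q + 10)"
          using I_intro[of s2 ?B L1 "?q + 10"] listed1 ag2 \<Psi>1 by (simp add: H2)
      qed auto
      have take: "budget (Seq ?setv (take_group y)) s2 (?q + 40) I" if deg: "arr s1 adeg H = ?p"
      proof -
        define s3 where "s3 = run ?setv s2"
        have s3_eq: "reg s3 = (reg s2)(rv := max (reg s1 rv) ?p)" "arr s3 = arr s2"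
          by (auto simp: s3_def H2 fun_eq_iff)
        have core3: "core y n m cls rep (live n m rep (arr s3 aown)) {H} ?B L1 s3"
          unfolding s3_eq(2) H2(5) by (rule core_cong[OF core2]) (simp_all add: s3_eq)
        have "potential m (live n m rep (arr s3 aown)) ?B L1 s3 = ?q"
          by (simp add: potential_def s3_eq H2)
        then have "budget (take_group y) s3 (?q + 10) (\<lambda>s' b'.
          (\<exists>B' L'. core y n m cls rep (live n m rep (arr s' aown)) {} B' L' s' \<and>
            listed n m cls L' (arr s' aown) \<and> potential m (live n m rep (arr s' aown)) B' L' s' \<le> b') \<and>
          agree {rt, rG, rN, rd, re, rp} {ahead, adeg, abucket, abnext, abgroup, aown} s3 s' \<and>
          arr s' aown = taken n cls H (arr s3 aown))"
          using listed1 H by (intro budget_take_group[OF core3 _ _ _ m cls y]) (auto simp: s3_eq H2)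
        from budget_slack[OF this, of 10] have "budget (take_group y) s3 (?q + 20) I"
        proof (rule budget_mono, goal_cases)
          case (2 s4 b4)
          then obtain b5 B4 L4 where 4: "core y n m cls rep (?live s4) {} B4 L4 s4"
            "listed n m cls L4 (arr s4 aown)" "potential m (?live s4) B4 L4 s4 \<le> b5"
            "agree {rt, rG, rN, rd, re, rp} {ahead, adeg, abucket, abnext, abgroup, aown} s3 s4"
            "arr s4 aown = taken n cls H (arr s3 aown)" and b5: "b4 = b5 + 10"
            by blast
          have "\<Psi> (taken n cls H (arr s1 aown)) (max (reg s1 rv) (card {N \<in> ?live s1. cls N = H}))"
          proof (rule step[OF \<Psi>1 H])
            fix G assume G: "G < m" "{N \<in> ?live s1. cls N = G} \<noteq> {}"
            have "finite (?live s1)" by (simp add: live_def)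
            then have "0 < arr s1 adeg G" using G deg1 by (simp add: card_gt_0_iff)
            then show "card {N \<in> ?live s1. cls N = H} \<le> card {N \<in> ?live s1. cls N = G}"
              using queued1[OF G(1)] deg deg1 G(1) H by (simp add: queued_def)
          qed
          moreover have "reg s4 rv = max (reg s1 rv) (card {N \<in> ?live s1. cls N = H})"
            using 4(4) deg deg1[OF H] by (simp add: agree_def s3_eq)
          ultimately have \<Psi>4: "\<Psi> (arr s4 aown) (reg s4 rv)" using 4(5) by (simp add: s3_eq H2)
          have "?ag s s4" using ag2 4(4) by (auto simp: agree_def s3_eq)
          then show ?case using 4(3) b5 \<Psi>4 by (intro I_intro[OF 4(1,2)]) simp_all
        qed auto
        then show ?thesis unfolding s3_def by (rule budget_Seq_loopfree) simp_all
      qed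
      have inner: "budget (IfLess (Reg rp) (Arr adeg (Reg rH)) Skip (Seq ?setv (take_group y))) s2 (?q + 50) I"
        if "\<not> arr s1 adeg H < ?p"
      proof (rule budget_If[where b' = "?q + 40"], goal_cases)
        case 2
        then show ?case using budget_mono[OF stale, of "?q + 40" I] by (simp add: H2)
      next
        case 3
        then show ?case using take that by (simp add: H2)
      qed simp
      have "budget ?pick s2 (?q + 60) I"
      proof (rule budget_If[where b' = "?q + 50"], goal_cases)
        case 2
        then show ?case using budget_mono[OF stale, of "?q + 50" I] by (simp add: H2)
      next
        case 3
        then show ?case using inner by (simp add: H2)
      qed simp
      from this[unfolded s2_def] have "budget (Seq ?pop ?pick) s1 (?q + 90) I"
        by (rule budget_Seq_loopfree[folded s2_def]) (simp_all add: s2_def)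
      then show ?thesis using b1 pot2 by (elim budget_mono) auto
    qed
    ultimately have "budget (IfLess (Arr abucket (Reg rp)) (Const 1) (inc rp) (Seq ?pop ?pick)) s1 (b1 - 5) I"
      using b1 by (intro budget_If[where b' = "b1 - 10"]) auto
    then show "\<exists>b'. cost (Reg rp) + cost (Plus (Reg rm) (Const 1)) + 1 + b' \<le> b1 \<and>
        budget (IfLess (Arr abucket (Reg rp)) (Const 1) (inc rp) (Seq ?pop ?pick)) s1 b' I"
      using b1 by (intro exI[of _ "b1 - 5"]) auto
  next
    fix s1 b1 assume I: "I s1 b1" and less: "\<not> val (Reg rp) s1 < val (Plus (Reg rm) (Const 1)) s1"
    from I obtain B1 L1 where core1: "core y n m cls rep (?live s1) {} B1 L1 s1"
      and b1: "potential m (?live s1) B1 L1 s1 + 10 \<le> b1" and ag1: "?ag s s1"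
      and \<Psi>1: "\<Psi> (arr s1 aown) (reg s1 rv)"
      by (auto simp: I_def)
    have sub: "?live s1 \<subseteq> {..<m}" by (auto simp: live_def)
    \<comment> \<open>A live item would give its group a degree that is at least \<open>rp\<close>,
      hence above \<open>m\<close>, but there are only \<open>m\<close> items.\<close>
    have "?live s1 = {}"
    proof (rule ccontr)
      assume "?live s1 \<noteq> {}"
      then obtain N where N: "N \<in> ?live s1" by blast
      let ?A = "{N' \<in> ?live s1. cls N' = cls N}"
      have G: "cls N < m" using N sub cls(1) by blast
      have "finite ?A" using sub by (auto intro: finite_subset)
      then have "0 < card ?A" using N by (auto simp: card_gt_0_iff)
      moreover have "arr s1 adeg (cls N) = card ?A" "queued B1 s1 (cls N)"
        using core1 G by (simp_all add: core_def)
      ultimately have "reg s1 rp \<le> card ?A" by (simp add: queued_def)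
      also have "\<dots> \<le> card {..<m}" using sub by (intro card_mono) auto
      finally show False using less core1 by (simp add: core_def)
    qed
    then show "\<exists>b'. cost (Reg rp) + cost (Plus (Reg rm) (Const 1)) + 1 + b' \<le> b1 \<and>
      \<Psi> (arr s1 aown) (reg s1 rv) \<and> ?live s1 = {} \<and> ?ag s s1"
      using \<Psi>1 ag1 b1 by (intro exI[of _ 0]) auto
  qed
qed

end

section \<open>Items and steps of the algorithm\<close>

text \<open>Interface between numbers and relation: \<open>cls\<close> names groups inside the block
  of \<open>n\<close> items of their set, and \<open>rep\<close> picks exactly one tuple from each
  class of equal projections to \<open>Y\<close>.\<close>

locale adec_items =
  fixes \<X> :: "'a set set" and Y :: "'a set" and ts :: "('a \<Rightarrow> 'v) list" and Xs :: "'a set list"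
    and n m :: nat and cls :: "nat \<Rightarrow> nat" and rep :: "nat \<Rightarrow> bool"
  assumes sub: "\<X> \<subseteq> Pow Y" and Xs: "distinct Xs" "set Xs = \<X>"
    and ts: "distinct ts" "length ts = n" and m: "m = length Xs * n"
    and cls_less: "\<And>N. N < m \<Longrightarrow> cls N < m"
    and cls_div: "\<And>N. N < m \<Longrightarrow> cls N div n = N div n"
    and cls_eq: "\<And>j t u. j < length Xs \<Longrightarrow> t < n \<Longrightarrow> u < n \<Longrightarrow> cls (j * n + t) = cls (j * n + u) \<longleftrightarrow>
      restrict (ts ! t) (Xs ! j) = restrict (ts ! u) (Xs ! j)"
    and rep_ex: "\<And>t. t < n \<Longrightarrow> \<exists>u<n. rep u \<and> restrict (ts ! u) Y = restrict (ts ! t) Y"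
    and rep_unique: "\<And>t u. t < n \<Longrightarrow> u < n \<Longrightarrow> rep t \<Longrightarrow> rep u \<Longrightarrow>
      restrict (ts ! t) Y = restrict (ts ! u) Y \<Longrightarrow> t = u"
begin

definition rest :: "(nat \<Rightarrow> nat) \<Rightarrow> ('a \<Rightarrow> 'v) set" where
  "rest own = {ts ! t |t. t < n \<and> own t = 0}"

definition parts :: "(nat \<Rightarrow> nat) \<Rightarrow> 'a set \<Rightarrow> ('a \<Rightarrow> 'v) set" where
  "parts own X = {ts ! t |t. t < n \<and> (\<exists>j<length Xs. own t = Suc j \<and> Xs ! j = X)}"

text \<open>By the first clause, tuples with equal projections to \<open>Y\<close> remain or have
  left together. Without it, the representative of a remaining tuple could be gone and the degree be
  undercounted.\<close>

definition reached :: "(nat \<Rightarrow> nat) \<Rightarrow> nat \<Rightarrow> bool" where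
  "reached own v \<longleftrightarrow>
     (\<forall>t<n. \<forall>u<n. restrict (ts ! t) Y = restrict (ts ! u) Y \<longrightarrow> (own t = 0 \<longleftrightarrow> own u = 0)) \<and>
     (adec_step \<X> Y)\<^sup>*\<^sup>* (set ts, \<lambda>_. {}) (rest own, parts own) \<and> v = max_DC \<X> (parts own) Y"

lemma nth_inj: "t < n \<Longrightarrow> u < n \<Longrightarrow> ts ! t = ts ! u \<longleftrightarrow> t = u"
  using ts nth_eq_iff_index_eq by blast

lemma rest_iff: "t < n \<Longrightarrow> ts ! t \<in> rest own \<longleftrightarrow> own t = 0"
  unfolding rest_def by (auto simp: nth_inj)

lemma parts_iff:
  "t < n \<Longrightarrow> ts ! t \<in> parts own X \<longleftrightarrow> (\<exists>j<length Xs. own t = Suc j \<and> Xs ! j = X)"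
  unfolding parts_def by (auto simp: nth_inj)

lemma set_eqI_nth:
  assumes "A \<subseteq> set ts" "B \<subseteq> set ts" "\<And>t. t < n \<Longrightarrow> ts ! t \<in> A \<longleftrightarrow> ts ! t \<in> B"
  shows "A = B"
proof -
  have "x \<in> A \<longleftrightarrow> x \<in> B" if "x \<in> set ts" for x
    using that assms(3) ts by (auto simp: in_set_conv_nth)
  then show ?thesis using assms(1,2) by blast
qed

lemma rest_subset: "rest own \<subseteq> set ts" and parts_subset: "parts own X \<subseteq> set ts"
  using ts by (auto simp: rest_def parts_def)

lemma item_less: "j < length Xs \<Longrightarrow> t < n \<Longrightarrow> j * n + t < m"
proof -
  assume "j < length Xs" "t < n"
  then have "Suc j * n \<le> m" unfolding m by (intro mult_le_mono1) simp
  then show ?thesis using \<open>t < n\<close> by simp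
qed

lemma item_cases:
  assumes "N < m"
  obtains j t where "j < length Xs" "t < n" "N = j * n + t" "N div n = j" "N mod n = t"
proof -
  have "0 < n" using assms m by (cases n) auto
  then show ?thesis
    using that[of "N div n" "N mod n"] assms m by (simp add: less_mult_imp_div_less)
qed

lemma Xs_sub: "j < length Xs \<Longrightarrow> Xs ! j \<in> \<X> \<and> Xs ! j \<subseteq> Y"
  using Xs sub nth_mem by blast

lemma restrict_Xs:
  "j < length Xs \<Longrightarrow> restrict t Y = restrict u Y \<Longrightarrow> restrict t (Xs ! j) = restrict u (Xs ! j)"
  using Xs_sub restrict_eq_subset by blast

lemma reached_steps:
  assumes "reached own v"
  shows "(adec_step \<X> Y)\<^sup>*\<^sup>* (set ts, \<lambda>_. {}) (rest own, parts own)" "v = max_DC \<X> (parts own) Y"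
  using assms unfolding reached_def by blast+

lemma reached_closed:
  "reached own v \<Longrightarrow> t < n \<Longrightarrow> u < n \<Longrightarrow> restrict (ts ! t) Y = restrict (ts ! u) Y \<Longrightarrow>
    own t = 0 \<longleftrightarrow> own u = 0"
  unfolding reached_def by blast

lemma rest_rep:
  assumes "reached own v" "t < n" "own t = 0"
  obtains u where "u < n" "own u = 0" "rep u" "restrict (ts ! u) Y = restrict (ts ! t) Y"
proof -
  obtain u where u: "u < n" "rep u" "restrict (ts ! u) Y = restrict (ts ! t) Y"
    using rep_ex[OF assms(2)] by blast
  have "own u = 0 \<longleftrightarrow> own t = 0" using reached_closed[OF assms(1) u(1) assms(2) u(3)] .
  then show ?thesis using that u assms(3) by blast
qed

text \<open>Mapping an item to the projection of its tuple is a bijection: distinct representatives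
  differ on \<open>Y\<close>, and the representative of a remaining tuple also remains and lies in
  the same group, since \<open>Xs ! j\<close> is inside \<open>Y\<close>.\<close>

lemma card_group:
  assumes reached: "reached own v" and j: "j < length Xs" and t: "t < n"
  shows "card {N \<in> live n m rep own. cls N = cls (j * n + t)} =
    card (proj Y (sel (Xs ! j) (restrict (ts ! t) (Xs ! j)) (rest own)))"
proof -
  let ?A = "{N \<in> live n m rep own. cls N = cls (j * n + t)}"
  let ?f = "\<lambda>N. restrict (ts ! (N mod n)) Y"
  have A: "\<exists>u<n. N = j * n + u \<and> N mod n = u \<and> own u = 0 \<and> rep u \<and>
      restrict (ts ! u) (Xs ! j) = restrict (ts ! t) (Xs ! j)" if N: "N \<in> ?A" for N
  proof -
    have "N < m" using N by (simp add: live_def)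
    then obtain i u where i: "i < length Xs" "u < n" "N = i * n + u" "N div n = i" "N mod n = u"
      by (rule item_cases)
    have "(j * n + t) div n = j" using t by simp
    then have "i = j"
      using N cls_div[OF \<open>N < m\<close>] cls_div[OF item_less[OF j t]] i by simp
    then show ?thesis
      using N i cls_eq[OF j i(2) t] by (auto simp: live_def)
  qed
  have inj: "inj_on ?f ?A"
  proof (rule inj_onI)
    fix N N' assume N: "N \<in> ?A" "N' \<in> ?A" "?f N = ?f N'"
    obtain u u' where "u < n" "N = j * n + u" "N mod n = u" "rep u"
      "u' < n" "N' = j * n + u'" "N' mod n = u'" "rep u'" using A[OF N(1)] A[OF N(2)] by blast
    then show "N = N'" using rep_unique[of u u'] N(3) by simp
  qed
  have "?f ` ?A = proj Y (sel (Xs ! j) (restrict (ts ! t) (Xs ! j)) (rest own))"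
  proof (intro equalityI subsetI)
    fix z assume "z \<in> ?f ` ?A"
    then obtain N where "N \<in> ?A" "z = ?f N" by blast
    with A show "z \<in> proj Y (sel (Xs ! j) (restrict (ts ! t) (Xs ! j)) (rest own))"
      unfolding proj_def sel_def rest_def by blast
  next
    fix z assume "z \<in> proj Y (sel (Xs ! j) (restrict (ts ! t) (Xs ! j)) (rest own))"
    then obtain u where u: "u < n" "own u = 0" "z = restrict (ts ! u) Y"
      "restrict (ts ! u) (Xs ! j) = restrict (ts ! t) (Xs ! j)"
      by (auto simp: proj_def sel_def rest_def)
    obtain u' where u': "u' < n" "own u' = 0" "rep u'" "restrict (ts ! u') Y = restrict (ts ! u) Y"
      using rest_rep[OF reached u(1,2)] .
    have "restrict (ts ! u') (Xs ! j) = restrict (ts ! t) (Xs ! j)"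
      using restrict_Xs[OF j u'(4)] u(4) by simp
    then have "j * n + u' \<in> ?A"
      using u' cls_eq[OF j u'(1) t] item_less[OF j u'(1)] by (simp add: live_def)
    moreover have "z = ?f (j * n + u')" using u' u by simp
    ultimately show "z \<in> ?f ` ?A" by (rule rev_image_eqI)
  qed
  then show ?thesis using card_image[OF inj] by simp
qed

lemma taken_eq:
  assumes "j < length Xs" "t0 < n" "H = cls (j * n + t0)" "t < n"
  shows "taken n cls H own t = (if own t = 0 \<and> restrict (ts ! t) (Xs ! j) = restrict (ts ! t0) (Xs ! j)
    then Suc j else own t)"
proof -
  have "H div n = j" using cls_div[OF item_less[OF assms(1,2)]] assms by simp
  then show ?thesis using assms cls_eq[OF assms(1,4,2)] by (simp add: taken_def)
qed

text \<open>By \<open>card_group\<close> the degrees compared by the queue are the cardinalities in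
  \<open>adec_step\<close>, and \<open>taken\<close> moves exactly the tuples of the selected group;
  so a selection simulates a step.\<close>

lemma reached_taken:
  assumes reached: "reached own v" and H: "H < m"
    and min: "\<And>G. G < m \<Longrightarrow> {N \<in> live n m rep own. cls N = G} \<noteq> {} \<Longrightarrow>
      card {N \<in> live n m rep own. cls N = H} \<le> card {N \<in> live n m rep own. cls N = G}"
  shows "reached (taken n cls H own) (max v (card {N \<in> live n m rep own. cls N = H}))"
proof (cases "\<exists>t<n. own t = 0 \<and> cls (H div n * n + t) = H")
  \<comment> \<open>The selected number denotes no group or an exhausted one. Its degree is 0 and
    the state stays as it is.\<close>
  case False
  have "{N \<in> live n m rep own. cls N = H} = {}"
  proof (rule ccontr)
    assume "{N \<in> live n m rep own. cls N = H} \<noteq> {}"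
    then obtain N where N: "N \<in> live n m rep own" "cls N = H" by blast
    then have "N < m" by (simp add: live_def)
    then obtain j t where "t < n" "N = j * n + t" "N div n = j" "N mod n = t"
      by (rule item_cases)
    then show False using N False cls_div[OF \<open>N < m\<close>] by (auto simp: live_def)
  qed
  then have "card {N \<in> live n m rep own. cls N = H} = 0" by (simp only: card.empty)
  moreover have "taken n cls H own = own" using False by (auto simp: taken_def)
  ultimately show ?thesis using reached by simp
next
  case True
  define j where "j = H div n"
  have j: "j < length Xs" using H m by (simp add: j_def less_mult_imp_div_less)
  obtain t0 where t0: "t0 < n" "own t0 = 0" "H = cls (j * n + t0)"
    using True by (auto simp: j_def)
  let ?X = "Xs ! j" and ?x = "restrict (ts ! t0) (Xs ! j)" and ?own = "taken n cls H own"
  let ?S = "sel ?X ?x (rest own)"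
  have own': "?own t = (if own t = 0 \<and> restrict (ts ! t) ?X = ?x then Suc j else own t)" if "t < n" for t
    using taken_eq[OF j t0(1,3) that] .
  have card_H: "card {N \<in> live n m rep own. cls N = H} = card (proj Y ?S)"
    unfolding t0(3) using card_group[OF reached j t0(1)] .
  have x: "?x \<in> proj ?X (rest own)" using t0 by (auto simp: proj_def rest_def)
  note steps = reached_steps(1)[OF reached] and v = reached_steps(2)[OF reached]
  have fin: "finite \<X>" using Xs by auto
  have "adec_step \<X> Y (rest own, parts own) (rest own - ?S, (parts own)(?X := parts own ?X \<union> ?S))"
  proof (rule adec_step.intros)
    show "?X \<in> \<X>" "?x \<in> proj ?X (rest own)" using Xs_sub[OF j] x by auto
    fix X' x' assume "X' \<in> \<X>" "x' \<in> proj X' (rest own)"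
    then obtain i t where i: "i < length Xs" "X' = Xs ! i" and t: "t < n" "own t = 0" "x' = restrict (ts ! t) X'"
      using Xs by (auto simp: proj_def rest_def in_set_conv_nth)
    \<comment> \<open>The representative shows that the competing group has a live item, so
      minimality applies to it.\<close>
    obtain u where u: "u < n" "own u = 0" "rep u" "restrict (ts ! u) Y = restrict (ts ! t) Y"
      using rest_rep[OF reached t(1,2)] .
    have "i * n + u \<in> {N \<in> live n m rep own. cls N = cls (i * n + t)}"
      using u item_less[OF i(1) u(1)] cls_eq[OF i(1) u(1) t(1)] restrict_Xs[OF i(1) u(4)]
      by (simp add: live_def)
    then have "card {N \<in> live n m rep own. cls N = H} \<le> card {N \<in> live n m rep own. cls N = cls (i * n + t)}"
      using min[OF cls_less[OF item_less[OF i(1) t(1)]]] by blast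
    then show "card (proj Y ?S) \<le> card (proj Y (sel X' x' (rest own)))"
      unfolding card_H card_group[OF reached i(1) t(1)] i(2) t(3) .
  qed
  moreover have S_sub: "?S \<subseteq> set ts" using sel_subset rest_subset by (rule order_trans)
  moreover have "rest ?own = rest own - ?S"
  proof (rule set_eqI_nth)
    fix t assume "t < n"
    then show "ts ! t \<in> rest ?own \<longleftrightarrow> ts ! t \<in> rest own - ?S"
      using own'[of t] by (simp add: rest_iff sel_def)
  qed (use rest_subset in auto)
  moreover have parts': "parts ?own = (parts own)(?X := parts own ?X \<union> ?S)"
  proof (rule ext, rule set_eqI_nth)
    fix X t assume "t < n"
    then show "ts ! t \<in> parts ?own X \<longleftrightarrow> ts ! t \<in> ((parts own)(?X := parts own ?X \<union> ?S)) X"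
      using own'[of t] j by (auto simp: rest_iff parts_iff sel_def)
  qed (use parts_subset S_sub in auto)
  ultimately have "(adec_step \<X> Y)\<^sup>*\<^sup>* (set ts, \<lambda>_. {}) (rest ?own, parts ?own)"
    using steps by (simp add: rtranclp.rtrancl_into_rtrancl)
  moreover have "max v (card {N \<in> live n m rep own. cls N = H}) = max_DC \<X> (parts ?own) Y"
    unfolding card_H v parts'
    using max_DC_step[OF fin _ sub adec_inv_steps[OF fin _ sub steps] _ x] Xs_sub[OF j] by simp
  moreover have "?own t = 0 \<longleftrightarrow> ?own u = 0" if "t < n" "u < n" "restrict (ts ! t) Y = restrict (ts ! u) Y" for t u
  proof -
    have "own t = 0 \<longleftrightarrow> own u = 0" using reached_closed[OF reached that] .
    then show ?thesis using own'[OF that(1)] own'[OF that(2)] restrict_Xs[OF j that(3)] by simp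
  qed
  ultimately show ?thesis unfolding reached_def by blast
qed

lemma reached_init:
  assumes "\<X> \<noteq> {}"
  shows "reached (\<lambda>_. 0) 0"
proof -
  have "rest (\<lambda>_. 0) = set ts" using ts by (auto simp: rest_def set_conv_nth)
  moreover have "parts (\<lambda>_. 0) = (\<lambda>_. {})" by (auto simp: parts_def)
  moreover have "max_DC \<X> (\<lambda>_. {}) Y = 0"
    using assms by (simp add: max_DC_def image_constant_conv)
  ultimately show ?thesis by (simp add: reached_def)
qed

lemma reached_result:
  assumes "reached own v" "live n m rep own = {}" "\<X> \<noteq> {}"
  shows "adec_result \<X> Y (set ts) (parts own) v"
proof -
  have "rest own = {}"
  proof (rule ccontr)
    assume "rest own \<noteq> {}"
    then obtain t where t: "t < n" "own t = 0" by (auto simp: rest_def)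
    obtain u where u: "u < n" "own u = 0" "rep u" using rest_rep[OF assms(1) t] by blast
    \<comment> \<open>A remaining representative yields a live item only if there is some set; the
      item for set number 0 is used.\<close>
    have "0 < length Xs" using assms(3) Xs by auto
    then have "0 * n + u \<in> live n m rep own" using u item_less[of 0 u] by (simp add: live_def)
    then show False using assms(2) by simp
  qed
  then show ?thesis using reached_steps[OF assms(1)] by (simp add: adec_result_def)
qed

end

section \<open>Output\<close>

context layout
begin

primrec copy_row :: "nat \<Rightarrow> nat \<Rightarrow> com" where
  "copy_row j 0 = Skip"
| "copy_row j (Suc c) = Seq (copy_row j c)
    (Store (Suc j) (Plus (times w (Reg (Suc j))) (Const c)) (Arr 0 (Plus (times w (Reg rt)) (Const c))))"

lemma copy_row:
  "loopfree (copy_row j c)"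
  "run (copy_row j c) s = s\<lparr>arr := (arr s)(Suc j := (\<lambda>i.
     if w * reg s (Suc j) \<le> i \<and> i < w * reg s (Suc j) + c
     then arr s 0 (w * reg s rt + (i - w * reg s (Suc j))) else arr s (Suc j) i))\<rparr>"
proof -
  show "loopfree (copy_row j c)" by (induction c) auto
  show "run (copy_row j c) s = s\<lparr>arr := (arr s)(Suc j := (\<lambda>i.
     if w * reg s (Suc j) \<le> i \<and> i < w * reg s (Suc j) + c
     then arr s 0 (w * reg s rt + (i - w * reg s (Suc j))) else arr s (Suc j) i))\<rparr>"
  proof (induction c)
    case 0
    have "(\<lambda>i. if w * reg s (Suc j) \<le> i \<and> i < w * reg s (Suc j) + 0
       then arr s 0 (w * reg s rt + (i - w * reg s (Suc j))) else arr s (Suc j) i) = arr s (Suc j)"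
      by auto
    then show ?case by (simp del: add_0_right)
  next
    case (Suc c)
    show ?case
      unfolding copy_row.simps run.simps Suc by (auto intro!: state.equality simp: fun_eq_iff)
  qed
qed

text \<open>Each set scans all tuples anew, which costs only the constant factor \<open>k\<close>.
  Register \<open>Suc j\<close>, zero in the input, is both the output count and the write
  position.\<close>

definition output_part :: "nat \<Rightarrow> com" where
  "output_part j = Seq (Assign rt (Const 0)) (WhileLess (Reg rt) (Reg rn)
     (Seq (IfLess (Arr aown (Reg rt)) (Const (Suc j)) Skip
        (IfLess (Const (Suc j)) (Arr aown (Reg rt)) Skip (Seq (copy_row j w) (inc (Suc j)))))
      (inc rt)))"

definition written :: "(nat \<Rightarrow> nat) \<Rightarrow> (nat \<Rightarrow> nat) \<Rightarrow> nat \<Rightarrow> nat \<Rightarrow> state \<Rightarrow> bool" where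
  "written inp own n j s \<longleftrightarrow> (let ix = filter (\<lambda>t. own t = Suc j) [0..<n] in
     reg s (Suc j) = length ix \<and> (\<forall>i<length ix. \<forall>c<w. arr s (Suc j) (w * i + c) = inp (w * (ix ! i) + c)))"

lemma written_Suc:
  assumes "written inp own q j s" "own q = Suc j"
    and "reg s' (Suc j) = Suc (reg s (Suc j))"
    and "arr s' (Suc j) = (\<lambda>i. if w * reg s (Suc j) \<le> i \<and> i < w * reg s (Suc j) + w
       then inp (w * q + (i - w * reg s (Suc j))) else arr s (Suc j) i)"
  shows "written inp own (Suc q) j s'"
proof -
  let ?ix = "filter (\<lambda>t. own t = Suc j) [0..<q]"
  have reg: "reg s (Suc j) = length ?ix"
    and old: "\<And>i c. i < length ?ix \<Longrightarrow> c < w \<Longrightarrow> arr s (Suc j) (w * i + c) = inp (w * (?ix ! i) + c)"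
    using assms(1) by (auto simp: written_def Let_def)
  have ix: "filter (\<lambda>t. own t = Suc j) [0..<Suc q] = ?ix @ [q]" using assms(2) by simp
  have "arr s' (Suc j) (w * i + c) = inp (w * ((?ix @ [q]) ! i) + c)"
    if i: "i < length (?ix @ [q])" and c: "c < w" for i c
  proof (cases "i < length ?ix")
    case True
    then have "w * Suc i \<le> w * length ?ix" by (intro mult_le_mono2) simp
    then have "w * i + c < w * length ?ix" using c by simp
    then show ?thesis using old[OF True c] True by (simp add: assms(4) reg nth_append)
  next
    case False
    then have "i = length ?ix" using i by simp
    then show ?thesis using c by (simp add: assms(4) reg)
  qed
  then show ?thesis unfolding written_def Let_def ix assms(3) reg by simp
qed

lemma runs_output_part:
  "\<exists>C. \<forall>s n. j < k \<longrightarrow> reg s rn = n \<longrightarrow> reg s (Suc j) = 0 \<longrightarrow>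
    runs (output_part j) s (C * (n + 1)) (\<lambda>s'. agree {rt, Suc j} {Suc j} s s' \<and>
      written (arr s 0) (arr s aown) n j s')"
proof -
  let ?body = "Seq (IfLess (Arr aown (Reg rt)) (Const (Suc j)) Skip
        (IfLess (Const (Suc j)) (Arr aown (Reg rt)) Skip (Seq (copy_row j w) (inc (Suc j)))))
      (inc rt)"
  show ?thesis
  proof (intro exI[of _ "2 + (cost (Reg rn) + 2 + bound ?body)"] allI impI)
    fix s :: state and n
    assume j: "j < k" and n: "reg s rn = n" and zero: "reg s (Suc j) = 0"
    define J where "J q s' \<longleftrightarrow> agree {rt, Suc j} {Suc j} s s' \<and> reg s' rt = q \<and>
      written (arr s 0) (arr s aown) q j s'" for q s'
    have J0: "J 0 (run (Assign rt (Const 0)) s)"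
      using j zero by (simp add: J_def agree_def written_def)
    have step: "J (Suc q) (run ?body s')" if "q < n" "J q s'" for q s'
    proof -
      have ag: "agree {rt, Suc j} {Suc j} s s'" and rt: "reg s' rt = q"
        and wr: "written (arr s 0) (arr s aown) q j s'" using that(2) by (auto simp: J_def)
      have own: "arr s' aown = arr s aown" and inp: "arr s' 0 = arr s 0"
        using ag j by (auto simp: agree_def)
      show ?thesis
      proof (cases "arr s aown q = Suc j")
        case True
        have s'': "reg (run ?body s') = (reg s')(Suc j := Suc (reg s' (Suc j)), rt := Suc q)"
          "arr (run ?body s') = (arr s')(Suc j := (\<lambda>i.
             if w * reg s' (Suc j) \<le> i \<and> i < w * reg s' (Suc j) + w
             then arr s 0 (w * q + (i - w * reg s' (Suc j))) else arr s' (Suc j) i))"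
          using j True by (auto simp: copy_row rt own inp fun_eq_iff)
        have "written (arr s 0) (arr s aown) (Suc q) j (run ?body s')"
          by (rule written_Suc[OF wr True]) (use j s'' in auto)
        then show ?thesis using ag j s'' unfolding J_def by (auto simp: agree_def)
      next
        case False
        have s'': "run ?body s' = s'\<lparr>reg := (reg s')(rt := Suc q)\<rparr>"
          using False by (auto simp: rt own not_less_iff_gr_or_eq)
        have "written (arr s 0) (arr s aown) (Suc q) j (run ?body s')"
          using wr False j unfolding s'' by (simp add: written_def)
        then show ?thesis using ag j unfolding J_def s'' by (auto simp: agree_def)
      qed
    qed
    have "runs (WhileLess (Reg rt) (Reg rn) ?body) (run (Assign rt (Const 0)) s)
        ((cost (Reg rn) + 2 + bound ?body) * (n + 1)) (J n)"
      by (rule runs_for[where J=J, OF _ J0 _ step]) (use j n in \<open>auto simp: J_def agree_def copy_row\<close>)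
    then have "runs (output_part j) s (2 + (cost (Reg rn) + 2 + bound ?body) * (n + 1)) (J n)"
      unfolding output_part_def
      by (intro runs_Seq[OF runs_loopfree[where Q="\<lambda>s'. s' = run (Assign rt (Const 0)) s"]]) auto
    then show "runs (output_part j) s ((2 + (cost (Reg rn) + 2 + bound ?body)) * (n + 1))
      (\<lambda>s'. agree {rt, Suc j} {Suc j} s s' \<and> written (arr s 0) (arr s aown) n j s')"
      by (rule runs_mono) (auto simp: J_def)
  qed
qed

primrec outputs :: "nat \<Rightarrow> com" where
  "outputs 0 = Skip"
| "outputs (Suc j) = Seq (outputs j) (output_part j)"

lemma runs_outputs:
  "\<exists>C. \<forall>s n. j \<le> k \<longrightarrow> reg s rn = n \<longrightarrow> (\<forall>i<j. reg s (Suc i) = 0) \<longrightarrow>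
    runs (outputs j) s (C * (n + 1)) (\<lambda>s'. agree ({rt} \<union> {0<..j}) {0<..j} s s' \<and>
      (\<forall>i<j. written (arr s 0) (arr s aown) n i s'))"
proof (induction j)
  case 0
  show ?case by (intro exI[of _ 1] allI impI runs_loopfree) auto
next
  case (Suc j)
  then obtain C1 where C1: "\<And>s n. j \<le> k \<Longrightarrow> reg s rn = n \<Longrightarrow> (\<forall>i<j. reg s (Suc i) = 0) \<Longrightarrow>
    runs (outputs j) s (C1 * (n + 1)) (\<lambda>s'. agree ({rt} \<union> {0<..j}) {0<..j} s s' \<and>
      (\<forall>i<j. written (arr s 0) (arr s aown) n i s'))" by blast
  obtain C2 where C2: "\<And>s n. j < k \<Longrightarrow> reg s rn = n \<Longrightarrow> reg s (Suc j) = 0 \<Longrightarrow>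
    runs (output_part j) s (C2 * (n + 1)) (\<lambda>s'. agree {rt, Suc j} {Suc j} s s' \<and>
      written (arr s 0) (arr s aown) n j s')"
    using runs_output_part[of j] by blast
  show ?case
  proof (intro exI[of _ "C1 + C2"] allI impI)
    fix s :: state and n
    assume j: "Suc j \<le> k" and n: "reg s rn = n" and zero: "\<forall>i<Suc j. reg s (Suc i) = 0"
    have 1: "runs (outputs j) s (C1 * (n + 1)) (\<lambda>s'. agree ({rt} \<union> {0<..j}) {0<..j} s s' \<and>
      (\<forall>i<j. written (arr s 0) (arr s aown) n i s'))"
      using j n zero by (intro C1) auto
    have "runs (outputs (Suc j)) s (C1 * (n + 1) + C2 * (n + 1))
      (\<lambda>s'. agree ({rt} \<union> {0<..Suc j}) {0<..Suc j} s s' \<and>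
        (\<forall>i<Suc j. written (arr s 0) (arr s aown) n i s'))"
      unfolding outputs.simps
    proof (rule runs_Seq[OF 1])
      fix s1
      assume s1: "agree ({rt} \<union> {0<..j}) {0<..j} s s1 \<and> (\<forall>i<j. written (arr s 0) (arr s aown) n i s1)"
      then have "runs (output_part j) s1 (C2 * (n + 1)) (\<lambda>s'. agree {rt, Suc j} {Suc j} s1 s' \<and>
          written (arr s1 0) (arr s1 aown) n j s')"
        using j n zero by (intro C2) (auto simp: agree_def)
      moreover have same: "arr s1 0 = arr s 0" "arr s1 aown = arr s aown"
        using s1 j by (auto simp: agree_def)
      ultimately show "runs (output_part j) s1 (C2 * (n + 1))
        (\<lambda>s'. agree ({rt} \<union> {0<..Suc j}) {0<..Suc j} s s' \<and>
          (\<forall>i<Suc j. written (arr s 0) (arr s aown) n i s'))"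
      proof (elim runs_mono[OF _ order_refl])
        fix s2
        assume s2: "agree {rt, Suc j} {Suc j} s1 s2 \<and> written (arr s1 0) (arr s1 aown) n j s2"
        have "agree ({rt} \<union> {0<..Suc j}) {0<..Suc j} s s2"
          using s1 s2 by (auto simp: agree_def)
        moreover have "written (arr s 0) (arr s aown) n i s2" if "i < Suc j" for i
        proof (cases "i = j")
          case True
          then show ?thesis using s2 same by simp
        next
          case False
          have "reg s2 (Suc i) = reg s1 (Suc i)" "arr s2 (Suc i) = arr s1 (Suc i)"
            using s2 False j that by (auto simp: agree_def)
          moreover have "written (arr s 0) (arr s aown) n i s1" using s1 False that by simp
          ultimately show ?thesis by (simp add: written_def)
        qed
        ultimately show "agree ({rt} \<union> {0<..Suc j}) {0<..Suc j} s s2 \<and>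
          (\<forall>i<Suc j. written (arr s 0) (arr s aown) n i s2)" by blast
      qed
    qed
    then show "runs (outputs (Suc j)) s ((C1 + C2) * (n + 1))
      (\<lambda>s'. agree ({rt} \<union> {0<..Suc j}) {0<..Suc j} s s' \<and>
        (\<forall>i<Suc j. written (arr s 0) (arr s aown) n i s'))"
      by (simp add: algebra_simps)
  qed
qed

end

section \<open>The program\<close>

context layout
begin

text \<open>The list \<open>yc\<close> holds the columns in \<open>Y\<close>, the lists in \<open>css\<close> those in the sets of the family.\<close>

definition index_program :: "nat list \<Rightarrow> nat list list \<Rightarrow> com" where
  "index_program yc css = Seq (Seq (Assign rn (Reg 0)) (Assign rm (times k (Reg 0))))
     (Seq multiples (Seq (chain (k + 21) yc) (items (k + 22 + 4 * length yc) 0 css)))"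

lemma runs_index_program:
  "\<exists>C. \<forall>s n. reg s = (\<lambda>_. 0)(0 := n) \<longrightarrow> (\<forall>a>0. arr s a = (\<lambda>_. 0)) \<longrightarrow>
    runs (index_program yc css) s (C * (n + 1)) (\<lambda>s'.
      agree {rn, rm, rt, ri} ({amul, acls, atup, aset} \<union> {k + 21..}) s s' \<and>
      reg s' rn = n \<and> reg s' rm = k * n \<and>
      (\<forall>t<n. arr s' (k + 21 + 4 * length yc) t = first (\<lambda>t. map (\<lambda>c. arr s 0 (w * t + c)) yc) t) \<and>
      (\<forall>i<length css. \<forall>t<n.
        arr s' acls (i * n + t) = i * n + first (\<lambda>t. map (\<lambda>c. arr s 0 (w * t + c)) (css ! i)) t \<and>
        arr s' atup (i * n + t) = t \<and> arr s' aset (i * n + t) = i))"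
proof -
  let ?f = "k + 21" and ?K = "\<lambda>s cs t. map (\<lambda>c. arr s 0 (w * t + c)) cs"
  let ?y = "?f + 4 * length yc"
  let ?init = "Seq (Assign rn (Reg 0)) (Assign rm (times k (Reg 0)))"
  obtain C1 where C1: "\<And>s n ds. ?f > k + 20 \<Longrightarrow> reg s rn = n \<Longrightarrow> (\<forall>i<n. arr s amul i = i * n) \<Longrightarrow>
     (\<forall>a>?f. arr s a = (\<lambda>_. 0)) \<Longrightarrow> (\<forall>t<n. arr s ?f t = first (?K s ds) t) \<Longrightarrow>
     runs (chain ?f yc) s (C1 * (n + 1)) (\<lambda>s'. agree {rt, ri} {?f<..?y} s s' \<and>
       (\<forall>t<n. arr s' ?y t = first (?K s (ds @ yc)) t))"
    using runs_chain[of ?f yc] by blast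
  let ?post = "\<lambda>s n s'. agree {rt, ri} ({acls, atup, aset} \<union> {k + 22 + 4 * length yc..}) s s' \<and>
       (\<forall>i<length css. \<forall>t<n.
         arr s' acls ((0 + i) * n + t) = (0 + i) * n + first (?K s (css ! i)) t \<and>
         arr s' atup ((0 + i) * n + t) = t \<and> arr s' aset ((0 + i) * n + t) = 0 + i) \<and>
       (\<forall>N < 0 * n. arr s' acls N = arr s acls N \<and> arr s' atup N = arr s atup N \<and>
         arr s' aset N = arr s aset N)"
  obtain C2 where C2: "\<And>s n. k + 22 + 4 * length yc > k + 20 \<Longrightarrow> reg s rn = n \<Longrightarrow>
     (\<forall>i<n. arr s amul i = i * n) \<Longrightarrow> (\<forall>a\<ge>k + 22 + 4 * length yc. arr s a = (\<lambda>_. 0)) \<Longrightarrow>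
     runs (items (k + 22 + 4 * length yc) 0 css) s (C2 * (n + 1)) (?post s n)"
    using runs_items[of "k + 22 + 4 * length yc" 0 css] by blast
  show ?thesis
  proof (intro exI[of _ "bound ?init + (20 + (C1 + C2))"] allI impI)
    fix s :: state and n
    assume reg: "reg s = (\<lambda>_. 0)(0 := n)" and zero: "\<forall>a>0. arr s a = (\<lambda>_. 0)"
    let ?Q0 = "\<lambda>s1. agree {rn, rm} {} s s1 \<and> reg s1 rn = n \<and> reg s1 rm = k * n"
    let ?Q1 = "\<lambda>s1. agree {rn, rm, rt, ri} {amul} s s1 \<and> reg s1 rn = n \<and> reg s1 rm = k * n \<and>
      (\<forall>i<n. arr s1 amul i = i * n)"
    let ?Q2 = "\<lambda>s1. agree {rn, rm, rt, ri} ({amul} \<union> {?f<..?y}) s s1 \<and> reg s1 rn = n \<and>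
      reg s1 rm = k * n \<and> (\<forall>i<n. arr s1 amul i = i * n) \<and> (\<forall>t<n. arr s1 ?y t = first (?K s yc) t)"
    let ?Q3 = "\<lambda>s'. agree {rn, rm, rt, ri} ({amul, acls, atup, aset} \<union> {k + 21..}) s s' \<and>
      reg s' rn = n \<and> reg s' rm = k * n \<and> (\<forall>t<n. arr s' ?y t = first (?K s yc) t) \<and>
      (\<forall>i<length css. \<forall>t<n. arr s' acls (i * n + t) = i * n + first (?K s (css ! i)) t \<and>
        arr s' atup (i * n + t) = t \<and> arr s' aset (i * n + t) = i)"
    have 0: "runs ?init s (bound ?init * (n + 1)) ?Q0"
      using reg by (intro runs_loopfree) (auto simp: agree_def)
    have 1: "runs multiples s1 (20 * (n + 1)) ?Q1" if "?Q0 s1" for s1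
      by (rule runs_mono[OF runs_multiples order_refl]) (use that in \<open>auto simp: agree_def\<close>)
    have 2: "runs (chain ?f yc) s1 (C1 * (n + 1)) ?Q2" if Q1: "?Q1 s1" for s1
    proof -
      have "runs (chain ?f yc) s1 (C1 * (n + 1)) (\<lambda>s'. agree {rt, ri} {?f<..?y} s1 s' \<and>
       (\<forall>t<n. arr s' ?y t = first (?K s1 ([] @ yc)) t))"
        using Q1 zero by (intro C1) (auto simp: agree_def first_def)
      moreover have "arr s1 0 = arr s 0" using Q1 by (simp add: agree_def)
      ultimately show ?thesis
        by (elim runs_mono[OF _ order_refl]) (use Q1 in \<open>auto simp: agree_def\<close>)
    qed
    have 3: "runs (items (k + 22 + 4 * length yc) 0 css) s1 (C2 * (n + 1)) ?Q3" if Q2: "?Q2 s1" for s1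
    proof -
      have "runs (items (k + 22 + 4 * length yc) 0 css) s1 (C2 * (n + 1)) (?post s1 n)"
        using Q2 zero by (intro C2) (auto simp: agree_def)
      moreover have "arr s1 0 = arr s 0" using Q2 by (simp add: agree_def)
      ultimately show ?thesis
        by (elim runs_mono[OF _ order_refl]) (use Q2 in \<open>auto simp: agree_def\<close>)
    qed
    have "runs (index_program yc css) s
        (bound ?init * (n + 1) + (20 * (n + 1) + (C1 * (n + 1) + C2 * (n + 1)))) ?Q3"
      unfolding index_program_def
      by (rule runs_Seq[OF 0], rule runs_Seq[OF 1], assumption, rule runs_Seq[OF 2], assumption, rule 3)
    then show "runs (index_program yc css) s ((bound ?init + (20 + (C1 + C2))) * (n + 1)) ?Q3"
      by (rule runs_mono) (simp_all add: algebra_simps)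
  qed
qed

definition main_program :: "nat \<Rightarrow> com" where
  "main_program y = Seq (groups y) (Seq fill_buckets (main_loop y))"

lemma runs_main_program:
  fixes \<Psi> :: "(nat \<Rightarrow> nat) \<Rightarrow> nat \<Rightarrow> bool"
  assumes regs: "reg s rn = n" "reg s rm = m" "reg s rp = 0" "reg s rv = 0"
    and items: "\<And>N. N < m \<Longrightarrow> arr s acls N = cls N \<and> arr s atup N = N mod n \<and> arr s aset N = N div n"
    and rep: "\<And>t. t < n \<Longrightarrow> arr s y t < t \<longleftrightarrow> \<not> rep t"
    and zero: "\<And>a. a \<in> {anext, ahead, adeg, abucket, abnext, abgroup, aown} \<Longrightarrow> arr s a = (\<lambda>_. 0)"
    and m: "n dvd m" and y: "y > k + 20"
    and cls: "\<And>N. N < m \<Longrightarrow> cls N < m" "\<And>N. N < m \<Longrightarrow> cls N div n = N div n"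
    and \<Psi>: "\<Psi> (\<lambda>_. 0) 0"
    and step: "\<And>own v H. \<Psi> own v \<Longrightarrow> H < m \<Longrightarrow>
      (\<And>G. G < m \<Longrightarrow> {N \<in> live n m rep own. cls N = G} \<noteq> {} \<Longrightarrow>
        card {N \<in> live n m rep own. cls N = H} \<le> card {N \<in> live n m rep own. cls N = G}) \<Longrightarrow>
      \<Psi> (taken n cls H own) (max v (card {N \<in> live n m rep own. cls N = H}))"
  shows "runs (main_program y) s (1000 * (m + 1)) (\<lambda>s'. \<Psi> (arr s' aown) (reg s' rv) \<and>
    live n m rep (arr s' aown) = {} \<and>
    agree {rt, rG, rN, rp, rv, rd, re, rH}
      {anext, ahead, adeg, aown, abucket, abnext, abgroup} s s')"
proof -
  let ?L = "\<lambda>G. rev (filter (\<lambda>N. arr s acls N = G) [0..<m])"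
  let ?Q1 = "\<lambda>s1. agree {rN, rG} {anext, ahead, adeg} s s1 \<and>
    (\<forall>G. linked (arr s1 anext) (arr s1 ahead G) (?L G) \<and>
      arr s1 adeg G = card {N. N < m \<and> \<not> arr s y (arr s atup N) < arr s atup N \<and> arr s acls N = G})"
  let ?B = "\<lambda>s1 l. rev (filter (\<lambda>G. arr s1 adeg G = l) [0..<m])"
  let ?Q2 = "\<lambda>s1 s2. agree {rd, rG, re} {abucket, abnext, abgroup} s1 s2 \<and>
    reg s2 re = m \<and> (\<forall>G<m. arr s2 abgroup G = G) \<and>
    (\<forall>l. linked (arr s2 abnext) (arr s2 abucket l) (?B s1 l))"
  have 1: "runs (groups y) s (100 * (m + 1)) ?Q1"
    using regs y zero by (intro runs_groups) auto
  have 2: "runs fill_buckets s1 (100 * (m + 1)) (\<lambda>s2. ?Q1 s1 \<and> ?Q2 s1 s2)" if "?Q1 s1" for s1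
    by (rule runs_mono[OF runs_fill_buckets order_refl]) (use that regs zero in \<open>auto simp: agree_def\<close>)
  have 3: "runs (main_loop y) s2 (800 * (m + 1)) (\<lambda>s'. \<Psi> (arr s' aown) (reg s' rv) \<and>
      live n m rep (arr s' aown) = {} \<and>
      agree {rt, rG, rN, rp, rv, rd, re, rH}
        {anext, ahead, adeg, aown, abucket, abnext, abgroup} s s')"
    if Q1: "?Q1 s1" and Q2: "?Q2 s1 s2" for s1 s2
  proof -
    have own: "arr s2 aown = (\<lambda>_. 0)" using Q1 Q2 zero by (auto simp: agree_def)
    let ?A = "live n m rep (arr s2 aown)"
    have n: "n > 0" if "m > 0" using m that by (cases n) auto
    have same: "reg s2 rn = n" "reg s2 rm = m" "reg s2 rp = 0" "reg s2 rv = 0" "arr s2 acls = arr s acls"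
      "arr s2 atup = arr s atup" "arr s2 aset = arr s aset" "arr s2 y = arr s y"
      "arr s2 adeg = arr s1 adeg" "arr s2 anext = arr s1 anext" "arr s2 ahead = arr s1 ahead"
      using Q1 Q2 regs y by (auto simp: agree_def)
    \<comment> \<open>While all owners are 0, the items counted during initialization are exactly
      the live ones.\<close>
    have "N < m \<and> \<not> arr s y (arr s atup N) < arr s atup N \<and> arr s acls N = G \<longleftrightarrow>
        N \<in> ?A \<and> cls N = G" for N G
      using items[of N] rep[of "N mod n"] n by (cases "N < m") (auto simp: live_def own)
    then have "{N. N < m \<and> \<not> arr s y (arr s atup N) < arr s atup N \<and> arr s acls N = G} =
        {N \<in> ?A. cls N = G}" for G
      by blast
    then have deg: "arr s2 adeg G = card {N \<in> ?A. cls N = G}" for G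
      using Q1 same by simp
    have A: "?A \<subseteq> {..<m}" by (auto simp: live_def)
    have deg_le: "arr s2 adeg G \<le> m" for G
      using card_mono[of "{..<m}" "{N \<in> ?A. cls N = G}"] A unfolding deg by auto
    have "core y n m cls rep ?A {} (?B s1) ?L s2"
      unfolding core_def
    proof (intro conjI allI impI)
      show "group_lists m cls ?L s2"
        using Q1 items by (auto simp: group_lists_def same)
      show "bucket_lists m (?B s1) s2"
        using Q2 by (auto simp: bucket_lists_def)
      show "queued (?B s1) s2 G" if "G < m" for G
        unfolding queued_def same
      proof (intro impI conjI bexI)
        show "arr s2 abgroup G = G" using Q2 that by blast
      qed (use that in auto)
    qed (use same items rep deg A in auto)
    moreover have "listed n m cls ?L (arr s2 aown)"
      using items by (simp add: listed_def)
    \<comment> \<open>With \<open>rp\<close> at 0 the potential is at most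
      \<open>100 * (6 * m + 1)\<close>: \<open>m + 1\<close> for the position, \<open>m\<close> for
      each kind of list and \<open>3 * m\<close> for the live items.\<close>
    moreover have "potential m ?A (?B s1) ?L s2 + 50 \<le> 800 * (m + 1)"
    proof -
      have "(\<Sum>l\<le>m. length (?B s1 l)) \<le> m"
        using sum_length_filter_le[of "{..m}" "arr s1 adeg" "[0..<m]"] by simp
      moreover have "(\<Sum>G<m. length (?L G)) \<le> m"
        using sum_length_filter_le[of "{..<m}" "arr s acls" "[0..<m]"] by simp
      moreover have "card ?A \<le> m" using card_mono[OF _ A] by simp
      ultimately show ?thesis unfolding potential_def same by simp
    qed
    ultimately have "budget (main_loop y) s2 (800 * (m + 1)) (\<lambda>s' _. \<Psi> (arr s' aown) (reg s' rv) \<and>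
      live n m rep (arr s' aown) = {} \<and>
      agree {rt, rG, rN, rp, rv, rd, re, rH} {ahead, adeg, abucket, abnext, abgroup, aown} s2 s')"
      using \<Psi> by (intro budget_main_loop[where \<Psi> = \<Psi> and cls = cls and rep = rep and n = n, OF _ _ m cls y _ _ step]) (simp_all add: own same)
    from budget_runs[OF this] show ?thesis
      by (rule runs_mono) (use Q1 Q2 in \<open>auto simp: agree_def\<close>)
  qed
  have "runs (main_program y) s (100 * (m + 1) + (100 * (m + 1) + 800 * (m + 1)))
    (\<lambda>s'. \<Psi> (arr s' aown) (reg s' rv) \<and> live n m rep (arr s' aown) = {} \<and>
      agree {rt, rG, rN, rp, rv, rd, re, rH}
        {anext, ahead, adeg, aown, abucket, abnext, abgroup} s s')"
    unfolding main_program_def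
    by (rule runs_Seq[OF 1], rule runs_Seq[OF 2], assumption, elim conjE, rule 3, blast, blast)
  then show ?thesis by (rule runs_mono) simp_all
qed

text \<open>The index phase leaves the classes for \<open>Y\<close> in array
  \<open>k + 21 + 4 * length yc\<close>, four arrays per column after the first one.\<close>

definition program :: "nat list \<Rightarrow> nat list list \<Rightarrow> com" where
  "program yc css = Seq (index_program yc css)
     (Seq (main_program (k + 21 + 4 * length yc)) (Seq (outputs k) (Assign 0 (Reg rv))))"

definition key :: "(nat \<Rightarrow> nat) \<Rightarrow> nat list \<Rightarrow> nat \<Rightarrow> nat list" where
  "key inp cs t = map (\<lambda>c. inp (w * t + c)) cs"

definition group_of :: "nat \<Rightarrow> (nat \<Rightarrow> nat) \<Rightarrow> nat list list \<Rightarrow> nat \<Rightarrow> nat" where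
  "group_of n inp css N = N div n * n + first (key inp (css ! (N div n))) (N mod n)"

lemma group_of:
  assumes "N < k * n"
  shows "group_of n inp css N < k * n" "group_of n inp css N div n = N div n"
proof -
  have n: "0 < n" using assms by (cases n) auto
  then have f: "first (key inp (css ! (N div n))) (N mod n) < n" by (simp add: first_less)
  then show "group_of n inp css N div n = N div n" by (simp add: group_of_def)
  have "N div n < k" using assms n by (simp add: less_mult_imp_div_less)
  then have "Suc (N div n) * n \<le> k * n" by (intro mult_le_mono1) simp
  then show "group_of n inp css N < k * n" using f by (simp add: group_of_def)
qed

text \<open>\<open>C\<close> precedes the state, \<open>n\<close> and \<open>\<Psi>\<close>, so it
  depends on the layout and the column lists only. \<open>\<Psi>\<close> must be free to depend on
  the input, because \<open>reached\<close> refers to its tuples.\<close>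

lemma runs_program:
  assumes css: "length css = k"
  shows "\<exists>C. \<forall>s n \<Psi>. reg s = (\<lambda>_. 0)(0 := n) \<longrightarrow> (\<forall>a>0. arr s a = (\<lambda>_. 0)) \<longrightarrow> \<Psi> (\<lambda>_. 0) 0 \<longrightarrow>
    (let inp = arr s 0; m = k * n; cls = group_of n inp css; rep = (\<lambda>t. first (key inp yc) t = t) in
      (\<forall>own v H. \<Psi> own v \<longrightarrow> H < m \<longrightarrow>
        (\<forall>G<m. {N \<in> live n m rep own. cls N = G} \<noteq> {} \<longrightarrow>
          card {N \<in> live n m rep own. cls N = H} \<le> card {N \<in> live n m rep own. cls N = G}) \<longrightarrow>
        \<Psi> (taken n cls H own) (max v (card {N \<in> live n m rep own. cls N = H}))) \<longrightarrow>
      runs (program yc css) s (C * (n + 1)) (\<lambda>s'. \<exists>own. \<Psi> own (reg s' 0) \<and>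
        live n m rep own = {} \<and> (\<forall>j<k. written inp own n j s')))"
proof -
  let ?y = "k + 21 + 4 * length yc"
  obtain C1 where C1: "\<And>s n. reg s = (\<lambda>_. 0)(0 := n) \<Longrightarrow> (\<forall>a>0. arr s a = (\<lambda>_. 0)) \<Longrightarrow>
    runs (index_program yc css) s (C1 * (n + 1)) (\<lambda>s'.
      agree {rn, rm, rt, ri} ({amul, acls, atup, aset} \<union> {k + 21..}) s s' \<and>
      reg s' rn = n \<and> reg s' rm = k * n \<and>
      (\<forall>t<n. arr s' ?y t = first (\<lambda>t. map (\<lambda>c. arr s 0 (w * t + c)) yc) t) \<and>
      (\<forall>i<length css. \<forall>t<n.
        arr s' acls (i * n + t) = i * n + first (\<lambda>t. map (\<lambda>c. arr s 0 (w * t + c)) (css ! i)) t \<and>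
        arr s' atup (i * n + t) = t \<and> arr s' aset (i * n + t) = i))"
    using runs_index_program[of yc css] by blast
  obtain C2 where C2: "\<And>s n. k \<le> k \<Longrightarrow> reg s rn = n \<Longrightarrow> (\<forall>i<k. reg s (Suc i) = 0) \<Longrightarrow>
    runs (outputs k) s (C2 * (n + 1)) (\<lambda>s'. agree ({rt} \<union> {0<..k}) {0<..k} s s' \<and>
      (\<forall>i<k. written (arr s 0) (arr s aown) n i s'))"
    using runs_outputs[of k] by blast
  show ?thesis
    unfolding Let_def
  proof (intro exI[of _ "C1 + (1000 * (k + 1) + (C2 + 2))"] allI impI)
    fix s :: state and n and \<Psi> :: "(nat \<Rightarrow> nat) \<Rightarrow> nat \<Rightarrow> bool"
    let ?inp = "arr s 0" and ?m = "k * n" and ?cls = "group_of n (arr s 0) css"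
      and ?rep = "\<lambda>t. first (key (arr s 0) yc) t = t"
    assume reg: "reg s = (\<lambda>_. 0)(0 := n)" and zero: "\<forall>a>0. arr s a = (\<lambda>_. 0)" and \<Psi>: "\<Psi> (\<lambda>_. 0) 0"
      and step: "\<forall>own v H. \<Psi> own v \<longrightarrow> H < ?m \<longrightarrow>
        (\<forall>G<?m. {N \<in> live n ?m ?rep own. ?cls N = G} \<noteq> {} \<longrightarrow>
          card {N \<in> live n ?m ?rep own. ?cls N = H} \<le> card {N \<in> live n ?m ?rep own. ?cls N = G}) \<longrightarrow>
        \<Psi> (taken n ?cls H own) (max v (card {N \<in> live n ?m ?rep own. ?cls N = H}))"
    let ?Q1 = "\<lambda>s'. agree {rn, rm, rt, ri} ({amul, acls, atup, aset} \<union> {k + 21..}) s s' \<and>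
      reg s' rn = n \<and> reg s' rm = k * n \<and> (\<forall>t<n. arr s' ?y t = first (key ?inp yc) t) \<and>
      (\<forall>i<length css. \<forall>t<n. arr s' acls (i * n + t) = i * n + first (key ?inp (css ! i)) t \<and>
        arr s' atup (i * n + t) = t \<and> arr s' aset (i * n + t) = i)"
    let ?Q2 = "\<lambda>s'. \<Psi> (arr s' aown) (reg s' rv) \<and> live n ?m ?rep (arr s' aown) = {} \<and>
      reg s' rn = n \<and> (\<forall>i<k. reg s' (Suc i) = 0) \<and> arr s' 0 = ?inp"
    let ?Q3 = "\<lambda>s'. \<exists>own. \<Psi> own (reg s' rv) \<and> live n ?m ?rep own = {} \<and> (\<forall>j<k. written ?inp own n j s')"
    let ?Q4 = "\<lambda>s'. \<exists>own. \<Psi> own (reg s' 0) \<and> live n ?m ?rep own = {} \<and> (\<forall>j<k. written ?inp own n j s')"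
    have 1: "runs (index_program yc css) s (C1 * (n + 1)) ?Q1"
      using C1[OF reg zero] unfolding key_def .
    have 2: "runs (main_program ?y) s1 (1000 * (?m + 1)) ?Q2" if Q1: "?Q1 s1" for s1
    proof (rule runs_mono[OF runs_main_program[where \<Psi> = \<Psi> and n = n and m = ?m and rep = ?rep and cls = ?cls] order_refl])
      show "reg s1 rn = n" "reg s1 rm = ?m" "reg s1 rp = 0" "reg s1 rv = 0"
        using Q1 reg by (auto simp: agree_def)
      show "arr s1 acls N = ?cls N \<and> arr s1 atup N = N mod n \<and> arr s1 aset N = N div n" if "N < ?m" for N
      proof -
        have n: "0 < n" using that by (cases n) auto
        then have "N div n < length css" "N mod n < n" using that css by (simp_all add: less_mult_imp_div_less)
        moreover have "N div n * n + N mod n = N" by simp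
        ultimately show ?thesis using Q1 unfolding group_of_def by metis
      qed
      \<comment> \<open>The class name never exceeds \<open>t\<close>, so being smaller is the same
        as being different.\<close>
      show "arr s1 ?y t < t \<longleftrightarrow> \<not> ?rep t" if "t < n" for t
        using Q1 that first_le[of "key ?inp yc" t] by (auto simp: nat_less_le)
      show "arr s1 a = (\<lambda>_. 0)" if "a \<in> {anext, ahead, adeg, abucket, abnext, abgroup, aown}" for a
        using Q1 that zero by (auto simp: agree_def)
      show "n dvd ?m" "?y > k + 20" by simp_all
      show "\<Psi> (\<lambda>_. 0) 0" by fact
      show "?cls N < ?m" "?cls N div n = N div n" if "N < ?m" for N using group_of[OF that] .
      show "\<Psi> (taken n ?cls H own) (max v (card {N \<in> live n ?m ?rep own. ?cls N = H}))"
        if "\<Psi> own v" "H < ?m" "\<And>G. G < ?m \<Longrightarrow> {N \<in> live n ?m ?rep own. ?cls N = G} \<noteq> {} \<Longrightarrow>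
          card {N \<in> live n ?m ?rep own. ?cls N = H} \<le> card {N \<in> live n ?m ?rep own. ?cls N = G}" for own v H
        using step that by blast
      fix s2
      assume "\<Psi> (arr s2 aown) (reg s2 rv) \<and> live n ?m ?rep (arr s2 aown) = {} \<and>
        agree {rt, rG, rN, rp, rv, rd, re, rH} {anext, ahead, adeg, aown, abucket, abnext, abgroup} s1 s2"
      then show "?Q2 s2" using Q1 reg by (auto simp: agree_def)
    qed
    have 3: "runs (outputs k) s2 (C2 * (n + 1)) ?Q3" if Q2: "?Q2 s2" for s2
    proof (rule runs_mono[OF C2 order_refl])
      fix s3
      assume s3: "agree ({rt} \<union> {0<..k}) {0<..k} s2 s3 \<and> (\<forall>i<k. written (arr s2 0) (arr s2 aown) n i s3)"
      then have "reg s3 rv = reg s2 rv" by (simp add: agree_def)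
      then show "?Q3 s3" using Q2 s3 by (intro exI[of _ "arr s2 aown"]) simp
    qed (use Q2 in auto)
    have 4: "runs (Assign 0 (Reg rv)) s3 (2 * (n + 1)) ?Q4" if "?Q3 s3" for s3
      using that by (intro runs_loopfree) (auto simp: written_def)
    have "runs (program yc css) s (C1 * (n + 1) + (1000 * (?m + 1) + (C2 * (n + 1) + 2 * (n + 1)))) ?Q4"
      unfolding program_def
      by (rule runs_Seq[OF 1], rule runs_Seq[OF 2], assumption, rule runs_Seq[OF 3], assumption, rule 4)
    then show "runs (program yc css) s ((C1 + (1000 * (k + 1) + (C2 + 2))) * (n + 1)) ?Q4"
      by (rule runs_mono) (simp_all add: algebra_simps)
  qed
qed

end

section \<open>Approximate decomposition in linear time\<close>

definition columns :: "'a list \<Rightarrow> 'a set \<Rightarrow> nat list" where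
  "columns zs S = filter (\<lambda>c. zs ! c \<in> S) [0..<length zs]"

text \<open>\<open>enc\<close> is injective on the values occurring in \<open>R\<close>, so
  comparing codes column by column compares the tuples on \<open>S\<close>.\<close>

lemma columns_eq_iff:
  assumes "encoding (set zs) R enc" "t \<in> R" "u \<in> R" "S \<subseteq> set zs"
  shows "map (\<lambda>c. enc (t (zs ! c))) (columns zs S) = map (\<lambda>c. enc (u (zs ! c))) (columns zs S) \<longleftrightarrow>
    restrict t S = restrict u S"
proof -
  have "enc (t x) = enc (u x) \<longleftrightarrow> t x = u x" if "x \<in> S" for x
  proof -
    have "t x \<in> (\<Union>t\<in>R. t ` set zs)" "u x \<in> (\<Union>t\<in>R. t ` set zs)"
      using that assms by auto
    then show ?thesis using assms(1) unfolding encoding_def by (rule inj_on_eq_iff[rotated])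
  qed
  then have "(\<forall>x\<in>S. enc (t x) = enc (u x)) \<longleftrightarrow> (\<forall>x\<in>S. t x = u x)" by simp
  moreover have "(\<forall>c\<in>set (columns zs S). enc (t (zs ! c)) = enc (u (zs ! c))) \<longleftrightarrow>
      (\<forall>x\<in>S. enc (t x) = enc (u x))"
  proof -
    have "(!) zs ` set (columns zs S) = S"
      using assms(4) by (auto simp: columns_def in_set_conv_nth image_iff subset_iff)
    then show ?thesis by (metis (no_types, lifting) image_iff)
  qed
  moreover have "restrict t S = restrict u S \<longleftrightarrow> (\<forall>x\<in>S. t x = u x)"
    by (auto simp: restrict_def fun_eq_iff)
  ultimately show ?thesis by (simp add: map_eq_conv)
qed

lemma adec_program:
  assumes sub: "\<X> \<subseteq> Pow Y" "Y \<subseteq> Z" and ne: "\<X> \<noteq> {}"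
    and zs: "distinct zs" "set zs = Z" and Xs: "distinct Xs" "set Xs = \<X>"
  shows "\<exists>prog c. \<forall>(R :: ('a \<Rightarrow> 'v) set) enc s.
    relation Z R \<and> encoding Z R enc \<and> input_state enc zs R s \<longrightarrow>
    (\<exists>t s' P v. exec prog s t s' \<and> t \<le> c * (card R + 1) \<and>
       adec_result \<X> Y R P v \<and> output_state enc zs Xs P v s')"
proof -
  define k w where "k = length Xs" and "w = length zs"
  define css where "css = map (columns zs) Xs"
  interpret layout k w .
  let ?yc = "columns zs Y"
  have len: "length css = k" by (simp add: css_def k_def)
  from runs_program[OF this, of ?yc] obtain C where C: "\<And>s n \<Psi>. reg s = (\<lambda>_. 0)(0 := n) \<Longrightarrow> (\<forall>a>0. arr s a = (\<lambda>_. 0)) \<Longrightarrow>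
    \<Psi> (\<lambda>_. 0) 0 \<Longrightarrow>
    (let inp = arr s 0; m = k * n; cls = group_of n inp css; rep = (\<lambda>t. first (key inp ?yc) t = t) in
      (\<forall>own v H. \<Psi> own v \<longrightarrow> H < m \<longrightarrow>
        (\<forall>G<m. {N \<in> live n m rep own. cls N = G} \<noteq> {} \<longrightarrow>
          card {N \<in> live n m rep own. cls N = H} \<le> card {N \<in> live n m rep own. cls N = G}) \<longrightarrow>
        \<Psi> (taken n cls H own) (max v (card {N \<in> live n m rep own. cls N = H}))) \<longrightarrow>
      runs (program ?yc css) s (C * (n + 1)) (\<lambda>s'. \<exists>own. \<Psi> own (reg s' 0) \<and>
        live n m rep own = {} \<and> (\<forall>j<k. written inp own n j s')))"
    by blast
  have "\<exists>t s' P v. exec (program ?yc css) s t s' \<and> t \<le> C * (card R + 1) \<and>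
       adec_result \<X> Y R P v \<and> output_state enc zs Xs P v s'"
    if "relation Z R" and enc: "encoding Z R enc" and inp: "input_state enc zs R s"
    for R :: "('a \<Rightarrow> 'v) set" and enc s
  proof -
    define n where "n = card R"
    obtain ts where tuples: "distinct ts" "set ts = R" "length ts = n"
      and arr0: "\<And>t c. t < n \<Longrightarrow> c < w \<Longrightarrow> arr s 0 (w * t + c) = enc ((ts ! t) (zs ! c))"
      using inp unfolding input_state_def holds_relation_def n_def w_def by (auto simp: mult.commute)
    have reg: "reg s = (\<lambda>_. 0)(0 := n)" and zero: "\<forall>a>0. arr s a = (\<lambda>_. 0)"
      using inp by (auto simp: input_state_def n_def)
    let ?inp = "arr s 0"
    let ?m = "k * n" and ?cls = "group_of n ?inp css" and ?rep = "\<lambda>t. first (key ?inp ?yc) t = t"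
    have key_iff: "key ?inp (columns zs S) t = key ?inp (columns zs S) u \<longleftrightarrow>
        restrict (ts ! t) S = restrict (ts ! u) S" if "t < n" "u < n" "S \<subseteq> Z" for t u S
    proof -
      have "key ?inp (columns zs S) t = map (\<lambda>c. enc ((ts ! t) (zs ! c))) (columns zs S)" if "t < n" for t
        using arr0[OF that] unfolding key_def by (simp add: columns_def w_def)
      moreover have "ts ! t \<in> R" "ts ! u \<in> R" using that tuples nth_mem by metis+
      ultimately show ?thesis
        using columns_eq_iff[of zs R enc "ts ! t" "ts ! u" S] that enc zs(2) tuples by simp
    qed
    have item: "(j * n + t) div n = j" "(j * n + t) mod n = t" if "t < n" for j t
      using that by simp_all
    interpret adec_items \<X> Y ts Xs n ?m ?cls ?rep
    proof
      show "?m = length Xs * n" by (simp add: k_def)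
      show "?cls N < ?m" "?cls N div n = N div n" if "N < ?m" for N using group_of[OF that] .
      show "?cls (j * n + t) = ?cls (j * n + u) \<longleftrightarrow> restrict (ts ! t) (Xs ! j) = restrict (ts ! u) (Xs ! j)"
        if "j < length Xs" "t < n" "u < n" for j t u
      proof -
        have "Xs ! j \<subseteq> Z" using that(1) Xs sub nth_mem by fastforce
        then show ?thesis
          using key_iff[OF that(2,3)] that(1) by (simp add: group_of_def item that css_def first_eq_iff)
      qed
      show "\<exists>u<n. ?rep u \<and> restrict (ts ! u) Y = restrict (ts ! t) Y" if "t < n" for t
      proof (intro exI conjI)
        let ?u = "first (key ?inp ?yc) t"
        show u: "?u < n" using that by (rule first_less)
        show "?rep ?u" by (simp add: first_eq_iff)
        show "restrict (ts ! ?u) Y = restrict (ts ! t) Y"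
          using key_iff[OF u that sub(2)] by simp
      qed
      show "t = u" if "t < n" "u < n" "?rep t" "?rep u" "restrict (ts ! t) Y = restrict (ts ! u) Y" for t u
      proof -
        have "first (key ?inp ?yc) t = first (key ?inp ?yc) u"
          using key_iff[OF that(1,2) sub(2)] that(5) by (simp add: first_eq_iff)
        then show ?thesis using that by simp
      qed
    qed (use sub Xs tuples in auto)
    \<comment> \<open>Here \<open>\<Psi>\<close> becomes \<open>reached\<close>, which turns the run
      of the machine into a run of the algorithm.\<close>
    have "runs (program ?yc css) s (C * (n + 1)) (\<lambda>s'. \<exists>own. reached own (reg s' 0) \<and>
        live n ?m ?rep own = {} \<and> (\<forall>j<k. written ?inp own n j s'))"
      using C[OF reg zero, of reached, unfolded Let_def] reached_init[OF ne] reached_taken by blast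
    then obtain t s' own where run: "exec (program ?yc css) s t s'" "t \<le> C * (n + 1)"
      and reached: "reached own (reg s' 0)" "live n ?m ?rep own = {}"
      and written: "\<And>j. j < k \<Longrightarrow> written ?inp own n j s'"
      unfolding runs_def by blast
    have "adec_result \<X> Y R (parts own) (reg s' 0)"
      using reached_result[OF reached ne] tuples(2) by simp
    moreover have "output_state enc zs Xs (parts own) (reg s' 0) s'"
      unfolding output_state_def
    proof (intro conjI allI impI)
      fix j assume j: "j < length Xs"
      let ?ix = "filter (\<lambda>t. own t = Suc j) [0..<n]"
      have ix: "reg s' (Suc j) = length ?ix"
        and out: "\<And>i c. i < length ?ix \<Longrightarrow> c < w \<Longrightarrow> arr s' (Suc j) (w * i + c) = ?inp (w * (?ix ! i) + c)"
        using written[of j] j by (auto simp: written_def Let_def k_def)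
      have ix_less: "?ix ! i < n" if "i < length ?ix" for i
        using nth_mem[OF that] by auto
      have "distinct (map ((!) ts) ?ix)"
        using ts by (auto simp: distinct_map inj_on_def nth_eq_iff_index_eq)
      moreover have "set (map ((!) ts) ?ix) = parts own (Xs ! j)"
        using Xs(1) j by (auto simp: parts_def nth_eq_iff_index_eq)
      moreover have "arr s' (Suc j) (i * length zs + c) = enc ((map ((!) ts) ?ix ! i) (zs ! c))"
        if "i < length ?ix" "c < length zs" for i c
        using out[OF that(1), of c] arr0[OF ix_less[OF that(1)], of c] that by (simp add: w_def mult.commute)
      ultimately show "holds_relation enc zs (arr s' (j + 1)) (reg s' (j + 1)) (parts own (Xs ! j))"
        unfolding holds_relation_def by (intro exI[of _ "map ((!) ts) ?ix"]) (simp add: ix)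
    qed simp
    ultimately show ?thesis using run unfolding n_def by blast
  qed
  then show ?thesis by blast
qed

text \<open>An empty family cannot partition a nonempty relation, whence
  \<open>\<X> \<noteq> {}\<close>. The summand 1 in the time bound accounts for the empty input, on
  which a program also takes time. The program may depend on the enumerations \<open>zs\<close> and
  \<open>Xs\<close>, but not on the relation, the encoding or the state.\<close>

theorem theorem14:
  fixes Z Y :: "'a set" and \<X> :: "'a set set"
  assumes "finite Z" and "Y \<subseteq> Z" and "\<X> \<subseteq> Pow Y" and "\<X> \<noteq> {}"
  shows
    "(\<forall>R :: ('a \<Rightarrow> 'v) set. relation Z R \<longrightarrow>
        adec_terminates \<X> Y R \<and>
        (\<forall>P v. adec_result \<X> Y R P v \<longrightarrow>
           is_partition \<X> R P \<and>
           (\<forall>X\<in>\<X>. DC (P X) X Y (card \<X> * PC R \<X> Y)))) \<and>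
     (\<forall>zs Xs. distinct zs \<and> set zs = Z \<and> distinct Xs \<and> set Xs = \<X> \<longrightarrow>
        (\<exists>prog c. \<forall>(R :: ('a \<Rightarrow> 'v) set) enc s.
           relation Z R \<and> encoding Z R enc \<and> input_state enc zs R s \<longrightarrow>
           (\<exists>t s' P v. exec prog s t s' \<and> t \<le> c * (card R + 1) \<and>
              adec_result \<X> Y R P v \<and> output_state enc zs Xs P v s')))"
proof (intro conjI allI impI)
  have fin: "finite \<X>" using assms(1-3) by (meson finite_Pow_iff finite_subset)
  fix R :: "('a \<Rightarrow> 'v) set" assume "relation Z R"
  then have R: "finite R" by (simp add: relation_def)
  show "adec_terminates \<X> Y R" using adec_terminates[OF fin assms(4,3) R] .
  fix P v assume "adec_result \<X> Y R P v"
  from adec_result_correct[OF fin assms(3) R this]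
  show "is_partition \<X> R P" "\<forall>X\<in>\<X>. DC (P X) X Y (card \<X> * PC R \<X> Y)" .
next
  fix zs Xs assume "distinct zs \<and> set zs = Z \<and> distinct Xs \<and> set Xs = \<X>"
  then show "\<exists>prog c. \<forall>(R :: ('a \<Rightarrow> 'v) set) enc s.
           relation Z R \<and> encoding Z R enc \<and> input_state enc zs R s \<longrightarrow>
           (\<exists>t s' P v. exec prog s t s' \<and> t \<le> c * (card R + 1) \<and>
              adec_result \<X> Y R P v \<and> output_state enc zs Xs P v s')"
    using adec_program[OF assms(3,2,4)] by blast
qed

end
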